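(* Let $R$ be a commutative unital ring, $a \in R$, and let $n \in \mathbb{N}$ be odd. Consider the Temperley--Lieb algebra $\mathcal{TL}_n(a)$ on $n$ strands and its trivial module $\mathds{1}$. Then $$H_0(\mathcal{TL}_n(a), \mathds{1}) = R \quad\text{and}\quad H_\star(\mathcal{TL}_n(a), \mathds{1}) = 0 \text{ for all } \star > 0,$$ where $H_\star(\mathcal{TL}_n(a), \mathds{1}) = \operatorname{Tor}^{\mathcal{TL}_n(a)}_\star(\mathds{1}, \mathds{1})$ (identifications as $R$-modules).
   Context: Let $R$ be a commutative unital ring, $a \in R$ and $n \in \mathbb{N}$. The Temperley--Lieb algebra $\mathcal{TL}_n(a)$ is the associative unital $R$-algebra with generators $U_1, \dots, U_{n-1}$ and relations: (1) $U_iU_j = U_jU_i$ if $|i-j| \geq 2$; (2) $U_iU_jU_i = U_i$ if $j = i \pm 1$; (3) $U_i^2 = aU_i$ for all $i$. In particular $\mathcal{TL}_0(a) = \mathcal{TL}_1(a) = R$. The trivial module $\mathds{1}$ is $R$ regarded as a (left or right) $\mathcal{TL}_n(a)$-module via the $R$-algebra augmentation $\epsilon: \mathcal{TL}_n(a) \to R$ sending every generator $U_i$ to $0$; equivalently $\mathds{1} = \mathcal{TL}_n(a)/\widehat{\mathcal{TL}}_n$, where $\widehat{\mathcal{TL}}_n$ is the two-sided ideal generated by $U_1, \dots, U_{n-1}$. For a left $\mathcal{TL}_n(a)$-module $N$, $H_\star(\mathcal{TL}_n(a), N) = \operatorname{Tor}^{\mathcal{TL}_n(a)}_\star(\mathds{1},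 N)$, with $\mathds{1}$ the right trivial module. *)

theory Defs
  imports "HOL-Algebra.Module" "HOL-Algebra.QuotRing" "HOL-Library.FSet"
begin

section \<open>Conventions\<close>

text \<open>
  Modules over a possibly noncommutative ring are carried by the record type \<^typ>\<open>('a, 'm) module\<close>;
  only its fields \<open>carrier\<close>, \<open>add\<close>, \<open>zero\<close> and \<open>smult\<close> are meaningful for modules. For a left module
  \<open>a \<odot>\<^bsub>M\<^esub> x\<close> denotes \<open>a x\<close>, for a right module it denotes \<open>x a\<close>. The same record type also
  describes an associative algebra \<open>A\<close> over a commutative ring \<open>R\<close>, and then all of its fields are used.
\<close>

definition ring_as_module :: "('r, 'z) ring_scheme \<Rightarrow> ('a \<Rightarrow> 'r) \<Rightarrow> ('a, 'r) module" where
  "ring_as_module R \<phi> =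
    \<lparr>carrier = carrier R, monoid.mult = monoid.mult R, one = one R,
     ring.zero = ring.zero R, ring.add = ring.add R, smult = (\<lambda>a x. \<phi> a \<otimes>\<^bsub>R\<^esub> x)\<rparr>"

definition module_iso ::
  "('r, 'z) ring_scheme \<Rightarrow> ('r, 'm) module \<Rightarrow> ('r, 'k) module \<Rightarrow> ('m \<Rightarrow> 'k) set" where
  "module_iso R M N =
    {h \<in> iso (add_monoid M) (add_monoid N).
      \<forall>r\<in>carrier R. \<forall>x\<in>carrier M. h (r \<odot>\<^bsub>M\<^esub> x) = r \<odot>\<^bsub>N\<^esub> h x}"

definition submodule_span ::
  "('r, 'z) ring_scheme \<Rightarrow> ('r, 'm) module \<Rightarrow> 'm set \<Rightarrow> 'm set" where
  "submodule_span R M S = \<Inter>{H. submodule H R M \<and> S \<subseteq> H}"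

text \<open>
  The quotient by a submodule, or, if \<open>M\<close> is an algebra, by a two-sided ideal: this is
  \<open>M Quot I\<close> with the induced scalar multiplication on cosets.
\<close>

definition quotient :: "('a, 'm) module \<Rightarrow> 'm set \<Rightarrow> ('a, 'm set) module" where
  "quotient M I =
    \<lparr>carrier = carrier (M Quot I), monoid.mult = monoid.mult (M Quot I), one = one (M Quot I),
     ring.zero = ring.zero (M Quot I), ring.add = ring.add (M Quot I),
     smult = (\<lambda>a C. \<Union>x\<in>C. I +>\<^bsub>M\<^esub> (a \<odot>\<^bsub>M\<^esub> x))\<rparr>"


section \<open>Free modules\<close>

text \<open>
  The free right \<open>A\<close>-module on \<open>X\<close>: finitely supported functions, with \<open>a\<close> acting by right
  multiplication on the coefficients. If \<open>A\<close> is commutative, this is the free \<open>A\<close>-module on \<open>X\<close>.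
\<close>

definition free_module :: "('a, 'z) ring_scheme \<Rightarrow> 'x set \<Rightarrow> ('a, 'x \<Rightarrow> 'a) module" where
  "free_module A X =
    \<lparr>carrier = {f. range f \<subseteq> carrier A \<and> finite {x. f x \<noteq> \<zero>\<^bsub>A\<^esub>} \<and> {x. f x \<noteq> \<zero>\<^bsub>A\<^esub>} \<subseteq> X},
     monoid.mult = undefined, one = undefined,
     ring.zero = (\<lambda>x. \<zero>\<^bsub>A\<^esub>), ring.add = (\<lambda>f g x. f x \<oplus>\<^bsub>A\<^esub> g x),
     smult = (\<lambda>a f x. f x \<otimes>\<^bsub>A\<^esub> a)\<rparr>"

definition basis_vector :: "('a, 'z) ring_scheme \<Rightarrow> 'x \<Rightarrow> 'x \<Rightarrow> 'a" where
  "basis_vector A x = (\<lambda>y. if y = x then \<one>\<^bsub>A\<^esub> else \<zero>\<^bsub>A\<^esub>)"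

text \<open>The linear map out of a free module sending the basis vector at \<open>x\<close> to \<open>g x\<close>:\<close>

definition linear_ext ::
  "('a, 'z) ring_scheme \<Rightarrow> ('a, 'm) module \<Rightarrow> ('x \<Rightarrow> 'm) \<Rightarrow> ('x \<Rightarrow> 'a) \<Rightarrow> 'm" where
  "linear_ext A M g f = (\<Oplus>\<^bsub>M\<^esub>x\<in>{x. f x \<noteq> \<zero>\<^bsub>A\<^esub>}. f x \<odot>\<^bsub>M\<^esub> g x)"


section \<open>Temperley--Lieb algebras\<close>

text \<open>
  The free associative unital \<open>R\<close>-algebra on \<open>X\<close>: the free module on the words over \<open>X\<close> (a word
  being the product of its letters), with the convolution product.
\<close>

definition free_algebra :: "('r, 'z) ring_scheme \<Rightarrow> 'x set \<Rightarrow> ('r, 'x list \<Rightarrow> 'r) module" where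
  "free_algebra R X = (free_module R (lists X))
    \<lparr>monoid.mult := (\<lambda>f g w. \<Oplus>\<^bsub>R\<^esub>i\<in>{..length w}. f (take i w) \<otimes>\<^bsub>R\<^esub> g (drop i w)),
     one := basis_vector R []\<rparr>"

text \<open>The letter \<open>i\<close>, for \<open>1 \<le> i < n\<close>, stands for the generator \<open>U\<^sub>i\<close>.\<close>

definition tl_relations :: "('r, 'z) ring_scheme \<Rightarrow> nat \<Rightarrow> 'r \<Rightarrow> (nat list \<Rightarrow> 'r) set" where
  "tl_relations R n a =
    (let F = free_algebra R {1..<n}; U = (\<lambda>i. basis_vector R [i]) in
      {U i \<otimes>\<^bsub>F\<^esub> U j \<ominus>\<^bsub>F\<^esub> U j \<otimes>\<^bsub>F\<^esub> U i | i j.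
        i \<in> {1..<n} \<and> j \<in> {1..<n} \<and> \<bar>int i - int j\<bar> \<ge> 2} \<union>
      {U i \<otimes>\<^bsub>F\<^esub> U j \<otimes>\<^bsub>F\<^esub> U i \<ominus>\<^bsub>F\<^esub> U i | i j.
        i \<in> {1..<n} \<and> j \<in> {1..<n} \<and> (j = i + 1 \<or> i = j + 1)} \<union>
      {U i \<otimes>\<^bsub>F\<^esub> U i \<ominus>\<^bsub>F\<^esub> a \<odot>\<^bsub>F\<^esub> U i | i. i \<in> {1..<n}})"

definition temperley_lieb ::
  "('r, 'z) ring_scheme \<Rightarrow> nat \<Rightarrow> 'r \<Rightarrow> ('r, (nat list \<Rightarrow> 'r) set) module" where
  "temperley_lieb R n a =
    quotient (free_algebra R {1..<n}) (genideal (free_algebra R {1..<n}) (tl_relations R n a))"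

text \<open>
  The algebra map sending every \<open>U\<^sub>i\<close> to \<open>0\<close> is, on the free algebra, the constant coefficient;
  it vanishes on the relations and hence is constant on each coset.
\<close>

definition augmentation :: "('x list \<Rightarrow> 'r) set \<Rightarrow> 'r" where
  "augmentation C = the_elem ((\<lambda>f. f []) ` C)"

text \<open>Since \<open>R\<close> is commutative, the left and the right trivial module are the same record.\<close>

definition trivial_module ::
  "('r, 'z) ring_scheme \<Rightarrow> ((nat list \<Rightarrow> 'r) set, 'r) module" where
  "trivial_module R = ring_as_module R augmentation"


section \<open>Tensor products\<close>

text \<open>
  For an \<open>R\<close>-algebra \<open>A\<close>, a right \<open>A\<close>-module \<open>M\<close> and a left \<open>A\<close>-module \<open>N\<close>, the \<open>R\<close>-module
  \<open>M \<otimes>\<^sub>A N\<close> is generated by the symbols \<open>x \<otimes> y\<close> subject to the following relations, where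
  \<open>R\<close> acts on \<open>M\<close> through \<open>r \<mapsto> r 1\<^sub>A\<close>.
\<close>

definition tensor_relations ::
  "('r, 'z) ring_scheme \<Rightarrow> ('r, 'a) module \<Rightarrow> ('a, 'm) module \<Rightarrow> ('a, 'k) module
    \<Rightarrow> ('m \<times> 'k \<Rightarrow> 'r) set" where
  "tensor_relations R A M N =
    (let F = free_module R (carrier M \<times> carrier N); e = (\<lambda>x y. basis_vector R (x, y)) in
      {e (x \<oplus>\<^bsub>M\<^esub> x') y \<ominus>\<^bsub>F\<^esub> (e x y \<oplus>\<^bsub>F\<^esub> e x' y) | x x' y.
        x \<in> carrier M \<and> x' \<in> carrier M \<and> y \<in> carrier N} \<union>
      {e x (y \<oplus>\<^bsub>N\<^esub> y') \<ominus>\<^bsub>F\<^esub> (e x y \<oplus>\<^bsub>F\<^esub> e x y') | x y y'.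
        x \<in> carrier M \<and> y \<in> carrier N \<and> y' \<in> carrier N} \<union>
      {e (c \<odot>\<^bsub>M\<^esub> x) y \<ominus>\<^bsub>F\<^esub> e x (c \<odot>\<^bsub>N\<^esub> y) | x c y.
        x \<in> carrier M \<and> c \<in> carrier A \<and> y \<in> carrier N} \<union>
      {e ((r \<odot>\<^bsub>A\<^esub> \<one>\<^bsub>A\<^esub>) \<odot>\<^bsub>M\<^esub> x) y \<ominus>\<^bsub>F\<^esub> r \<odot>\<^bsub>F\<^esub> e x y | r x y.
        r \<in> carrier R \<and> x \<in> carrier M \<and> y \<in> carrier N})"

definition tensor_kernel ::
  "('r, 'z) ring_scheme \<Rightarrow> ('r, 'a) module \<Rightarrow> ('a, 'm) module \<Rightarrow> ('a, 'k) module
    \<Rightarrow> ('m \<times> 'k \<Rightarrow> 'r) set" where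
  "tensor_kernel R A M N =
    submodule_span R (free_module R (carrier M \<times> carrier N)) (tensor_relations R A M N)"

definition tensor ::
  "('r, 'z) ring_scheme \<Rightarrow> ('r, 'a) module \<Rightarrow> ('a, 'm) module \<Rightarrow> ('a, 'k) module
    \<Rightarrow> ('r, ('m \<times> 'k \<Rightarrow> 'r) set) module" where
  "tensor R A M N = quotient (free_module R (carrier M \<times> carrier N)) (tensor_kernel R A M N)"

definition pure_tensor ::
  "('r, 'z) ring_scheme \<Rightarrow> ('r, 'a) module \<Rightarrow> ('a, 'm) module \<Rightarrow> ('a, 'k) module
    \<Rightarrow> 'm \<Rightarrow> 'k \<Rightarrow> ('m \<times> 'k \<Rightarrow> 'r) set" where
  "pure_tensor R A M N x y =
    tensor_kernel R A M N +>\<^bsub>free_module R (carrier M \<times> carrier N)\<^esub> basis_vector R (x, y)"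

text \<open>The map \<open>\<phi> \<otimes> id : M \<otimes>\<^sub>A N \<rightarrow> M' \<otimes>\<^sub>A N\<close> induced by an \<open>A\<close>-linear map \<open>\<phi> : M \<rightarrow> M'\<close>:\<close>

definition tensor_map ::
  "('r, 'z) ring_scheme \<Rightarrow> ('r, 'a) module \<Rightarrow> ('a, 'k) module \<Rightarrow> ('a, 'm') module
    \<Rightarrow> ('m \<Rightarrow> 'm') \<Rightarrow> ('m \<times> 'k \<Rightarrow> 'r) set \<Rightarrow> ('m' \<times> 'k \<Rightarrow> 'r) set" where
  "tensor_map R A N M' \<phi> C =
    the_elem (linear_ext R (tensor R A M' N) (\<lambda>(x, y). pure_tensor R A M' N (\<phi> x) y) ` C)"


section \<open>The canonical free resolution and Tor\<close>

text \<open>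
  Every right \<open>A\<close>-module \<open>M\<close> has the free resolution
  \<open>\<dots> \<rightarrow> F\<^sub>2 \<rightarrow> F\<^sub>1 \<rightarrow> F\<^sub>0 \<rightarrow> M\<close> in which \<open>F\<^sub>0\<close> is free on the set of all elements of \<open>M\<close> and
  \<open>F\<^sub>k\<^sub>+\<^sub>1\<close> is free on the set of all elements of the kernel \<open>Z\<^sub>k\<close> of the map out of \<open>F\<^sub>k\<close>.
  To have all these bases inside one type, an element \<open>f\<close> of \<open>Z\<^sub>k\<close>, which is a finitely supported
  function on basis elements, is named by the finite graph of its restriction to its support.
\<close>

datatype ('a, 'm) gen = Elem 'm | Syz "(('a, 'm) gen \<times> 'a) fset"

definition syz :: "('a, 'z) ring_scheme \<Rightarrow> (('a, 'm) gen \<Rightarrow> 'a) \<Rightarrow> ('a, 'm) gen" where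
  "syz A f = Syz (Abs_fset ((\<lambda>x. (x, f x)) ` {x. f x \<noteq> \<zero>\<^bsub>A\<^esub>}))"

text \<open>
  \<open>res_cycles A M k\<close> is the kernel \<open>Z\<^sub>k\<close>. The maps \<open>F\<^sub>0 \<rightarrow> M\<close> and \<open>F\<^sub>k\<^sub>+\<^sub>1 \<rightarrow> F\<^sub>k\<close> send the
  basis vector named by an element to that element; their values in \<open>F\<^sub>k\<close> are computed in the
  free module on all names, which contains \<open>F\<^sub>k\<close>.
\<close>

primrec res_cycles ::
  "('a, 'z) ring_scheme \<Rightarrow> ('a, 'm) module \<Rightarrow> nat \<Rightarrow> (('a, 'm) gen \<Rightarrow> 'a) set" where
  "res_cycles A M 0 =
    a_kernel (free_module A (Elem ` carrier M)) M
      (linear_ext A M (inv_into (carrier M) Elem))"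
| "res_cycles A M (Suc k) =
    a_kernel (free_module A (syz A ` res_cycles A M k)) (free_module A UNIV)
      (linear_ext A (free_module A UNIV) (inv_into (res_cycles A M k) (syz A)))"

definition res_module ::
  "('a, 'z) ring_scheme \<Rightarrow> ('a, 'm) module \<Rightarrow> nat \<Rightarrow> ('a, ('a, 'm) gen \<Rightarrow> 'a) module" where
  "res_module A M k =
    free_module A (case k of 0 \<Rightarrow> Elem ` carrier M | Suc j \<Rightarrow> syz A ` res_cycles A M j)"

text \<open>The differential \<open>F\<^sub>k\<^sub>+\<^sub>1 \<rightarrow> F\<^sub>k\<close>:\<close>

definition res_diff ::
  "('a, 'z) ring_scheme \<Rightarrow> ('a, 'm) module \<Rightarrow> nat \<Rightarrow> (('a, 'm) gen \<Rightarrow> 'a) \<Rightarrow> ('a, 'm) gen \<Rightarrow> 'a" where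
  "res_diff A M k = linear_ext A (free_module A UNIV) (inv_into (res_cycles A M k) (syz A))"

type_synonym ('r, 'a, 'm, 'k) tor_chain = "((('a, 'm) gen \<Rightarrow> 'a) \<times> 'k \<Rightarrow> 'r) set"

definition tor_chains ::
  "('r, 'z) ring_scheme \<Rightarrow> ('r, 'a) module \<Rightarrow> ('a, 'm) module \<Rightarrow> ('a, 'k) module \<Rightarrow> nat
    \<Rightarrow> ('r, ('r, 'a, 'm, 'k) tor_chain) module" where
  "tor_chains R A M N k = tensor R A (res_module A M k) N"

definition tor_diff ::
  "('r, 'z) ring_scheme \<Rightarrow> ('r, 'a) module \<Rightarrow> ('a, 'm) module \<Rightarrow> ('a, 'k) module \<Rightarrow> nat
    \<Rightarrow> ('r, 'a, 'm, 'k) tor_chain \<Rightarrow> ('r, 'a, 'm, 'k) tor_chain" where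
  "tor_diff R A M N k = tensor_map R A N (res_module A M k) (res_diff A M k)"

definition tor_cycles ::
  "('r, 'z) ring_scheme \<Rightarrow> ('r, 'a) module \<Rightarrow> ('a, 'm) module \<Rightarrow> ('a, 'k) module \<Rightarrow> nat
    \<Rightarrow> ('r, 'a, 'm, 'k) tor_chain set" where
  "tor_cycles R A M N k =
    (case k of
      0 \<Rightarrow> carrier (tor_chains R A M N 0)
    | Suc j \<Rightarrow> a_kernel (tor_chains R A M N (Suc j)) (tor_chains R A M N j) (tor_diff R A M N j))"

definition Tor ::
  "('r, 'z) ring_scheme \<Rightarrow> ('r, 'a) module \<Rightarrow> ('a, 'm) module \<Rightarrow> ('a, 'k) module \<Rightarrow> nat
    \<Rightarrow> ('r, ('r, 'a, 'm, 'k) tor_chain set) module" where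
  "Tor R A M N k =
    quotient ((tor_chains R A M N k)\<lparr>carrier := tor_cycles R A M N k\<rparr>)
      (tor_diff R A M N k ` carrier (tor_chains R A M N (Suc k)))"

definition tl_homology ::
  "('r, 'z) ring_scheme \<Rightarrow> nat \<Rightarrow> 'r \<Rightarrow> ((nat list \<Rightarrow> 'r) set, 'k) module \<Rightarrow> nat
    \<Rightarrow> ('r, ('r, (nat list \<Rightarrow> 'r) set, 'r, 'k) tor_chain set) module" where
  "tl_homology R n a N k = Tor R (temperley_lieb R n a) (trivial_module R) N k"

end

theory Submission
  imports Defs
begin

text \<open>
  Call a right module \<open>M\<close> separated if
  \<open>M U\<^sub>m v \<inter> (M U\<^sub>1 v + \<dots> + M U\<^sub>m\<^sub>-\<^sub>1 v) = M U\<^sub>1 U\<^sub>m v + \<dots> + M U\<^sub>m\<^sub>-\<^sub>2 U\<^sub>m v\<close>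
  for all products \<open>v\<close> of pairwise commuting generators with indices at least \<open>m + 2\<close>.
  The trivial module is separated because every \<open>U\<^sub>i\<close> acts by \<open>0\<close>. The regular module is separated
  because the algebra has a basis of planar diagrams, and a diagram with arcs at the positions in \<open>v\<close>
  is divisible by \<open>v\<close>; divisibility and the regularity \<open>v z v = v\<close> of \<open>v\<close> need a free strand,
  which exists as \<open>n\<close> is odd. If \<open>0 \<rightarrow> Z \<rightarrow> F \<rightarrow> M \<rightarrow> 0\<close> is exact with \<open>F\<close> free and \<open>M\<close> separated, then
  \<open>Z \<inter> F I = Z I\<close> for the augmentation ideal \<open>I\<close>, and \<open>Z\<close> is separated again. Applied to all
  syzygies of the canonical resolution of the trivial module, this is the vanishing of Tor in
  positive degrees.
\<close>

section \<open>Diagrams and words\<close>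

text \<open>The products v in the definition of separatedness are forced by the induction. The
  identity Z \<inter> F I = Z I only asks for separatedness of M at the empty product. To iterate
  it, Z must be separated too, and separatedness of Z at v rests on that of M at the longer product
  U_m v, because the overlap of the top summand with the lower ones consists of elements ending in
  U_m v. Quantifying over all v makes the property stable under syzygies.

  Regularity is what fails without a free strand: for n = 2 and v = U_1, each v z v with a word z is
  a positive power of a times v. With a free strand, every generator of v finds a neighbour with U_i
  U_j U_i = U_i, so the identity v z v = v contains no power of a and the argument is uniform in a.

  Planarity is never formulated. Only matchings reached from the identity by words matter, and
  \<open>run_faithful\<close> says that such a matching with its number of loops determines the
  monomial.\<close>

text \<open>
  The \<open>2 n\<close> boundary points of a diagram are put on a line: first the bottom points \<open>1, \<dots>, n\<close>, then
  the top points from right to left. To avoid boundary cases a matching is defined on all integers;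
  the identity diagram becomes the reflection \<open>base n\<close> below, and multiplication by \<open>U\<^sub>i\<close> joins
  the points \<open>i\<close> and \<open>i + 1\<close> and their two former partners.
\<close>

definition matching :: "(int \<Rightarrow> int) \<Rightarrow> bool" where
  "matching p \<longleftrightarrow> (\<forall>x. p (p x) = x \<and> p x \<noteq> x)"

text \<open>The pairs {x, p x} and {y, p y} are recombined into {x, y} and {p x, p y}. If x and y
  are already paired, nothing changes; the closed loop of the product is invisible here and is
  counted in \<open>cup_step\<close>.\<close>

definition join :: "'a \<Rightarrow> 'a \<Rightarrow> ('a \<Rightarrow> 'a) \<Rightarrow> 'a \<Rightarrow> 'a" where
  "join x y p = (\<lambda>z. if z = x then y else if z = y then x
    else if z = p x then p y else if z = p y then p x else p z)"

lemma join_involutive: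
  assumes pp: "\<And>x. p (p x) = x" and np: "\<And>x. p x \<noteq> x" and "x \<noteq> y"
  shows "join x y p (join x y p z) = z" "join x y p z \<noteq> z"
proof -
  have inj: "p u = p v \<longleftrightarrow> u = v" for u v using pp by metis
  have nq: "u \<noteq> p u" for u using np[of u] by metis
  note s = join_def inj pp np nq assms(3) assms(3)[symmetric]
  consider "p x = y" "p y = x" | "p x \<noteq> y" "p y \<noteq> x" "y \<noteq> p x" "x \<noteq> p y"
    using pp by metis
  then have "join x y p (join x y p z) = z \<and> join x y p z \<noteq> z"
  proof cases
    case 1
    then have "join x y p = p" by (auto simp: join_def)
    then show ?thesis using pp np by simp
  next
    case 2
    consider "z = x" | "z = y" | "z = p x" | "z = p y"
      | "z \<noteq> x" "z \<noteq> y" "z \<noteq> p x" "z \<noteq> p y" "p z \<noteq> x" "p z \<noteq> y" using pp by metis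
    then show ?thesis by cases (simp_all add: s 2)
  qed
  then show "join x y p (join x y p z) = z" "join x y p z \<noteq> z" by auto
qed

text \<open>This is U_i U_j U_i = U_i on pairings, for any three points. The cases only ask which of
  x, y, z are paired with each other.\<close>

lemma join_braid:
  assumes pp: "\<And>x. p (p x) = x" and np: "\<And>x. p x \<noteq> x" and d: "x \<noteq> y" "x \<noteq> z" "y \<noteq> z"
  shows "join x y (join y z (join x y p)) w = join x y p w"
proof -
  have inj: "p u = p v \<longleftrightarrow> u = v" for u v using pp by metis
  have nq: "u \<noteq> p u" for u using np[of u] by metis
  note s = join_def inj pp np nq d d[symmetric]
  consider "p x = y" "p y = x" | "p x \<noteq> y" "p y \<noteq> x" "y \<noteq> p x" "x \<noteq> p y" "p x = z" "p z = x"
   | "p x \<noteq> y" "p y \<noteq> x" "y \<noteq> p x" "x \<noteq> p y" "p x \<noteq> z" "p z \<noteq> x" "z \<noteq> p x" "x \<noteq> p z" "p y = z" "p z = y"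
   | "p x \<noteq> y" "p y \<noteq> x" "y \<noteq> p x" "x \<noteq> p y" "p x \<noteq> z" "p z \<noteq> x" "z \<noteq> p x" "x \<noteq> p z" "p y \<noteq> z" "p z \<noteq> y" "z \<noteq> p y" "y \<noteq> p z"
    using pp by metis
  then show ?thesis by cases (simp_all add: s)
qed

text \<open>The loop count needs its own equation: if p a = c and p b = d, then joining a with b
  also joins c with d, so the second step closes a loop that was not there before. The total is
  nevertheless symmetric.\<close>

lemma join_commute:
  assumes pp: "\<And>x. p (p x) = x" and np: "\<And>x. p x \<noteq> x" and d: "distinct [a, b, c, d]"
  shows "join a b (join c d p) z = join c d (join a b p) z"
    and "of_bool (p c = d) + of_bool (join c d p a = b) = of_bool (p a = b) + (of_bool (join a b p c = d) :: nat)"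
proof -
  have inj: "p u = p v \<longleftrightarrow> u = v" for u v using pp by metis
  have nq: "u \<noteq> p u" for u using np[of u] by metis
  note s = join_def inj pp np nq
  \<comment> \<open>Being unpaired, in all orientations of the (in)equations in which simplification
    may need it.\<close>
  define P where "P u v \<longleftrightarrow> p u \<noteq> v \<and> p v \<noteq> u \<and> v \<noteq> p u \<and> u \<noteq> p v" for u v
  have "P u v \<or> p u = v \<and> p v = u" for u v unfolding P_def using pp by metis
  then have "P a b \<or> p a = b \<and> p b = a" "P a c \<or> p a = c \<and> p c = a" "P a d \<or> p a = d \<and> p d = a"
     "P b c \<or> p b = c \<and> p c = b" "P b d \<or> p b = d \<and> p d = b" "P c d \<or> p c = d \<and> p d = c"
    by auto
  moreover have "a \<noteq> b" "a \<noteq> c" "a \<noteq> d" "b \<noteq> c" "b \<noteq> d" "c \<noteq> d" "b \<noteq> a" "c \<noteq> a" "d \<noteq> a" "c \<noteq> b" "d \<noteq> b" "d \<noteq> c"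
    using d by auto
  ultimately have "join a b (join c d p) z = join c d (join a b p) z \<and>
    of_bool (p c = d) + of_bool (join c d p a = b) = of_bool (p a = b) + (of_bool (join a b p c = d) :: nat)"
    by (elim disjE conjE; unfold P_def) (simp_all add: s)
  then show "join a b (join c d p) z = join c d (join a b p) z"
    "of_bool (p c = d) + of_bool (join c d p a = b) = of_bool (p a = b) + (of_bool (join a b p c = d) :: nat)"
    by auto
qed

section \<open>Generators acting on matchings, with loops counted\<close>

definition cup :: "nat \<Rightarrow> (int \<Rightarrow> int) \<Rightarrow> int \<Rightarrow> int" where
  "cup i = join (int i) (int i + 1)"

definition arc :: "nat \<Rightarrow> (int \<Rightarrow> int) \<Rightarrow> bool" where
  "arc i p \<longleftrightarrow> p (int i) = int i + 1"

text \<open>A state (k, p) stands for a^k times a diagram; a loop closes exactly when the two points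
  to be joined are already joined.\<close>

definition cup_step :: "nat \<Rightarrow> nat \<times> (int \<Rightarrow> int) \<Rightarrow> nat \<times> (int \<Rightarrow> int)" where
  "cup_step i s = (fst s + of_bool (arc i (snd s)), cup i (snd s))"

definition run :: "nat list \<Rightarrow> nat \<times> (int \<Rightarrow> int) \<Rightarrow> nat \<times> (int \<Rightarrow> int)" where
  "run = fold cup_step"

lemma run_simps [simp]: "run [] s = s" "run (i # w) s = run w (cup_step i s)"
  "run (u @ v) s = run v (run u s)"
  by (simp_all add: run_def)

lemma matching_cup [simp]: "matching p \<Longrightarrow> matching (cup i p)"
  using join_involutive[of p "int i" "int i + 1"] by (simp add: matching_def cup_def)

lemma matching_run [simp]: "matching (snd s) \<Longrightarrow> matching (snd (run w s))"
  by (induction w arbitrary: s) (simp_all add: cup_step_def)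

lemma run_shift: "run w (l + k, p) = (l + fst (run w (k, p)), snd (run w (k, p)))"
  by (induction w arbitrary: k p) (simp_all add: cup_step_def add.assoc)

lemma arc_cup_self [simp]: "arc i (cup i p)"
  by (simp add: arc_def cup_def join_def)

lemma arc_flip: "matching p \<Longrightarrow> arc i p \<Longrightarrow> p (int i + 1) = int i"
  by (metis matching_def arc_def)

lemma arc_cup_far: "matching p \<Longrightarrow> arc i p \<Longrightarrow> i + 2 \<le> j \<or> j + 2 \<le> i \<Longrightarrow> arc i (cup j p)"
proof -
  assume m: "matching p" and a: "arc i p" and "i + 2 \<le> j \<or> j + 2 \<le> i"
  then have d: "int i \<noteq> int j" "int i \<noteq> int j + 1" "int i + 1 \<noteq> int j" "int i + 1 \<noteq> int j + 1" by auto
  have "p (int i) = int i + 1" "p (int i + 1) = int i" "\<And>x. p (p x) = x"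
    using m a arc_flip[of p i] by (auto simp: arc_def matching_def)
  then have "int i \<noteq> p (int j)" "int i \<noteq> p (int j + 1)" using d by metis+
  then show ?thesis using a d by (simp add: arc_def cup_def join_def)
qed

text \<open>Arcs at i and i + 1 would share the point i + 1.\<close>

lemma arc_apart: "matching p \<Longrightarrow> arc i p \<Longrightarrow> arc j p \<Longrightarrow> i < j \<Longrightarrow> i + 2 \<le> j"
  using arc_flip[of p i] by (cases "j = Suc i") (auto simp: arc_def add.commute)

lemma cup_arc: "matching p \<Longrightarrow> arc i p \<Longrightarrow> cup i p = p"
  using arc_flip[of p i] by (auto simp: arc_def cup_def join_def fun_eq_iff)

lemma step_sq: "cup_step i (cup_step i s) = (Suc (fst (cup_step i s)), snd (cup_step i s))"
  if "matching (snd s)"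
  using that by (simp add: cup_step_def cup_arc)

lemma step_braid:
  assumes "matching (snd s)" "j = i + 1 \<or> i = j + 1"
  shows "cup_step i (cup_step j (cup_step i s)) = cup_step i s"
proof -
  obtain k p where s: "s = (k, p)" by (cases s)
  have p: "p (p x) = x" "p x \<noteq> x" for x using assms s by (auto simp: matching_def)
  have sym: "join x y = join y x" for x y :: int by (auto simp: join_def fun_eq_iff)
  have m: "matching p" using assms s by simp
  from assms(2) have "cup i (cup j (cup i p)) = cup i p"
  proof
    assume "j = i + 1"
    then show ?thesis
      using join_braid[of p "int i" "int i + 1" "int i + 2"] p by (auto simp: cup_def add.commute)
  next
    assume "i = j + 1"
    then show ?thesis
      using join_braid[of p "int j + 2" "int j + 1" "int j"] p by (auto simp: cup_def add.commute sym)
  qed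
  \<comment> \<open>No loop closes in the last two steps, since the preceding cup has left an arc at
    the neighbouring position.\<close>
  moreover have "\<not> arc j (cup i p)" "\<not> arc i (cup j (cup i p))"
    using assms(2) arc_apart[of "cup i p" i j] arc_apart[of "cup i p" j i] arc_apart[of "cup j (cup i p)" i j]
      arc_apart[of "cup j (cup i p)" j i] m by (elim disjE; simp; blast?)+
  ultimately show ?thesis by (simp add: cup_step_def s)
qed

lemma step_comm:
  assumes "matching (snd s)" "i + 2 \<le> j"
  shows "cup_step i (cup_step j s) = cup_step j (cup_step i s)"
proof -
  obtain k p where s: "s = (k, p)" by (cases s)
  have p: "p (p x) = x" "p x \<noteq> x" for x using assms s by (auto simp: matching_def)
  have "distinct [int i, int i + 1, int j, int j + 1]" using assms by auto
  from join_commute[OF p this] show ?thesis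
    by (auto simp add: cup_step_def s cup_def arc_def fun_eq_iff)
qed

section \<open>Monomials modulo the Temperley--Lieb relations\<close>

text \<open>A pair \<open>(k, w)\<close> stands for the monomial \<open>a\<^sup>k w\<close>.\<close>

inductive tleq :: "nat \<Rightarrow> nat \<times> nat list \<Rightarrow> nat \<times> nat list \<Rightarrow> bool" for n where
  tleq_refl [simp]: "tleq n s s"
| tleq_sym: "tleq n s t \<Longrightarrow> tleq n t s"
| tleq_trans [trans]: "tleq n s t \<Longrightarrow> tleq n t r \<Longrightarrow> tleq n s r"
| tleq_sq: "i \<in> {1..<n} \<Longrightarrow> tleq n (k, u @ [i, i] @ v) (Suc k, u @ [i] @ v)"
| tleq_braid: "i \<in> {1..<n} \<Longrightarrow> j \<in> {1..<n} \<Longrightarrow> j = i + 1 \<or> i = j + 1 \<Longrightarrow>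
    tleq n (k, u @ [i, j, i] @ v) (k, u @ [i] @ v)"
| tleq_comm: "i \<in> {1..<n} \<Longrightarrow> j \<in> {1..<n} \<Longrightarrow> i + 2 \<le> j \<Longrightarrow>
    tleq n (k, u @ [i, j] @ v) (k, u @ [j, i] @ v)"

lemma tleq_set: "tleq n s t \<Longrightarrow> set (snd s) \<subseteq> {1..<n} \<longleftrightarrow> set (snd t) \<subseteq> {1..<n}"
  by (induction rule: tleq.induct) auto

text \<open>Soundness of diagrams. The initial matching is arbitrary, which is used when a word is
  continued from the diagram of another one and for the representation on all matchings;
  \<open>run_faithful\<close> is the converse at the identity.\<close>

lemma tleq_run:
  "tleq n s t \<Longrightarrow> matching p \<Longrightarrow> run (snd s) (fst s, p) = run (snd t) (fst t, p)"
proof (induction rule: tleq.induct)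
  case (tleq_sq i k u v)
  have *: "run u (Suc k, p) = (Suc (fst (run u (k, p))), snd (run u (k, p)))"
    using run_shift[of u 1 k p] by simp
  have "matching (snd (run u (k, p)))" using tleq_sq by simp
  from step_sq[OF this, of i]
  have "cup_step i (cup_step i (run u (k, p))) = cup_step i (run u (Suc k, p))"
    by (simp add: * ) (simp add: cup_step_def)
  then show ?case by simp
next
  case (tleq_braid i j k u v)
  then show ?case by (simp add: step_braid[of "run u (k, p)" j i])
next
  case (tleq_comm i j k u v)
  then show ?case by (simp add: step_comm[of "run u (k, p)" i j])
qed simp_all

lemma tleq_context: "tleq n (k, w) (k', w') \<Longrightarrow> tleq n (l + k, u @ w @ v) (l + k', u @ w' @ v)"
proof (induction "(k, w)" "(k', w')" arbitrary: k w k' w' rule: tleq.induct)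
  case (tleq_sym s)
  then show ?case by (metis tleq.tleq_sym surj_pair)
next
  case (tleq_trans t)
  then show ?case by (metis tleq.tleq_trans surj_pair)
next
  case (tleq_sq i k u' v')
  then show ?case using tleq.tleq_sq[of i n "l + k" "u @ u'" "v' @ v"] by simp
next
  case (tleq_braid i j k u' v')
  then show ?case using tleq.tleq_braid[of i n j "l + k" "u @ u'" "v' @ v"] by simp
next
  case (tleq_comm i j k u' v')
  then show ?case using tleq.tleq_comm[of i n j "l + k" "u @ u'" "v' @ v"] by simp
qed simp

lemma tleq_mono: "tleq n s t \<Longrightarrow> n \<le> m \<Longrightarrow> tleq m s t"
proof (induction rule: tleq.induct)
  case (tleq_sym s t)
  then show ?case by (metis tleq.tleq_sym)
next
  case (tleq_trans s t r)
  then show ?case by (metis tleq.tleq_trans)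
next
  case (tleq_sq i k u v)
  then show ?case by (intro tleq.tleq_sq) auto
next
  case (tleq_braid i j k u v)
  then show ?case by (intro tleq.tleq_braid) auto
next
  case (tleq_comm i j k u v)
  then show ?case by (intro tleq.tleq_comm) auto
qed simp

lemma tleq_commute:
  assumes "set w \<subseteq> {1..<n}" "set w' \<subseteq> {1..<n}"
    "\<And>x y. x \<in> set w \<Longrightarrow> y \<in> set w' \<Longrightarrow> x + 2 \<le> y \<or> y + 2 \<le> x"
  shows "tleq n (k, u @ w @ w' @ v) (k, u @ w' @ w @ v)"
proof -
  have 1: "tleq n (k, u @ [x] @ w' @ v) (k, u @ w' @ [x] @ v)"
    if "x \<in> {1..<n}" "set w' \<subseteq> {1..<n}" "\<And>y. y \<in> set w' \<Longrightarrow> x + 2 \<le> y \<or> y + 2 \<le> x"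
    for x w' u v using that
  proof (induction w' arbitrary: u)
    case (Cons y w')
    have "tleq n (k, u @ [x, y] @ (w' @ v)) (k, u @ [y, x] @ (w' @ v))"
      using Cons.prems tleq_comm[of x n y k u "w' @ v"] tleq_comm[of y n x k u "w' @ v"]
      by (auto intro: tleq_sym)
    also have "tleq n (k, (u @ [y]) @ [x] @ w' @ v) (k, (u @ [y]) @ w' @ [x] @ v)"
      by (rule Cons.IH) (use Cons.prems in auto)
    then have "tleq n (k, u @ [y, x] @ w' @ v) (k, u @ (y # w') @ [x] @ v)" by simp
    finally show ?case by simp
  qed simp
  show ?thesis using assms
  proof (induction w arbitrary: u v)
    case (Cons x w)
    have "tleq n (k, (u @ [x]) @ w @ w' @ v) (k, (u @ [x]) @ w' @ w @ v)"
      by (rule Cons.IH) (use Cons.prems in auto)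
    also have "tleq n \<dots> (k, u @ w' @ [x] @ (w @ v))"
      using 1[of x w' u "w @ v"] Cons.prems by auto
    finally show ?case by simp
  qed simp
qed

section \<open>Inserting an arc into a matching\<close>

definition shift :: "nat \<Rightarrow> int \<Rightarrow> int" where
  "shift j x = (if x < int j then x else x + 2)"

definition unshift :: "nat \<Rightarrow> int \<Rightarrow> int" where
  "unshift j x = (if x < int j then x else x - 2)"

text \<open>A new arc adds two boundary points, so insertion turns diagrams on n strands into
  diagrams on n + 1 strands; the induction on n is built on it.\<close>

definition ins :: "nat \<Rightarrow> (int \<Rightarrow> int) \<Rightarrow> int \<Rightarrow> int" where
  "ins j p x = (if x = int j then int j + 1 else if x = int j + 1 then int j
    else shift j (p (unshift j x)))"

lemma unshift_shift [simp]: "unshift j (shift j x) = x"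
  by (auto simp: shift_def unshift_def)

lemma shift_eq [simp]: "shift j x = shift j y \<longleftrightarrow> x = y"
  by (metis unshift_shift)

lemma shift_avoids [simp]: "shift j x \<noteq> int j" "shift j x \<noteq> int j + 1"
  "int j \<noteq> shift j x" "int j + 1 \<noteq> shift j x"
  by (auto simp: shift_def)

lemma ins_cases:
  obtains "x = int j" | "x = int j + 1" | y where "x = shift j y"
proof -
  have "x = int j \<or> x = int j + 1 \<or> x = shift j (unshift j x)"
    by (auto simp: shift_def unshift_def)
  then show ?thesis using that by blast
qed

lemma ins_simps [simp]: "ins j p (int j) = int j + 1" "ins j p (int j + 1) = int j"
  "ins j p (shift j x) = shift j (p x)"
  by (simp_all add: ins_def)

lemma ins_inject: "ins j p = ins j q \<Longrightarrow> p = q"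
  by (metis ins_simps(3) shift_eq ext)

lemma matching_ins: "matching p \<Longrightarrow> matching (ins j p)"
  unfolding matching_def
proof
  fix x assume "\<forall>x. p (p x) = x \<and> p x \<noteq> x"
  then show "ins j p (ins j p x) = x \<and> ins j p x \<noteq> x"
    by (cases x rule: ins_cases[of _ j]) auto
qed

lemma join_ins: "join (shift j x) (shift j y) (ins j p) = ins j (join x y p)"
proof
  fix z show "join (shift j x) (shift j y) (ins j p) z = ins j (join x y p) z"
    by (cases z rule: ins_cases[of _ j]) (auto simp: join_def)
qed

lemma cup_ins_low: "i + 2 \<le> j \<Longrightarrow> cup i (ins j p) = ins j (cup i p)"
  using join_ins[of j "int i" "int i + 1" p] by (simp add: shift_def cup_def)

lemma arc_ins_low: "i + 2 \<le> j \<Longrightarrow> arc i (ins j p) \<longleftrightarrow> arc i p"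
  using ins_simps(3)[of j p "int i"] shift_eq[of j "p (int i)" "int i + 1"]
  by (auto simp: arc_def shift_def[of j "int i"] shift_def[of j "int i + 1"] split: if_splits)

lemma arc_ins_high:
  assumes "j \<le> i" shows "arc (i + 2) (ins j p) \<longleftrightarrow> arc i p"
proof -
  have *: "shift j (int i) = int (i + 2)" "shift j (int i + 1) = int (i + 2) + 1"
    using assms by (auto simp: shift_def)
  show ?thesis using ins_simps(3)[of j p "int i"] shift_eq[of j "p (int i)" "int i + 1"]
    unfolding arc_def * by simp
qed

lemma arc_ins [simp]: "arc j (ins j p)"
  by (simp add: arc_def)

text \<open>A cup overlapping an inserted arc in one point straightens the strand: the arc slides by
  one position, and the strand that ended beside it takes the vacated place.\<close>

lemma cup_ins_Suc:
  assumes "matching p"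
  shows "cup (Suc j) (ins j p) = ins (Suc j) p" "cup j (ins (Suc j) p) = ins j p"
proof -
  \<comment> \<open>The three positions involved are a = j, b = j + 1, c = j + 2. The point j of
    \<open>p\<close> sits at c in \<open>ins j p\<close> and at a in \<open>ins (Suc j) p\<close>;
    all other points have the same place in both, which is fact 2.\<close>
  define a where "a = int j"
  define b where "b = int j + 1"
  define c where "c = shift j a"
  have p: "p (p x) = x" "p x \<noteq> x" for x using assms by (auto simp: matching_def)
  have 1: "p x = a \<longleftrightarrow> x = p a" for x using p by metis
  have 2: "shift (Suc j) x = (if x = a then a else shift j x)" for x
    by (auto simp: shift_def a_def)
  have abc: "a \<noteq> b" "b \<noteq> c" "a \<noteq> c" "int j = a" "a + 1 = b" "int (Suc j) = b" "b + 1 = c"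
    by (auto simp: shift_def a_def b_def c_def)
  have sh: "shift j x \<noteq> a" "shift j x \<noteq> b" "shift j a = c" "shift j x = c \<longleftrightarrow> x = a" for x
    by (auto simp: a_def b_def c_def simp del: shift_eq) (simp_all add: shift_def split: if_splits)
  have new: "ins (Suc j) p b = c" "ins (Suc j) p c = b"
    using ins_simps(1,2)[of "Suc j" p] unfolding abc by auto
  have new': "ins (Suc j) p a = shift j (p a)"
    using ins_simps(3)[of "Suc j" p a] p(2)[of a] unfolding 2 by (simp only: if_True if_False simp_thms)
  have new'': "ins (Suc j) p (shift j x) = (if x = p a then a else shift j (p x))" if "x \<noteq> a" for x
    using ins_simps(3)[of "Suc j" p x] that unfolding 2 1 by (simp only: if_False)
  have old: "ins j p a = b" "ins j p b = a" "ins j p (shift j x) = shift j (p x)" "ins j p c = shift j (p a)" for x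
    using ins_simps[of j p] unfolding abc c_def by auto
  note simps = cup_def join_def abc abc(1-3)[symmetric] sh sh(1,2)[symmetric] new new' new'' old p(2)[symmetric] 1 p
  show "cup (Suc j) (ins j p) = ins (Suc j) p"
  proof
    fix z
    consider "z = a" | "z = b" | "z = c" | x where "x \<noteq> a" "z = shift j x"
      using ins_cases[of z j] unfolding a_def b_def c_def by metis
    then show "cup (Suc j) (ins j p) z = ins (Suc j) p z"
      by cases (simp_all only: simps if_True if_False simp_thms shift_eq split: if_split)
  qed
  show "cup j (ins (Suc j) p) = ins j p"
  proof
    fix z
    consider "z = a" | "z = b" | "z = c" | x where "x \<noteq> a" "z = shift j x"
      using ins_cases[of z j] unfolding a_def b_def c_def by metis
    then show "cup j (ins (Suc j) p) z = ins j p z"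
      by cases (simp_all only: simps if_True if_False simp_thms shift_eq split: if_split,
        simp add: p c_def)
  qed
qed

section \<open>Normal forms of words and faithfulness of diagrams\<close>

definition base :: "nat \<Rightarrow> int \<Rightarrow> int" where
  "base n x = 2 * int n + 1 - x"

lemma matching_base [simp]: "matching (base n)"
  by (auto simp: matching_def base_def) presburger

text \<open>The two ends of the last strand are adjacent on the line, so in the identity it is
  itself an inserted arc.\<close>

lemma base_Suc: "base (Suc n) = ins (Suc n) (base n)"
  by (auto simp: base_def ins_def shift_def unshift_def fun_eq_iff)

definition ins_step :: "nat \<Rightarrow> nat \<times> (int \<Rightarrow> int) \<Rightarrow> nat \<times> (int \<Rightarrow> int)" where
  "ins_step j s = (fst s, ins j (snd s))"

lemma run_low: "\<forall>i\<in>set w. i + 2 \<le> j \<Longrightarrow> run w (ins_step j s) = ins_step j (run w s)"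
  by (induction w arbitrary: s)
    (auto simp: cup_step_def ins_step_def arc_ins_low cup_ins_low)

abbreviation descent :: "nat \<Rightarrow> nat \<Rightarrow> nat list" where
  "descent n j \<equiv> rev [j..<n]"

text \<open>By \<open>cup_ins_Suc\<close> each letter slides the inserted arc one position down. No
  loop closes, since the next position cannot carry an arc as well.\<close>

lemma run_descent:
  assumes "j \<le> n" "matching (snd s)"
  shows "run (descent n j) (ins_step n s) = ins_step j s"
  using assms(1)
proof (induction j rule: inc_induct)
  case base
  then show ?case by simp
next
  case (step j)
  have "matching (ins (Suc j) (snd s))" using assms by (simp add: matching_ins)
  then have "\<not> arc j (ins (Suc j) (snd s))"
    using arc_apart[of "ins (Suc j) (snd s)" j "Suc j"] by auto
  then have "cup_step j (ins_step (Suc j) s) = ins_step j s"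
    by (simp add: cup_step_def ins_step_def cup_ins_Suc assms)
  moreover have "descent n j = descent n (Suc j) @ [j]" using step by (simp add: upt_conv_Cons)
  ultimately show ?case using step.IH by simp
qed

lemma run_normal:
  assumes "set y \<subseteq> {1..<n}" "1 \<le> j" "j \<le> Suc n"
  shows "run (y @ descent (Suc n) j) (k, base (Suc n)) = ins_step j (run y (k, base n))"
proof -
  have "run y (k, base (Suc n)) = ins_step (Suc n) (run y (k, base n))"
    using run_low[of y "Suc n" "(k, base n)"] subsetD[OF assms(1)]
    by (simp add: base_Suc ins_step_def Suc_le_eq)
  then show ?thesis using run_descent[of j "Suc n" "run y (k, base n)"] assms by simp
qed

lemma tleq_eq_context: "tleq n (k, w) (k', w') \<Longrightarrow> tleq n (k, u @ w @ v) (k', u @ w' @ v)"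
  using tleq_context[of n k w k' w' 0 u v] by simp

lemma descent_split: "j \<le> m \<Longrightarrow> m \<le> n \<Longrightarrow> descent n j = descent n m @ descent m j"
  using upt_add_eq_append[of j m "n - m"] by simp

lemma descent_snoc: "j < n \<Longrightarrow> descent n j = descent n (Suc j) @ [j]"
  by (simp add: upt_conv_Cons)

text \<open>U_i commutes past the letters from i + 2 on and is absorbed by U_i U_(i+1) U_i = U_i. As
  \<open>descent_shift_right\<close> arrives at the same word, a letter i + 2 on the right of a
  descent can be traded for a letter i on its left.\<close>

lemma descent_shift_left:
  assumes "1 \<le> j" "j \<le> i" "i + 2 \<le> n"
  shows "tleq n (k, [i] @ descent n j) (k, descent n (i + 2) @ descent (i + 1) j)"
proof -
  have 1: "descent n j = descent n (i + 2) @ [i + 1, i] @ descent i j"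
    using assms descent_split[of j "i + 2" n] descent_split[of j i "i + 2"]
    by simp
  have "tleq n (k, [] @ [i] @ descent n (i + 2) @ ([i + 1, i] @ descent i j))
      (k, [] @ descent n (i + 2) @ [i] @ ([i + 1, i] @ descent i j))"
    by (rule tleq_commute) (use assms in auto)
  also have "tleq n \<dots> (k, descent n (i + 2) @ [i] @ descent i j)"
    using tleq_braid[of i n "i + 1" k "descent n (i + 2)" "descent i j"] assms by auto
  also have "[i] @ descent i j = descent (i + 1) j" using assms by simp
  finally show ?thesis by (simp add: 1)
qed

lemma descent_shift_right:
  assumes "1 \<le> j" "j \<le> i" "i + 2 < n"
  shows "tleq n (k, descent n j @ [i + 2]) (k, descent n (i + 2) @ descent (i + 1) j)"
proof -
  have 1: "descent n j = descent n (i + 3) @ [i + 2, i + 1] @ descent (i + 1) j"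
    using assms descent_split[of j "i + 3" n] descent_split[of j "i + 1" "i + 3"]
    by (simp add: numeral_3_eq_3)
  have "tleq n (k, (descent n (i + 3) @ [i + 2, i + 1]) @ descent (i + 1) j @ [i + 2] @ [])
      (k, (descent n (i + 3) @ [i + 2, i + 1]) @ [i + 2] @ descent (i + 1) j @ [])"
    by (rule tleq_commute) (use assms in auto)
  also have "tleq n \<dots> (k, descent n (i + 3) @ [i + 2] @ descent (i + 1) j)"
    using tleq_braid[of "i + 2" n "i + 1" k "descent n (i + 3)" "descent (i + 1) j"] assms by auto
  also have "descent n (i + 3) @ [i + 2] @ descent (i + 1) j = descent n (i + 2) @ descent (i + 1) j"
    using assms descent_snoc[of "i + 2" n] by (simp add: numeral_3_eq_3)
  finally show ?thesis by (simp add: 1)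
qed

text \<open>This is a normal form in the style of Jones. A letter l appended to the descent ending
  in j gives a factor a (l = j), prolongs the descent (j = l + 1), or cuts it back to end in l (l =
  j + 1). Letters below j - 1 pass to the left unchanged, and letters above j + 1 arrive there
  lowered by two; both are then smaller than n and join y.\<close>

lemma normal_form:
  assumes "set w \<subseteq> {1..<Suc n}"
  shows "\<exists>k y j. set y \<subseteq> {1..<n} \<and> 1 \<le> j \<and> j \<le> Suc n \<and> tleq (Suc n) (0, w) (k, y @ descent (Suc n) j)"
  using assms
proof (induction w rule: rev_induct)
  case Nil
  then show ?case by (intro exI[of _ 0] exI[of _ "[]"] exI[of _ "Suc n"]) simp
next
  case (snoc l w)
  let ?d = "descent (Suc n)"
  from snoc obtain k y j where y: "set y \<subseteq> {1..<n}" and j: "1 \<le> j" "j \<le> Suc n"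
    and eq: "tleq (Suc n) (0, w) (k, y @ ?d j)" by auto
  have l: "1 \<le> l" "l < Suc n" using snoc.prems by auto
  have start: "tleq (Suc n) (0, w @ [l]) (k, y @ ?d j @ [l])"
    using tleq_eq_context[OF eq, of "[]" "[l]"] by simp
  have fin: ?case if "tleq (Suc n) (k, y @ ?d j @ [l]) (k', y' @ ?d j')" "set y' \<subseteq> {1..<n}" "1 \<le> j'" "j' \<le> Suc n"
    for k' y' j' using tleq_trans[OF start that(1)] that(2-) by blast
  have "l = j \<or> j = l + 1 \<or> l = j + 1 \<or> l + 2 \<le> j \<or> l = (l - 2) + 2 \<and> j \<le> l - 2" by linarith
  then consider "l = j" | "j = l + 1" | "l = j + 1" | "l + 2 \<le> j" | i where "l = i + 2" "j \<le> i"
    by blast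
  then show ?case
  proof cases
    case 1
    have "?d j @ [l] = ?d (Suc j) @ [l, l]" using 1 l descent_snoc[of j "Suc n"] by simp
    then have "tleq (Suc n) (k, y @ ?d j @ [l]) (Suc k, y @ ?d (Suc j) @ [l])"
      using tleq_sq[of l "Suc n" k "y @ ?d (Suc j)" "[]"] l by simp
    moreover have "?d (Suc j) @ [l] = ?d j" using 1 l descent_snoc[of j "Suc n"] by simp
    ultimately show ?thesis using fin y j by metis
  next
    case 2
    then have "?d j @ [l] = ?d l" using descent_snoc[of l "Suc n"] l by simp
    then show ?thesis using fin[of k y l] y l by simp
  next
    case 3
    then have "?d j @ [l] = ?d (j + 2) @ [l, j, l]"
      using l descent_split[of j "j + 2" "Suc n"] by simp
    then have "tleq (Suc n) (k, y @ ?d j @ [l]) (k, y @ ?d (j + 2) @ [l])"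
      using tleq_braid[of l "Suc n" j k "y @ ?d (j + 2)" "[]"] l j 3 by simp
    moreover have "?d (j + 2) @ [l] = ?d l" using 3 l descent_snoc[of l "Suc n"] by simp
    ultimately show ?thesis using fin[of k y l] y l by simp
  next
    case 4
    have "tleq (Suc n) (k, y @ ?d j @ [l] @ []) (k, y @ [l] @ ?d j @ [])"
      by (rule tleq_commute) (use 4 j l in auto)
    then have "tleq (Suc n) (0, w @ [l]) (k, (y @ [l]) @ ?d j)"
      using start by (auto intro: tleq_trans)
    moreover have "set (y @ [l]) \<subseteq> {1..<n}" using y l 4 j by auto
    ultimately show ?thesis using j by blast
  next
    case 5
    have "tleq (Suc n) (k, ?d j @ [i + 2]) (k, [i] @ ?d j)"
      using descent_shift_left[of j i "Suc n" k] descent_shift_right[of j i "Suc n" k] 5 j l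
      by (auto intro: tleq_trans tleq_sym)
    from tleq_eq_context[OF this, of y "[]"]
    have "tleq (Suc n) (0, w @ [l]) (k, (y @ [i]) @ ?d j)"
      using start 5 by (auto intro: tleq_trans)
    moreover have "set (y @ [i]) \<subseteq> {1..<n}" using y l 5 j by auto
    ultimately show ?thesis using j by blast
  qed
qed

text \<open>
  Induction on \<open>n\<close> along the normal form \<open>y U\<^sub>n\<^sub>-\<^sub>1 \<dots> U\<^sub>j\<close> with \<open>y\<close> in fewer letters, whose diagram is
  that of \<open>y\<close> with an arc inserted at \<open>j\<close>. Two normal forms of one diagram with \<open>j < j'\<close> both have
  an arc at \<open>j'\<close>, so that the first is divisible by \<open>U\<^sub>j\<^sub>'\<^sub>-\<^sub>2\<close> inside and can be moved to \<open>j'\<close>.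
\<close>

theorem run_faithful:
  assumes "set w \<subseteq> {1..<n}" "set w' \<subseteq> {1..<n}" "run w (k, base n) = run w' (k', base n)"
  shows "tleq n (k, w) (k', w')"
  using assms
proof (induction n arbitrary: w w' k k')
  case 0
  then show ?case by simp
next
  case (Suc n)
  let ?d = "descent (Suc n)"
  \<comment> \<open>An arc at i makes y divisible by U_i: if l is a neighbour of i, appending U_l
    U_i does not change the diagram, so the induction hypothesis identifies y with y U_l U_i. For n
    = 2 there is no neighbour, but then i is the only letter, and y is not empty because the
    identity has no arc at 1.\<close>
  have factor: "\<exists>x. set x \<subseteq> {1..<n} \<and> tleq n (k, y) (k, x @ [i])"
    if y: "set y \<subseteq> {1..<n}" and i: "1 \<le> i" "i < n" and a: "arc i (snd (run y (k, base n)))" for k y i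
  proof (cases "n = 2")
    case True
    have "y \<noteq> []" using a i True by (auto simp: arc_def base_def)
    then have "y = butlast y @ [last y]" by simp
    moreover have "last y = i" using y \<open>y \<noteq> []\<close> last_in_set[of y] i True by fastforce
    moreover have "set (butlast y) \<subseteq> {1..<n}" using y by (meson in_set_butlastD subset_iff)
    ultimately show ?thesis by (metis tleq_refl)
  next
    case False
    define l where "l = (if i + 1 < n then i + 1 else i - 1)"
    have l: "1 \<le> l" "l < n" "l = i + 1 \<or> i = l + 1" using i False by (auto simp: l_def)
    obtain m q where mq: "run y (k, base n) = (m, q)" by fastforce
    have q: "matching q" "arc i q" using a matching_run[of "(k, base n)" y] by (auto simp: mq)
    \<comment> \<open>Applied to a diagram with an arc at i, both sides of U_i U_l U_i = U_i start
      or end with one extra loop; removing it shows that U_l U_i fixes the diagram.\<close>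
    have "cup_step i (m, q) = (Suc m, q)" using q by (simp add: cup_step_def cup_arc)
    with step_braid[of "(m, q)" l i] q l have "cup_step i (cup_step l (Suc m, q)) = (Suc m, q)" by simp
    then have "cup_step i (cup_step l (m, q)) = (m, q)" by (simp add: cup_step_def)
    then have "run y (k, base n) = run ((y @ [l]) @ [i]) (k, base n)" by (simp add: mq)
    then have "tleq n (k, y) (k, (y @ [l]) @ [i])"
      by (intro Suc.IH) (use y i l in auto)
    then show ?thesis using y l by (intro exI[of _ "y @ [l]"]) auto
  qed
  have main: "tleq (Suc n) (k, y @ ?d j) (k', y' @ ?d j')"
    if y: "set y \<subseteq> {1..<n}" "set y' \<subseteq> {1..<n}" and j: "1 \<le> j" "j \<le> j'" "j' \<le> Suc n"
      and eq: "ins_step j (run y (k, base n)) = ins_step j' (run y' (k', base n))"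
    for k y j k' y' j'
  proof -
    \<comment> \<open>It suffices to rewrite the first word so that its descent ends in j' as well:
      insertion at j' is injective, so x and y' have equal diagrams on n strands and the induction
      hypothesis applies.\<close>
    have same: ?thesis if "tleq (Suc n) (k, y @ ?d j) (k, x @ ?d j')" "set x \<subseteq> {1..<n}" for x
    proof -
      have "run (y @ ?d j) (k, base (Suc n)) = run (x @ ?d j') (k, base (Suc n))"
        using tleq_run[OF that(1), of "base (Suc n)"] by simp
      then have "ins_step j' (run x (k, base n)) = ins_step j' (run y' (k', base n))"
        using run_normal[of y n j k] run_normal[of x n j' k] y that(2) j eq by simp
      then have "run x (k, base n) = run y' (k', base n)"
        by (auto simp: ins_step_def prod_eq_iff dest: ins_inject)
      then have "tleq (Suc n) (k, x) (k', y')"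
        using Suc.IH[of x y' k k'] that(2) y tleq_mono[of n _ _ "Suc n"] by simp
      from tleq_context[OF this, of 0 "[]" "?d j'"] that(1) show ?thesis
        by (auto intro: tleq_trans)
    qed
    show ?thesis
    proof (cases "j = j'")
      case True
      then show ?thesis using same[of y] y by simp
    next
      case False
      let ?p = "snd (run y (k, base n))"
      have m: "matching ?p" by simp
      have a': "arc j' (ins j ?p)" using eq arc_ins[of j' "snd (run y' (k', base n))"]
        by (simp add: ins_step_def)
      \<comment> \<open>Removing the inserted arc at j lowers the arc at j' by two.\<close>
      define i where "i = j' - 2"
      have "j + 2 \<le> j'" using arc_apart[OF matching_ins[OF m] arc_ins a'] False j by simp
      then have i: "j' = i + 2" "j \<le> i" "1 \<le> i" "i < n" using j by (auto simp: i_def)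
      have "arc i ?p" using a' arc_ins_high[of j i ?p] i by simp
      from factor[OF y(1) i(3,4) this] obtain x where x: "set x \<subseteq> {1..<n}" "tleq n (k, y) (k, x @ [i])"
        by blast
      have "tleq (Suc n) (k, y @ ?d j) (k, (x @ [i]) @ ?d j)"
        using tleq_eq_context[OF tleq_mono[OF x(2), of "Suc n"], of "[]" "?d j"] by simp
      also have "tleq (Suc n) \<dots> (k, x @ (?d (i + 2) @ descent (i + 1) j))"
        using tleq_eq_context[OF descent_shift_left[of j i "Suc n" k], of x "[]"] i j by simp
      also have "tleq (Suc n) \<dots> (k, x @ (descent (i + 1) j @ ?d (i + 2)))"
      proof -
        have "tleq (Suc n) (k, x @ ?d (i + 2) @ descent (i + 1) j @ []) (k, x @ descent (i + 1) j @ ?d (i + 2) @ [])"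
          by (rule tleq_commute) (use i j in auto)
        then show ?thesis by (simp only: append_Nil2)
      qed
      finally have "tleq (Suc n) (k, y @ ?d j) (k, (x @ descent (i + 1) j) @ ?d j')"
        using i by simp
      moreover have "set (x @ descent (i + 1) j) \<subseteq> {1..<n}" using x i j by auto
      ultimately show ?thesis by (rule same)
    qed
  qed
  obtain l y j where y: "set y \<subseteq> {1..<n}" "1 \<le> j" "j \<le> Suc n" "tleq (Suc n) (0, w) (l, y @ ?d j)"
    using normal_form Suc.prems(1) by metis
  obtain l' y' j' where y': "set y' \<subseteq> {1..<n}" "1 \<le> j'" "j' \<le> Suc n"
      "tleq (Suc n) (0, w') (l', y' @ ?d j')"
    using normal_form Suc.prems(2) by metis
  have t: "tleq (Suc n) (k, w) (k + l, y @ ?d j)" "tleq (Suc n) (k', w') (k' + l', y' @ ?d j')"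
    using tleq_context[OF y(4), of k "[]" "[]"] tleq_context[OF y'(4), of k' "[]" "[]"] by simp_all
  have "run (y @ ?d j) (k + l, base (Suc n)) = run (y' @ ?d j') (k' + l', base (Suc n))"
    using tleq_run[OF t(1), of "base (Suc n)"] tleq_run[OF t(2), of "base (Suc n)"] Suc.prems(3) by simp
  then have e: "ins_step j (run y (k + l, base n)) = ins_step j' (run y' (k' + l', base n))"
    using run_normal[of y n j "k + l"] run_normal[of y' n j' "k' + l'"] y y' by simp
  have "tleq (Suc n) (k + l, y @ ?d j) (k' + l', y' @ ?d j')"
  proof (cases "j \<le> j'")
    case True
    then show ?thesis using main[OF y(1) y'(1) y(2) _ y'(3) e] by simp
  next
    case False
    then show ?thesis by (intro tleq_sym[OF main[OF y'(1) y(1) y'(2) _ y(3) e[symmetric]]]) simp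
  qed
  from tleq_trans[OF tleq_trans[OF t(1) this] tleq_sym[OF t(2)]] show ?case .
qed

text \<open>In a normal form only y can close loops, since the descent merely slides an inserted
  arc; so it is enough to remove the loops of y.\<close>

lemma loop_free_form:
  assumes "set w \<subseteq> {1..<n}"
  shows "\<exists>k w'. set w' \<subseteq> {1..<n} \<and> tleq n (0, w) (k, w') \<and> fst (run w' (0, base n)) = 0"
  using assms
proof (induction n arbitrary: w)
  case 0
  then show ?case by (intro exI[of _ 0] exI[of _ "[]"]) simp
next
  case (Suc n)
  let ?d = "descent (Suc n)"
  obtain l y j where y: "set y \<subseteq> {1..<n}" "1 \<le> j" "j \<le> Suc n" "tleq (Suc n) (0, w) (l, y @ ?d j)"
    using normal_form Suc.prems(1) by metis
  obtain k x where x: "set x \<subseteq> {1..<n}" "tleq n (0, y) (k, x)" "fst (run x (0, base n)) = 0"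
    using Suc.IH y(1) by blast
  have "tleq (Suc n) (l, y @ ?d j) (l + k, x @ ?d j)"
    using tleq_context[OF tleq_mono[OF x(2), of "Suc n"], of l "[]" "?d j"] by simp
  with y(4) have "tleq (Suc n) (0, w) (l + k, x @ ?d j)" by (rule tleq_trans)
  moreover have "set (x @ ?d j) \<subseteq> {1..<Suc n}" using x y by auto
  moreover have "fst (run (x @ ?d j) (0, base (Suc n))) = 0"
    using run_normal[OF x(1) y(2,3), of 0] x(3) by (simp add: ins_step_def)
  ultimately show ?case by blast
qed

section \<open>Products of pairwise commuting generators, with increasing indices at least two
  apart\<close>

primrec spaced :: "nat \<Rightarrow> nat \<Rightarrow> nat list \<Rightarrow> bool" where
  "spaced n b [] \<longleftrightarrow> True"
| "spaced n b (i # v) \<longleftrightarrow> b \<le> i \<and> i < n \<and> spaced n (i + 2) v"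

lemma spaced_mono: "spaced n b v \<Longrightarrow> c \<le> b \<Longrightarrow> spaced n c v"
  by (cases v) auto

lemma spaced_set: "spaced n b v \<Longrightarrow> set v \<subseteq> {b..<n}"
  by (induction v arbitrary: b) fastforce+

lemma tleq_spaced_commute:
  assumes "1 \<le> i" "i < n" "spaced n (i + 2) v"
  shows "tleq n (k, x @ [i] @ v @ y) (k, x @ v @ [i] @ y)"
  by (rule tleq_commute) (use assms spaced_set[of n "i + 2" v] in auto)

text \<open>No letter i of v has i - 1 in v, and i - 1 is still at least b. The word z lists these
  left neighbours in decreasing order, and U_i U_(i-1) U_i = U_i is applied from the last letter of
  v to the first.\<close>

lemma spaced_regular_gap:
  assumes "spaced n (b + 1) v" "1 \<le> b"
  shows "\<exists>z. set z \<subseteq> {b..<n} \<and> tleq n (0, v @ z @ v) (0, v)"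
  using assms
proof (induction v arbitrary: b)
  case Nil
  then show ?case by (intro exI[of _ "[]"]) simp
next
  case (Cons i v)
  then obtain z where z: "set z \<subseteq> {i + 1..<n}" "tleq n (0, v @ z @ v) (0, v)"
    using Cons.IH[of "i + 1"] by auto
  have i: "b + 1 \<le> i" "i < n" "spaced n (i + 2) v" using Cons.prems by auto
  have v: "set v \<subseteq> {i + 2..<n}" using spaced_set i by blast
  let ?z = "z @ [i - 1]"
  have "tleq n (0, ([i] @ v @ z) @ [i - 1, i] @ v @ []) (0, ([i] @ v @ z) @ v @ [i - 1, i] @ [])"
    by (rule tleq_commute) (use Cons.prems i v in auto)
  also have "tleq n \<dots> (0, [i] @ v @ [i - 1, i])"
    using tleq_eq_context[OF z(2), of "[i]" "[i - 1, i]"] by simp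
  also have "tleq n \<dots> (0, v @ [i, i - 1, i])"
    using tleq_spaced_commute[of i n v 0 "[]" "[i - 1, i]"] i Cons.prems by simp
  also have "tleq n \<dots> (0, v @ [i])"
  proof -
    have "i - 1 \<in> {1..<n}" "i \<in> {1..<n}" "i = i - 1 + 1" using i Cons.prems by auto
    then show ?thesis using tleq_braid[of i n "i - 1" 0 v "[]"] by (simp del: One_nat_def)
  qed
  also have "tleq n \<dots> (0, i # v)"
    using tleq_spaced_commute[of i n v 0 "[]" "[]"] i Cons.prems by (simp add: tleq_sym)
  finally have "tleq n (0, (i # v) @ ?z @ (i # v)) (0, i # v)" by simp
  moreover have "set ?z \<subseteq> {b..<n}" using z i by auto
  ultimately show ?case by blast
qed

text \<open>Evenness of n - b means that b, ..., n is an odd number of points. Each letter of v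
  covers two of them, so some point stays free. Letters before the first gap take their right
  neighbour for z; behind the gap all letters can take the left one, by
  \<open>spaced_regular_gap\<close>.\<close>

lemma spaced_regular:
  assumes "spaced n b v" "1 \<le> b" "b \<le> n \<Longrightarrow> even (n - b)"
  shows "\<exists>z. set z \<subseteq> {b..<n} \<and> tleq n (0, v @ z @ v) (0, v)"
  using assms
proof (induction v arbitrary: b)
  case Nil
  then show ?case by (intro exI[of _ "[]"]) simp
next
  case (Cons i v)
  have i: "b \<le> i" "i < n" "spaced n (i + 2) v" using Cons.prems by auto
  show ?case
  proof (cases "i = b")
    case False
    then show ?thesis using spaced_regular_gap[of n b "i # v"] Cons.prems by simp
  next
    case True
    \<comment> \<open>By parity b is not the last generator, so its right neighbour b + 1
      exists.\<close>
    then have b: "b + 2 \<le> n" using Cons.prems i by (cases "n = b + 1") auto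
    have "even (n - (b + 2))" using b Cons.prems by auto
    then obtain z where z: "set z \<subseteq> {b + 2..<n}" "tleq n (0, v @ z @ v) (0, v)"
      using Cons.IH[of "b + 2"] i True by auto
    let ?z = "[b + 1] @ z"
    have "tleq n (0, [b] @ v @ [b + 1] @ z @ [b] @ v) (0, v @ [b] @ [b + 1] @ z @ [b] @ v)"
      using tleq_spaced_commute[of b n v 0 "[]" "[b + 1] @ z @ [b] @ v"] i Cons.prems True by simp
    also have "tleq n \<dots> (0, v @ [b] @ [b + 1] @ [b] @ z @ v)"
      using tleq_commute[of z n "[b]" 0 "v @ [b, b + 1]" v] z Cons.prems b by force
    also have "tleq n \<dots> (0, v @ [b] @ z @ v)"
      using tleq_braid[of b n "b + 1" 0 v "z @ v"] Cons.prems b by auto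
    also have "tleq n \<dots> (0, [b] @ v @ z @ v)"
      using tleq_spaced_commute[of b n v 0 "[]" "z @ v"] i Cons.prems True by (simp add: tleq_sym)
    also have "tleq n \<dots> (0, [b] @ v)"
      using tleq_eq_context[OF z(2), of "[b]" "[]"] by simp
    finally have "tleq n (0, (i # v) @ ?z @ (i # v)) (0, i # v)" using True by simp
    moreover have "set ?z \<subseteq> {b..<n}" using z b by auto
    ultimately show ?thesis by blast
  qed
qed

lemma run_arcs:
  assumes "matching p" "\<forall>i\<in>set v. arc i p"
  shows "run v (k, p) = (k + length v, p)"
  using assms by (induction v arbitrary: k) (auto simp: cup_step_def cup_arc)

text \<open>The quotient is x = w z, where v z v = v. On a diagram with arcs at v, multiplication by
  v only adds loops; cancelling them shows that z v fixes the diagram of w, and faithfulness gives w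
  = w z v. Thus no diagram has to be cut open.\<close>

lemma arcs_right_divisible:
  assumes "odd n" "spaced n 1 v" "set w \<subseteq> {1..<n}" "\<forall>i\<in>set v. arc i (snd (run w (0, base n)))"
  shows "\<exists>x. set x \<subseteq> {1..<n} \<and> tleq n (0, w) (0, x @ v)"
proof -
  obtain z where z: "set z \<subseteq> {1..<n}" "tleq n (0, v @ z @ v) (0, v)"
    using spaced_regular[of n 1 v] assms by auto
  obtain m q where mq: "run w (0, base n) = (m, q)" by fastforce
  have q: "matching q" using matching_run[of "(0, base n)" w] by (simp add: mq)
  have v: "run v (m, q) = (length v + m, q)" using run_arcs[OF q, of v m] assms(4) by (simp add: mq)
  have "run (v @ z @ v) (0, q) = run v (0, q)" using tleq_run[OF z(2) q] by simp
  then have "run (v @ z @ v) (m, q) = run v (m, q)"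
    using run_shift[of "v @ z @ v" m 0 q] run_shift[of v m 0 q] by simp
  then have "run (z @ v) (length v + m, q) = (length v + m, q)" using v by simp
  then have "run (z @ v) (m, q) = (m, q)"
    using run_shift[of "z @ v" "length v" m q] by (simp add: prod_eq_iff)
  then have "run w (0, base n) = run ((w @ z) @ v) (0, base n)" by (simp add: mq)
  then have "tleq n (0, w) (0, (w @ z) @ v)"
    by (intro run_faithful) (use assms z spaced_set[of n 1 v] in auto)
  then show ?thesis using assms(3) z by (intro exI[of _ "w @ z"]) auto
qed

section \<open>Right modules\<close>

text \<open>Instances are taken over the algebra and also over the commutative ring of scalars,
  where the side does not matter.\<close>

locale right_module = A?: ring A + M?: abelian_group M for A (structure) and M :: "('a, 'm) module" (structure) +
  assumes smult_closed [simp, intro]: "a \<in> carrier A \<Longrightarrow> x \<in> carrier M \<Longrightarrow> a \<odot>\<^bsub>M\<^esub> x \<in> carrier M"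
    and smult_scalar_add: "a \<in> carrier A \<Longrightarrow> b \<in> carrier A \<Longrightarrow> x \<in> carrier M \<Longrightarrow>
      (a \<oplus> b) \<odot>\<^bsub>M\<^esub> x = a \<odot>\<^bsub>M\<^esub> x \<oplus>\<^bsub>M\<^esub> b \<odot>\<^bsub>M\<^esub> x"
    and smult_add: "a \<in> carrier A \<Longrightarrow> x \<in> carrier M \<Longrightarrow> y \<in> carrier M \<Longrightarrow>
      a \<odot>\<^bsub>M\<^esub> (x \<oplus>\<^bsub>M\<^esub> y) = a \<odot>\<^bsub>M\<^esub> x \<oplus>\<^bsub>M\<^esub> a \<odot>\<^bsub>M\<^esub> y"
    and smult_mult: "a \<in> carrier A \<Longrightarrow> b \<in> carrier A \<Longrightarrow> x \<in> carrier M \<Longrightarrow>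
      (a \<otimes> b) \<odot>\<^bsub>M\<^esub> x = b \<odot>\<^bsub>M\<^esub> (a \<odot>\<^bsub>M\<^esub> x)"
    and smult_one [simp]: "x \<in> carrier M \<Longrightarrow> \<one> \<odot>\<^bsub>M\<^esub> x = x"
begin

lemma smult_zero_left [simp]: "x \<in> carrier M \<Longrightarrow> \<zero> \<odot>\<^bsub>M\<^esub> x = \<zero>\<^bsub>M\<^esub>"
  using smult_scalar_add[of \<zero> \<zero> x] M.add.r_cancel_one[of "\<zero> \<odot>\<^bsub>M\<^esub> x" "\<zero> \<odot>\<^bsub>M\<^esub> x"] by simp

lemma smult_zero_right [simp]: "a \<in> carrier A \<Longrightarrow> a \<odot>\<^bsub>M\<^esub> \<zero>\<^bsub>M\<^esub> = \<zero>\<^bsub>M\<^esub>"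
  using smult_add[of a "\<zero>\<^bsub>M\<^esub>" "\<zero>\<^bsub>M\<^esub>"] M.add.r_cancel_one[of "a \<odot>\<^bsub>M\<^esub> \<zero>\<^bsub>M\<^esub>" "a \<odot>\<^bsub>M\<^esub> \<zero>\<^bsub>M\<^esub>"] by simp

lemma smult_minus: "a \<in> carrier A \<Longrightarrow> x \<in> carrier M \<Longrightarrow> a \<odot>\<^bsub>M\<^esub> (\<ominus>\<^bsub>M\<^esub> x) = \<ominus>\<^bsub>M\<^esub> (a \<odot>\<^bsub>M\<^esub> x)"
  using smult_add[of a "\<ominus>\<^bsub>M\<^esub> x" x] by (intro M.add.inv_equality[symmetric]) (simp_all add: M.l_neg)

lemma uminus_smult: "x \<in> carrier M \<Longrightarrow> \<ominus>\<^bsub>M\<^esub> x = (\<ominus> \<one>) \<odot>\<^bsub>M\<^esub> x"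
  using smult_scalar_add[of "\<ominus> \<one>" \<one> x] by (intro M.add.inv_equality) (simp_all add: A.l_neg)

lemma smult_finsum:
  assumes "a \<in> carrier A" "f \<in> S \<rightarrow> carrier M"
  shows "a \<odot>\<^bsub>M\<^esub> (\<Oplus>\<^bsub>M\<^esub>i\<in>S. f i) = (\<Oplus>\<^bsub>M\<^esub>i\<in>S. a \<odot>\<^bsub>M\<^esub> f i)"
  using assms(2)
proof (induction S rule: infinite_finite_induct)
  case (insert i S)
  then have "f i \<in> carrier M" "f \<in> S \<rightarrow> carrier M" by auto
  with insert assms show ?case
    by (subst (1 2) M.finsum_insert) (auto simp: smult_add intro!: M.finsum_closed)
qed (use assms in auto)

end

definition right_linear ::
  "('a, 'z) ring_scheme \<Rightarrow> ('a, 'm) module \<Rightarrow> ('a, 'k) module \<Rightarrow> ('m \<Rightarrow> 'k) \<Rightarrow> bool" where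
  "right_linear A M N h \<longleftrightarrow> (\<forall>x\<in>carrier M. h x \<in> carrier N) \<and>
    (\<forall>x\<in>carrier M. \<forall>y\<in>carrier M. h (x \<oplus>\<^bsub>M\<^esub> y) = h x \<oplus>\<^bsub>N\<^esub> h y) \<and>
    (\<forall>a\<in>carrier A. \<forall>x\<in>carrier M. h (a \<odot>\<^bsub>M\<^esub> x) = a \<odot>\<^bsub>N\<^esub> h x)"

lemma right_linearD:
  assumes "right_linear A M N h" "x \<in> carrier M"
  shows "h x \<in> carrier N" "y \<in> carrier M \<Longrightarrow> h (x \<oplus>\<^bsub>M\<^esub> y) = h x \<oplus>\<^bsub>N\<^esub> h y"
    "a \<in> carrier A \<Longrightarrow> h (a \<odot>\<^bsub>M\<^esub> x) = a \<odot>\<^bsub>N\<^esub> h x"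
  using assms by (auto simp: right_linear_def)

lemma right_linear_zero:
  assumes "right_module A M" "right_module A N" "right_linear A M N h"
  shows "h \<zero>\<^bsub>M\<^esub> = \<zero>\<^bsub>N\<^esub>"
proof -
  interpret M: right_module A M by fact
  interpret N: right_module A N by fact
  have "h (\<zero>\<^bsub>A\<^esub> \<odot>\<^bsub>M\<^esub> \<zero>\<^bsub>M\<^esub>) = \<zero>\<^bsub>A\<^esub> \<odot>\<^bsub>N\<^esub> h \<zero>\<^bsub>M\<^esub>"
    by (rule right_linearD[OF assms(3)]) simp_all
  then show ?thesis using right_linearD(1)[OF assms(3), of "\<zero>\<^bsub>M\<^esub>"] by simp
qed

lemma right_linear_minus:
  assumes "right_module A M" "right_module A N" "right_linear A M N h" "x \<in> carrier M"
  shows "h (\<ominus>\<^bsub>M\<^esub> x) = \<ominus>\<^bsub>N\<^esub> h x"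
proof -
  interpret M: right_module A M by fact
  interpret N: right_module A N by fact
  show ?thesis using right_linearD[OF assms(3,4)] assms(4)
    by (simp add: M.uminus_smult N.uminus_smult)
qed

lemma right_linear_comp:
  "right_linear A M N h \<Longrightarrow> right_linear A N P k \<Longrightarrow> right_linear A M P (\<lambda>x. k (h x))"
  by (simp add: right_linear_def)

lemma right_module_sub:
  assumes "right_module A M" "H \<subseteq> carrier M" "\<zero>\<^bsub>M\<^esub> \<in> H"
    "\<And>x y. x \<in> H \<Longrightarrow> y \<in> H \<Longrightarrow> x \<oplus>\<^bsub>M\<^esub> y \<in> H" "\<And>a x. a \<in> carrier A \<Longrightarrow> x \<in> H \<Longrightarrow> a \<odot>\<^bsub>M\<^esub> x \<in> H"
  shows "right_module A (M\<lparr>carrier := H\<rparr>)"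
proof -
  interpret right_module A M by fact
  have "abelian_group (M\<lparr>carrier := H\<rparr>)"
  proof (rule abelian_groupI)
    fix x assume x: "x \<in> carrier (M\<lparr>carrier := H\<rparr>)"
    then have "\<ominus>\<^bsub>M\<^esub> x \<in> H" "\<ominus>\<^bsub>M\<^esub> x \<oplus>\<^bsub>M\<^esub> x = \<zero>\<^bsub>M\<^esub>"
      using assms(2,5) by (auto simp: uminus_smult[of x, symmetric] M.l_neg subset_eq)
        (metis A.add.inv_closed A.one_closed uminus_smult)
    then show "\<exists>y\<in>carrier (M\<lparr>carrier := H\<rparr>). y \<oplus>\<^bsub>M\<lparr>carrier := H\<rparr>\<^esub> x = \<zero>\<^bsub>M\<lparr>carrier := H\<rparr>\<^esub>" by auto
  qed (use assms(2-4) in \<open>auto simp: M.a_ac subset_eq\<close>)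
  then show ?thesis
    by (intro right_module.intro right_module_axioms.intro A.ring_axioms)
      (use assms in \<open>auto simp: smult_scalar_add smult_add smult_mult subset_eq\<close>)
qed

lemma right_linear_kernel:
  assumes "right_module A M" "right_module A N" "right_linear A M N h"
  shows "right_module A (M\<lparr>carrier := a_kernel M N h\<rparr>)"
proof -
  interpret M: right_module A M by fact
  interpret N: right_module A N by fact
  show ?thesis
    by (rule right_module_sub)
      (use assms right_linear_zero[OF assms] in \<open>auto simp: a_kernel_def' right_linear_def\<close>)
qed

section \<open>Free modules\<close>

lemma free_module_simps [simp]:
  "\<zero>\<^bsub>free_module A X\<^esub> = (\<lambda>x. \<zero>\<^bsub>A\<^esub>)"
  "f \<oplus>\<^bsub>free_module A X\<^esub> g = (\<lambda>x. f x \<oplus>\<^bsub>A\<^esub> g x)"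
  "a \<odot>\<^bsub>free_module A X\<^esub> f = (\<lambda>x. f x \<otimes>\<^bsub>A\<^esub> a)"
  by (simp_all add: free_module_def)

lemma free_module_carrier:
  "f \<in> carrier (free_module A X) \<longleftrightarrow>
    (\<forall>x. f x \<in> carrier A) \<and> finite {x. f x \<noteq> \<zero>\<^bsub>A\<^esub>} \<and> {x. f x \<noteq> \<zero>\<^bsub>A\<^esub>} \<subseteq> X"
  by (auto simp: free_module_def)

lemma free_module_carrierI:
  assumes "\<And>x. f x \<in> carrier A" "finite S" "S \<subseteq> X" "\<And>x. x \<notin> S \<Longrightarrow> f x = \<zero>\<^bsub>A\<^esub>"
  shows "f \<in> carrier (free_module A X)"
proof -
  have "{x. f x \<noteq> \<zero>\<^bsub>A\<^esub>} \<subseteq> S" using assms(4) by auto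
  then show ?thesis using assms(1-3) finite_subset unfolding free_module_carrier by blast
qed

lemma free_module_mono: "X \<subseteq> Y \<Longrightarrow> carrier (free_module A X) \<subseteq> carrier (free_module A Y)"
  by (intro subsetI) (simp add: free_module_carrier, blast)

context ring
begin

lemma free_module_right_module: "right_module R (free_module R X)"
proof -
  let ?F = "free_module R X"
  have closed: "(\<lambda>x. f x \<oplus> g x) \<in> carrier ?F" if "f \<in> carrier ?F" "g \<in> carrier ?F" for f g
    by (rule free_module_carrierI[of _ _ "{x. f x \<noteq> \<zero>} \<union> {x. g x \<noteq> \<zero>}"])
      (use that in \<open>auto simp: free_module_carrier\<close>)
  have zero: "(\<lambda>x. \<zero>) \<in> carrier ?F" by (rule free_module_carrierI[of _ _ "{}"]) auto
  have smult: "(\<lambda>x. f x \<otimes> a) \<in> carrier ?F" if "f \<in> carrier ?F" "a \<in> carrier R" for f a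
    by (rule free_module_carrierI[of _ _ "{x. f x \<noteq> \<zero>}"])
      (use that in \<open>auto simp: free_module_carrier\<close>)
  have "abelian_group ?F"
  proof (rule abelian_groupI)
    fix f assume f: "f \<in> carrier ?F"
    have "(\<lambda>x. \<ominus> f x) \<in> carrier ?F"
      by (rule free_module_carrierI[of _ _ "{x. f x \<noteq> \<zero>}"])
        (use f in \<open>auto simp: free_module_carrier\<close>)
    then show "\<exists>g\<in>carrier ?F. g \<oplus>\<^bsub>?F\<^esub> f = \<zero>\<^bsub>?F\<^esub>"
      by (rule bexI[rotated]) (use f in \<open>simp add: free_module_carrier l_neg\<close>)
  qed (use closed zero in \<open>auto simp: free_module_carrier a_ac\<close>)
  then show ?thesis
    by (intro right_module.intro right_module_axioms.intro ring_axioms)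
      (use closed zero smult in \<open>auto simp: free_module_carrier r_distr l_distr m_assoc\<close>)
qed

lemma basis_vector_carrier [simp]: "x \<in> X \<Longrightarrow> basis_vector R x \<in> carrier (free_module R X)"
  by (rule free_module_carrierI[of _ _ "{x}"]) (auto simp: basis_vector_def)

lemma free_module_induct [consumes 1, case_names zero add basis]:
  assumes f: "f \<in> carrier (free_module R X)" and zero: "P (\<lambda>x. \<zero>)"
    and add: "\<And>f g. f \<in> carrier (free_module R X) \<Longrightarrow> g \<in> carrier (free_module R X) \<Longrightarrow>
      P f \<Longrightarrow> P g \<Longrightarrow> P (\<lambda>x. f x \<oplus> g x)"
    and basis: "\<And>a x. a \<in> carrier R \<Longrightarrow> x \<in> X \<Longrightarrow> P (a \<odot>\<^bsub>free_module R X\<^esub> basis_vector R x)"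
  shows "P f"
proof -
  have "P f" if "finite S" "f \<in> carrier (free_module R X)" "{x. f x \<noteq> \<zero>} = S" for S f
    using that
  proof (induction S arbitrary: f rule: finite_induct)
    case empty
    then have "f = (\<lambda>x. \<zero>)" by auto
    then show ?case using zero by simp
  next
    case (insert x S)
    let ?g = "f(x := \<zero>)" and ?b = "f x \<odot>\<^bsub>free_module R X\<^esub> basis_vector R x"
    have x: "x \<in> X" "f x \<in> carrier R" using insert.prems by (auto simp: free_module_carrier)
    have g: "?g \<in> carrier (free_module R X)"
      by (rule free_module_carrierI[of _ _ "{x. f x \<noteq> \<zero>}"])
        (use insert.prems(1) in \<open>auto simp: free_module_carrier\<close>)
    have "P ?g" by (rule insert.IH[OF g]) (use insert in auto)
    moreover have "?b \<in> carrier (free_module R X)"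
      by (rule right_module.smult_closed[OF free_module_right_module x(2) basis_vector_carrier[OF x(1)]])
    ultimately have "P (\<lambda>y. ?g y \<oplus> ?b y)" using add g basis x by blast
    moreover have "(\<lambda>y. ?g y \<oplus> ?b y) = f"
      using insert.prems(1) x by (auto simp: fun_eq_iff basis_vector_def free_module_carrier)
    ultimately show ?case by simp
  qed
  then show ?thesis using f by (auto simp: free_module_carrier)
qed

end

context right_module
begin

lemma linear_ext_superset:
  assumes f: "f \<in> carrier (free_module A X)" and g: "\<And>x. x \<in> X \<Longrightarrow> g x \<in> carrier M"
    and S: "finite S" "{x. f x \<noteq> \<zero>} \<subseteq> S" "S \<subseteq> X"
  shows "linear_ext A M g f = (\<Oplus>\<^bsub>M\<^esub>x\<in>S. f x \<odot>\<^bsub>M\<^esub> g x)"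
  unfolding linear_ext_def
  by (rule M.add.finprod_mono_neutral_cong_left) (use assms in \<open>auto simp: free_module_carrier subset_eq\<close>)

lemma linear_ext_right_linear:
  assumes g: "\<And>x. x \<in> X \<Longrightarrow> g x \<in> carrier M"
  shows "right_linear A (free_module A X) M (linear_ext A M g)"
proof -
  interpret F: right_module A "free_module A X" by (rule A.free_module_right_module)
  have closed: "linear_ext A M g f \<in> carrier M" if "f \<in> carrier (free_module A X)" for f
    unfolding linear_ext_def
    by (rule M.finsum_closed) (use that g in \<open>auto simp: free_module_carrier\<close>)
  moreover have "linear_ext A M g (f \<oplus>\<^bsub>free_module A X\<^esub> f') = linear_ext A M g f \<oplus>\<^bsub>M\<^esub> linear_ext A M g f'"
    if f: "f \<in> carrier (free_module A X)" "f' \<in> carrier (free_module A X)" for f f'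
  proof -
    define S where "S = {x. f x \<noteq> \<zero>} \<union> {x. f' x \<noteq> \<zero>}"
    have S: "finite S" "S \<subseteq> X" using f by (auto simp: S_def free_module_carrier)
    have 1: "linear_ext A M g h = (\<Oplus>\<^bsub>M\<^esub>x\<in>S. h x \<odot>\<^bsub>M\<^esub> g x)" 
      if "h \<in> {f, f', f \<oplus>\<^bsub>free_module A X\<^esub> f'}" for h
      by (rule linear_ext_superset[of _ X])
        (use that f S g F.a_closed[OF f] in \<open>auto simp: S_def free_module_carrier\<close>)
    have "(\<Oplus>\<^bsub>M\<^esub>x\<in>S. (f x \<oplus> f' x) \<odot>\<^bsub>M\<^esub> g x) = (\<Oplus>\<^bsub>M\<^esub>x\<in>S. f x \<odot>\<^bsub>M\<^esub> g x \<oplus>\<^bsub>M\<^esub> f' x \<odot>\<^bsub>M\<^esub> g x)"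
      using f S g by (intro M.finsum_cong') (auto simp: free_module_carrier smult_scalar_add subset_eq)
    also have "\<dots> = (\<Oplus>\<^bsub>M\<^esub>x\<in>S. f x \<odot>\<^bsub>M\<^esub> g x) \<oplus>\<^bsub>M\<^esub> (\<Oplus>\<^bsub>M\<^esub>x\<in>S. f' x \<odot>\<^bsub>M\<^esub> g x)"
      using f S g by (intro M.finsum_addf) (auto simp: free_module_carrier subset_eq)
    finally show ?thesis using 1 by simp
  qed
  moreover have "linear_ext A M g (a \<odot>\<^bsub>free_module A X\<^esub> f) = a \<odot>\<^bsub>M\<^esub> linear_ext A M g f"
    if f: "f \<in> carrier (free_module A X)" and a: "a \<in> carrier A" for f a
  proof -
    define S where "S = {x. f x \<noteq> \<zero>}"
    have S: "finite S" "S \<subseteq> X" using f by (auto simp: S_def free_module_carrier)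
    have 1: "linear_ext A M g h = (\<Oplus>\<^bsub>M\<^esub>x\<in>S. h x \<odot>\<^bsub>M\<^esub> g x)" 
      if "h \<in> {f, a \<odot>\<^bsub>free_module A X\<^esub> f}" for h
      by (rule linear_ext_superset[of _ X])
        (use that f S g a F.smult_closed[OF a f] in \<open>auto simp: S_def free_module_carrier\<close>)
    have "(\<Oplus>\<^bsub>M\<^esub>x\<in>S. (f x \<otimes> a) \<odot>\<^bsub>M\<^esub> g x) = (\<Oplus>\<^bsub>M\<^esub>x\<in>S. a \<odot>\<^bsub>M\<^esub> (f x \<odot>\<^bsub>M\<^esub> g x))"
      using f S g a by (intro M.finsum_cong') (auto simp: free_module_carrier smult_mult subset_eq)
    also have "\<dots> = a \<odot>\<^bsub>M\<^esub> (\<Oplus>\<^bsub>M\<^esub>x\<in>S. f x \<odot>\<^bsub>M\<^esub> g x)"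
      using f S g a by (intro smult_finsum[symmetric]) (auto simp: free_module_carrier subset_eq)
    finally show ?thesis using 1 by simp
  qed
  ultimately show ?thesis unfolding right_linear_def by blast
qed

lemma linear_ext_basis_vector:
  assumes "g x \<in> carrier M"
  shows "linear_ext A M g (basis_vector A x) = g x"
proof -
  have "linear_ext A M g (basis_vector A x) = (\<Oplus>\<^bsub>M\<^esub>y\<in>{x}. basis_vector A x y \<odot>\<^bsub>M\<^esub> g y)"
    by (rule linear_ext_superset[of _ "{x}"]) (use assms A.basis_vector_carrier[of x "{x}"] in \<open>auto simp: basis_vector_def\<close>)
  also have "\<dots> = g x" using assms by (simp add: basis_vector_def)
  finally show ?thesis .
qed

lemma right_linear_eqI:
  assumes "right_linear A (free_module A X) M h" "right_linear A (free_module A X) M k"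
    and "\<And>x. x \<in> X \<Longrightarrow> h (basis_vector A x) = k (basis_vector A x)"
    and "f \<in> carrier (free_module A X)"
  shows "h f = k f"
  using assms(4)
proof (induction f rule: A.free_module_induct)
  case zero
  have "right_module A M" by (rule right_module_axioms)
  then show ?case
    using right_linear_zero[OF A.free_module_right_module _ assms(1)]
      right_linear_zero[OF A.free_module_right_module _ assms(2)] by simp
next
  case (add f g)
  then show ?case using right_linearD(2)[OF assms(1), of f g] right_linearD(2)[OF assms(2), of f g] by simp
next
  case (basis a x)
  then show ?case
    using right_linearD(3)[OF assms(1), of "basis_vector A x" a]
      right_linearD(3)[OF assms(2), of "basis_vector A x" a] assms(3) by simp
qed

end

section \<open>Quotients\<close>

context abelian_subgroup
begin

lemma coset_eq_iff: "x \<in> carrier G \<Longrightarrow> y \<in> carrier G \<Longrightarrow> H +> x = H +> y \<longleftrightarrow> x \<oplus> \<ominus> y \<in> H"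
  by (metis a_rcos_module a_rcos_self a_repr_independence')

lemma coset_eq_self_iff: "x \<in> carrier G \<Longrightarrow> H +> x = H \<longleftrightarrow> x \<in> H"
  using coset_eq_iff[of x \<zero>] a_subset minus_equality[of \<zero> \<zero>] by simp

end

locale right_submodule = right_module A M + H: abelian_subgroup H M for A (structure) and M :: "('a, 'm) module" (structure) and H +
  assumes sub_smult: "a \<in> carrier A \<Longrightarrow> x \<in> H \<Longrightarrow> a \<odot>\<^bsub>M\<^esub> x \<in> H"
begin

lemma quotient_carrier: "carrier (quotient M H) = (\<lambda>x. H +>\<^bsub>M\<^esub> x) ` carrier M"
  by (auto simp: quotient_def FactRing_def A_RCOSETS_def')

lemma quotient_zero: "\<zero>\<^bsub>quotient M H\<^esub> = H"
  by (simp add: quotient_def FactRing_def)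

lemma quotient_add: "x \<in> carrier M \<Longrightarrow> y \<in> carrier M \<Longrightarrow>
    (H +>\<^bsub>M\<^esub> x) \<oplus>\<^bsub>quotient M H\<^esub> (H +>\<^bsub>M\<^esub> y) = H +>\<^bsub>M\<^esub> (x \<oplus>\<^bsub>M\<^esub> y)"
  by (simp add: quotient_def FactRing_def H.a_rcos_sum)

text \<open>The union in the definition runs over all representatives; stability of H under the
  action makes all its members the same coset.\<close>

lemma quotient_smult:
  assumes "a \<in> carrier A" "x \<in> carrier M"
  shows "a \<odot>\<^bsub>quotient M H\<^esub> (H +>\<^bsub>M\<^esub> x) = H +>\<^bsub>M\<^esub> (a \<odot>\<^bsub>M\<^esub> x)"
proof -
  have "H +>\<^bsub>M\<^esub> (a \<odot>\<^bsub>M\<^esub> y) = H +>\<^bsub>M\<^esub> (a \<odot>\<^bsub>M\<^esub> x)" if "y \<in> H +>\<^bsub>M\<^esub> x" for y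
  proof -
    have y: "y \<in> carrier M" using that assms H.a_elemrcos_carrier by blast
    have "y \<oplus>\<^bsub>M\<^esub> \<ominus>\<^bsub>M\<^esub> x \<in> H" using H.a_rcos_module_imp that assms by blast
    then have "a \<odot>\<^bsub>M\<^esub> (y \<oplus>\<^bsub>M\<^esub> \<ominus>\<^bsub>M\<^esub> x) \<in> H" using sub_smult assms by blast
    then show ?thesis using y assms by (simp add: H.coset_eq_iff smult_add smult_minus)
  qed
  moreover have "x \<in> H +>\<^bsub>M\<^esub> x" using assms H.a_rcos_self by blast
  ultimately have "(\<Union>y\<in>H +>\<^bsub>M\<^esub> x. H +>\<^bsub>M\<^esub> (a \<odot>\<^bsub>M\<^esub> y)) = H +>\<^bsub>M\<^esub> (a \<odot>\<^bsub>M\<^esub> x)" by blast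
  then show ?thesis by (simp add: quotient_def)
qed

lemma quotient_right_module: "right_module A (quotient M H)"
proof -
  have "abelian_group (quotient M H)"
  proof (rule abelian_groupI; (unfold quotient_carrier)?)
    show "\<zero>\<^bsub>quotient M H\<^esub> \<in> (\<lambda>x. H +>\<^bsub>M\<^esub> x) ` carrier M"
      using H.coset_eq_self_iff[of "\<zero>\<^bsub>M\<^esub>"] by (metis M.zero_closed H.zero_closed imageI quotient_zero)
  next
    fix X assume "X \<in> (\<lambda>x. H +>\<^bsub>M\<^esub> x) ` carrier M"
    then obtain x where x: "x \<in> carrier M" "X = H +>\<^bsub>M\<^esub> x" by auto
    have "H +>\<^bsub>M\<^esub> \<zero>\<^bsub>M\<^esub> = H" by (simp add: H.coset_eq_self_iff)
    with x quotient_add[of "\<zero>\<^bsub>M\<^esub>" x] show "\<zero>\<^bsub>quotient M H\<^esub> \<oplus>\<^bsub>quotient M H\<^esub> X = X"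
      by (simp add: quotient_zero)
    from x quotient_add[of "\<ominus>\<^bsub>M\<^esub> x" x]
    show "\<exists>Y\<in>(\<lambda>x. H +>\<^bsub>M\<^esub> x) ` carrier M. Y \<oplus>\<^bsub>quotient M H\<^esub> X = \<zero>\<^bsub>quotient M H\<^esub>"
      by (intro bexI[of _ "H +>\<^bsub>M\<^esub> (\<ominus>\<^bsub>M\<^esub> x)"]) (simp_all add: quotient_zero M.l_neg \<open>H +>\<^bsub>M\<^esub> \<zero>\<^bsub>M\<^esub> = H\<close>)
  qed (auto simp: quotient_add M.a_ac)
  then show ?thesis
    by (intro right_module.intro right_module_axioms.intro A.ring_axioms)
      (auto simp: quotient_carrier quotient_smult quotient_add smult_scalar_add smult_add smult_mult)
qed

lemma coset_right_linear: "right_linear A M (quotient M H) (\<lambda>x. H +>\<^bsub>M\<^esub> x)"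
  by (auto simp: right_linear_def quotient_carrier quotient_add quotient_smult)

end

section \<open>Separated modules\<close>

definition right_regular :: "('a, 'z) ring_scheme \<Rightarrow> ('a, 'a) module" where
  "right_regular A = \<lparr>carrier = carrier A, monoid.mult = monoid.mult A, one = one A,
     ring.zero = ring.zero A, ring.add = ring.add A, smult = (\<lambda>a x. x \<otimes>\<^bsub>A\<^esub> a)\<rparr>"

lemma right_regular_simps [simp]:
  "carrier (right_regular A) = carrier A" "\<zero>\<^bsub>right_regular A\<^esub> = \<zero>\<^bsub>A\<^esub>"
  "x \<oplus>\<^bsub>right_regular A\<^esub> y = x \<oplus>\<^bsub>A\<^esub> y" "a \<odot>\<^bsub>right_regular A\<^esub> x = x \<otimes>\<^bsub>A\<^esub> a"
  by (simp_all add: right_regular_def)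

lemma (in ring) right_regular_right_module: "right_module R (right_regular R)"
proof -
  have "abelian_group (right_regular R)"
    by (rule abelian_groupI) (auto simp: a_ac intro: bexI[of _ "\<ominus> _"] l_neg)
  then show ?thesis
    by (intro right_module.intro right_module_axioms.intro ring_axioms) (auto simp: r_distr l_distr m_assoc)
qed

text \<open>All that the syzygy argument uses of the algebra: words, and those identities between
  them in which no power of a is left over.\<close>

locale word_algebra = ring A for A (structure) +
  fixes n :: nat and W :: "nat list \<Rightarrow> 'a"
  assumes odd_n: "odd n"
    and W_closed: "set w \<subseteq> {1..<n} \<Longrightarrow> W w \<in> carrier A"
    and W_append: "set u \<subseteq> {1..<n} \<Longrightarrow> set v \<subseteq> {1..<n} \<Longrightarrow> W (u @ v) = W u \<otimes> W v"
    and W_tleq: "set w \<subseteq> {1..<n} \<Longrightarrow> tleq n (0, w) (0, w') \<Longrightarrow> W w = W w'"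
begin

definition multiples :: "('a, 'm) module \<Rightarrow> nat list \<Rightarrow> 'm set" where
  "multiples M v = (\<lambda>x. W v \<odot>\<^bsub>M\<^esub> x) ` carrier M"

text \<open>\<open>cups M v m\<close> is the subgroup \<open>M U\<^sub>1 v + \<dots> + M U\<^sub>m v\<close>.\<close>

primrec cups :: "('a, 'm) module \<Rightarrow> nat list \<Rightarrow> nat \<Rightarrow> 'm set" where
  "cups M v 0 = {\<zero>\<^bsub>M\<^esub>}"
| "cups M v (Suc m) = {s \<oplus>\<^bsub>M\<^esub> W (Suc m # v) \<odot>\<^bsub>M\<^esub> x | s x. s \<in> cups M v m \<and> x \<in> carrier M}"

text \<open>The index m of the overview is \<open>Suc m\<close> here. Only the inclusion with
  content is demanded; the reverse one is \<open>cups_Cons\<close>. For \<open>m = 0\<close> the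
  truncated \<open>m - 1\<close> yields the zero group, as it should.\<close>

definition separated :: "('a, 'm) module \<Rightarrow> bool" where
  "separated M \<longleftrightarrow> (\<forall>m v. Suc m < n \<longrightarrow> spaced n (m + 3) v \<longrightarrow>
    multiples M (Suc m # v) \<inter> cups M v m \<subseteq> cups M (Suc m # v) (m - 1))"

lemma W_Cons_closed: "m < n \<Longrightarrow> spaced n b v \<Longrightarrow> 1 \<le> b \<Longrightarrow> 1 \<le> m \<Longrightarrow> W (m # v) \<in> carrier A"
  using spaced_set[of n b v] by (intro W_closed) auto

context
  fixes M :: "('a, 'm) module"
  assumes M: "right_module A M"
begin

interpretation right_module A M by (rule M)

lemma cups_closed: "m < n \<Longrightarrow> spaced n b v \<Longrightarrow> 1 \<le> b \<Longrightarrow> x \<in> cups M v m \<Longrightarrow> x \<in> carrier M"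
  by (induction m arbitrary: x) (use W_Cons_closed in \<open>fastforce+\<close>)

lemma cups_zero: "m < n \<Longrightarrow> spaced n b v \<Longrightarrow> 1 \<le> b \<Longrightarrow> \<zero>\<^bsub>M\<^esub> \<in> cups M v m"
proof (induction m)
  case (Suc m)
  then have "\<zero>\<^bsub>M\<^esub> = \<zero>\<^bsub>M\<^esub> \<oplus>\<^bsub>M\<^esub> W (Suc m # v) \<odot>\<^bsub>M\<^esub> \<zero>\<^bsub>M\<^esub>" using W_Cons_closed by simp
  with Suc show ?case by fastforce
qed simp

lemma cups_add:
  "m < n \<Longrightarrow> spaced n b v \<Longrightarrow> 1 \<le> b \<Longrightarrow> x \<in> cups M v m \<Longrightarrow> y \<in> cups M v m \<Longrightarrow> x \<oplus>\<^bsub>M\<^esub> y \<in> cups M v m"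
proof (induction m arbitrary: x y)
  case (Suc m)
  let ?w = "W (Suc m # v)"
  have w: "?w \<in> carrier A" using Suc.prems W_Cons_closed by simp
  obtain s a where s: "s \<in> cups M v m" "a \<in> carrier M" "x = s \<oplus>\<^bsub>M\<^esub> ?w \<odot>\<^bsub>M\<^esub> a" using Suc.prems by auto
  obtain t b where t: "t \<in> cups M v m" "b \<in> carrier M" "y = t \<oplus>\<^bsub>M\<^esub> ?w \<odot>\<^bsub>M\<^esub> b" using Suc.prems by auto
  have "s \<in> carrier M" "t \<in> carrier M"
    using s t Suc.prems(1) cups_closed[OF _ Suc.prems(2,3), of m] by simp_all
  then have "x \<oplus>\<^bsub>M\<^esub> y = (s \<oplus>\<^bsub>M\<^esub> t) \<oplus>\<^bsub>M\<^esub> ?w \<odot>\<^bsub>M\<^esub> (a \<oplus>\<^bsub>M\<^esub> b)"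
    using s t w by (simp add: smult_add M.a_ac)
  moreover have "s \<oplus>\<^bsub>M\<^esub> t \<in> cups M v m" using Suc s t by simp
  ultimately show ?case using s t by auto
qed simp

lemma cups_minus:
  "m < n \<Longrightarrow> spaced n b v \<Longrightarrow> 1 \<le> b \<Longrightarrow> x \<in> cups M v m \<Longrightarrow> \<ominus>\<^bsub>M\<^esub> x \<in> cups M v m"
proof (induction m arbitrary: x)
  case (Suc m)
  let ?w = "W (Suc m # v)"
  have w: "?w \<in> carrier A" using Suc.prems W_Cons_closed by simp
  obtain s a where s: "s \<in> cups M v m" "a \<in> carrier M" "x = s \<oplus>\<^bsub>M\<^esub> ?w \<odot>\<^bsub>M\<^esub> a" using Suc.prems by auto
  have "s \<in> carrier M" using s Suc.prems(1) cups_closed[OF _ Suc.prems(2,3), of m s] by simp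
  then have "\<ominus>\<^bsub>M\<^esub> x = \<ominus>\<^bsub>M\<^esub> s \<oplus>\<^bsub>M\<^esub> ?w \<odot>\<^bsub>M\<^esub> (\<ominus>\<^bsub>M\<^esub> a)"
    using s w by (simp add: smult_minus M.minus_add)
  moreover have "\<ominus>\<^bsub>M\<^esub> s \<in> cups M v m" using Suc s by simp
  ultimately show ?case using s by auto
qed (use M.minus_equality[of "\<zero>\<^bsub>M\<^esub>" "\<zero>\<^bsub>M\<^esub>"] in simp)

lemma cups_mono: "m < n \<Longrightarrow> spaced n b v \<Longrightarrow> 1 \<le> b \<Longrightarrow> x \<in> cups M v k \<Longrightarrow> k \<le> m \<Longrightarrow> x \<in> cups M v m"
proof (induction m)
  case (Suc m)
  show ?case
  proof (cases "k = Suc m")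
    case False
    then have "x \<in> cups M v m" using Suc by simp
    moreover have "m < n" using Suc.prems(1) by simp
    ultimately have x: "x \<in> cups M v m" "x \<in> carrier M" using cups_closed[OF _ Suc.prems(2,3)] by blast+
    then have "x = x \<oplus>\<^bsub>M\<^esub> W (Suc m # v) \<odot>\<^bsub>M\<^esub> \<zero>\<^bsub>M\<^esub>" using W_Cons_closed Suc.prems by simp
    then show ?thesis using x by fastforce
  qed (use Suc in simp)
qed simp

lemma cups_mem:
  assumes "m < n" "spaced n b v" "1 \<le> b" "1 \<le> i" "i \<le> m" "x \<in> carrier M"
  shows "W (i # v) \<odot>\<^bsub>M\<^esub> x \<in> cups M v m"
proof (cases i)
  case (Suc k)
  have "W (i # v) \<odot>\<^bsub>M\<^esub> x = \<zero>\<^bsub>M\<^esub> \<oplus>\<^bsub>M\<^esub> W (Suc k # v) \<odot>\<^bsub>M\<^esub> x"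
    using assms Suc W_Cons_closed by simp
  then have "W (i # v) \<odot>\<^bsub>M\<^esub> x \<in> cups M v (Suc k)"
    using assms Suc cups_zero[of k b v] by auto
  then show ?thesis using assms Suc cups_mono[of m b v _ "Suc k"] by simp
qed (use assms in simp)

lemma multiples_add:
  assumes "set v \<subseteq> {1..<n}" "x \<in> multiples M v" "y \<in> multiples M v"
  shows "x \<oplus>\<^bsub>M\<^esub> y \<in> multiples M v"
proof -
  obtain a b where "a \<in> carrier M" "x = W v \<odot>\<^bsub>M\<^esub> a" "b \<in> carrier M" "y = W v \<odot>\<^bsub>M\<^esub> b"
    using assms by (auto simp: multiples_def)
  then have "x \<oplus>\<^bsub>M\<^esub> y = W v \<odot>\<^bsub>M\<^esub> (a \<oplus>\<^bsub>M\<^esub> b)" "a \<oplus>\<^bsub>M\<^esub> b \<in> carrier M"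
    using W_closed[OF assms(1)] by (simp_all add: smult_add)
  then show ?thesis by (auto simp: multiples_def)
qed

lemma multiples_minus:
  assumes "set v \<subseteq> {1..<n}" "x \<in> multiples M v"
  shows "\<ominus>\<^bsub>M\<^esub> x \<in> multiples M v"
proof -
  obtain a where "a \<in> carrier M" "x = W v \<odot>\<^bsub>M\<^esub> a" using assms by (auto simp: multiples_def)
  then have "\<ominus>\<^bsub>M\<^esub> x = W v \<odot>\<^bsub>M\<^esub> (\<ominus>\<^bsub>M\<^esub> a)" "\<ominus>\<^bsub>M\<^esub> a \<in> carrier M"
    using W_closed[OF assms(1)] by (simp_all add: smult_minus)
  then show ?thesis by (auto simp: multiples_def)
qed

lemma act_append:
  "set u \<subseteq> {1..<n} \<Longrightarrow> set v \<subseteq> {1..<n} \<Longrightarrow> x \<in> carrier M \<Longrightarrow> W (u @ v) \<odot>\<^bsub>M\<^esub> x = W v \<odot>\<^bsub>M\<^esub> (W u \<odot>\<^bsub>M\<^esub> x)"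
  by (simp add: W_append W_closed smult_mult)

text \<open>For i \<le> m - 2 the generators U_i and U_m commute, so an element of M U_i U_m v is at
  the same time a multiple of U_m v and a multiple of U_i v.\<close>

lemma cups_Cons:
  assumes "m < n" "spaced n (m + 2) v" "1 \<le> m"
  shows "k + 2 \<le> m \<Longrightarrow> x \<in> cups M (m # v) k \<Longrightarrow> x \<in> multiples M (m # v) \<inter> cups M v k"
proof (induction k arbitrary: x)
  have v: "set v \<subseteq> {1..<n}" using spaced_set[OF assms(2)] by auto
  case 0
  have "W (m # v) \<odot>\<^bsub>M\<^esub> \<zero>\<^bsub>M\<^esub> = \<zero>\<^bsub>M\<^esub>" using W_Cons_closed assms by simp
  then have "\<zero>\<^bsub>M\<^esub> \<in> multiples M (m # v)" unfolding multiples_def by (metis M.zero_closed imageI)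
  with 0 show ?case by simp
next
  have v: "set v \<subseteq> {1..<n}" using spaced_set[OF assms(2)] by auto
  case (Suc k)
  then obtain s a where s: "s \<in> cups M (m # v) k" "a \<in> carrier M"
    "x = s \<oplus>\<^bsub>M\<^esub> W (Suc k # m # v) \<odot>\<^bsub>M\<^esub> a" by auto
  have 1: "W (Suc k # m # v) \<odot>\<^bsub>M\<^esub> a = W (m # v) \<odot>\<^bsub>M\<^esub> (W [Suc k] \<odot>\<^bsub>M\<^esub> a)"
    using act_append[of "[Suc k]" "m # v" a] Suc.prems assms v s by simp
  have "tleq n (0, Suc k # m # v) (0, m # Suc k # v)"
    using tleq_comm[of "Suc k" n m 0 "[]" v] Suc.prems assms by simp
  then have "W (Suc k # m # v) = W (m # Suc k # v)"
    using Suc.prems assms v by (intro W_tleq) auto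
  then have 2: "W (Suc k # m # v) \<odot>\<^bsub>M\<^esub> a = W (Suc k # v) \<odot>\<^bsub>M\<^esub> (W [m] \<odot>\<^bsub>M\<^esub> a)"
    using act_append[of "[m]" "Suc k # v" a] Suc.prems assms v s by simp
  have "W [Suc k] \<odot>\<^bsub>M\<^esub> a \<in> carrier M" "W [m] \<odot>\<^bsub>M\<^esub> a \<in> carrier M"
    using s Suc.prems assms W_closed by auto
  moreover have "s \<in> multiples M (m # v)" "s \<in> cups M v k" using Suc s by auto
  moreover have "x \<in> multiples M (m # v)"
    unfolding s(3) 1 by (rule multiples_add) (use assms v calculation in \<open>auto simp: multiples_def\<close>)
  moreover have "x \<in> cups M v (Suc k)" using calculation unfolding s(3) 2 by auto
  ultimately show ?case by simp
qed

end

lemma cups_hom: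
  assumes "right_module A M" "right_module A N" "right_linear A M N h"
    and "m < n" "spaced n b v" "1 \<le> b"
  shows "x \<in> cups M v m \<Longrightarrow> h x \<in> cups N v m"
  using assms(4)
proof (induction m arbitrary: x)
  case 0
  then show ?case using right_linear_zero[OF assms(1-3)] by simp
next
  case (Suc m)
  interpret M: right_module A M by fact
  have w: "W (Suc m # v) \<in> carrier A" using Suc.prems assms W_Cons_closed by simp
  obtain s a where s: "s \<in> cups M v m" "a \<in> carrier M" "x = s \<oplus>\<^bsub>M\<^esub> W (Suc m # v) \<odot>\<^bsub>M\<^esub> a"
    using Suc.prems by auto
  have "s \<in> carrier M" using cups_closed[OF assms(1) _ assms(5,6) s(1)] Suc.prems(2) by simp
  then have "h x = h s \<oplus>\<^bsub>N\<^esub> W (Suc m # v) \<odot>\<^bsub>N\<^esub> h a"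
    using s w right_linearD[OF assms(3)] by simp
  then show ?case using Suc s right_linearD(1)[OF assms(3) s(2)] by auto
qed

lemma cups_hom_surj:
  assumes "right_module A M" "right_module A N" "right_linear A M N h" "h ` carrier M = carrier N"
    and "m < n" "spaced n b v" "1 \<le> b"
  shows "y \<in> cups N v m \<Longrightarrow> \<exists>x\<in>cups M v m. h x = y"
  using assms(5)
proof (induction m arbitrary: y)
  case 0
  then show ?case using right_linear_zero[OF assms(1-3)] by simp
next
  case (Suc m)
  interpret M: right_module A M by fact
  have w: "W (Suc m # v) \<in> carrier A" using Suc.prems assms W_Cons_closed by simp
  obtain s a where s: "s \<in> cups N v m" "a \<in> carrier N" "y = s \<oplus>\<^bsub>N\<^esub> W (Suc m # v) \<odot>\<^bsub>N\<^esub> a"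
    using Suc.prems by auto
  obtain t where t: "t \<in> cups M v m" "h t = s" using Suc s by auto
  obtain b where b: "b \<in> carrier M" "h b = a" using s(2) unfolding assms(4)[symmetric] by auto
  have "t \<in> carrier M" using cups_closed[OF assms(1) _ assms(6,7) t(1)] Suc.prems(2) by simp
  then have "h (t \<oplus>\<^bsub>M\<^esub> W (Suc m # v) \<odot>\<^bsub>M\<^esub> b) = y"
    using s t b w right_linearD[OF assms(3)] by simp
  then show ?case using t b by auto
qed

text \<open>Regularity of \<open>v\<close> is where the parity of \<open>n\<close> enters: it puts \<open>Z \<inter> F v\<close> inside \<open>Z v\<close>.\<close>

lemma multiples_kernel:
  assumes "right_module A F" "right_module A M" "right_linear A F M h"
    and v: "spaced n 1 v" and f: "f \<in> multiples F v" "h f = \<zero>\<^bsub>M\<^esub>"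
  shows "f \<in> multiples (F\<lparr>carrier := a_kernel F M h\<rparr>) v"
proof -
  interpret F: right_module A F by fact
  interpret M: right_module A M by fact
  obtain z where z: "set z \<subseteq> {1..<n}" "tleq n (0, v @ z @ v) (0, v)"
    using spaced_regular[OF v] odd_n by auto
  have s: "set v \<subseteq> {1..<n}" using spaced_set[OF v] .
  obtain g where g: "g \<in> carrier F" "f = W v \<odot>\<^bsub>F\<^esub> g" using f by (auto simp: multiples_def)
  let ?k = "W z \<odot>\<^bsub>F\<^esub> f"
  have fc: "f \<in> carrier F" using g s W_closed by simp
  have "W (v @ z @ v) = W v" using W_tleq[OF _ z(2)] z s by simp
  then have "f = W (v @ z @ v) \<odot>\<^bsub>F\<^esub> g" using g by simp
  also have "\<dots> = W v \<odot>\<^bsub>F\<^esub> ?k"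
    using act_append[OF assms(1), of "v" "z @ v" g] act_append[OF assms(1), of z v f] s z(1) g fc by simp
  finally have "f = W v \<odot>\<^bsub>F\<^esub> ?k" .
  moreover have "?k \<in> a_kernel F M h"
    using right_linearD[OF assms(3) fc] W_closed[OF z(1)] fc f by (simp add: a_kernel_def')
  ultimately show ?thesis unfolding multiples_def by simp
qed

text \<open>
  This says \<open>Tor\<^sub>1\<close> vanishes between \<open>M = F / Z\<close> and the left module \<open>A v / (A U\<^sub>1 v + \<dots> + A U\<^sub>m v)\<close>:
  by separatedness of \<open>M\<close> the top summand of \<open>f\<close> agrees modulo \<open>Z\<close> with lower ones.
\<close>

lemma cups_kernel:
  assumes F: "right_module A F" "right_module A M" "right_linear A F M h" "h ` carrier F = carrier M"
    and sep: "separated M"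
  shows "m < n \<Longrightarrow> spaced n (m + 2) v \<Longrightarrow> f \<in> cups F v m \<Longrightarrow> h f = \<zero>\<^bsub>M\<^esub> \<Longrightarrow>
    f \<in> cups (F\<lparr>carrier := a_kernel F M h\<rparr>) v m"
proof (induction m arbitrary: f)
  case (Suc m)
  interpret F: right_module A F by fact
  interpret M: right_module A M by fact
  note h = right_linearD[OF F(3)]
  let ?u = "Suc m # v" and ?Z = "F\<lparr>carrier := a_kernel F M h\<rparr>"
  have v: "spaced n (m + 3) v" "spaced n (m + 2) v" "spaced n 1 ?u"
    using Suc.prems spaced_mono[of n "Suc m + 2" v "m + 2"] by (simp_all add: numeral_3_eq_3)
  have us: "set ?u \<subseteq> {1..<n}" using spaced_set[OF v(3)] .
  have w: "W ?u \<in> carrier A" using W_closed[OF us] .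
  obtain s x where s: "s \<in> cups F v m" "x \<in> carrier F" "f = s \<oplus>\<^bsub>F\<^esub> W ?u \<odot>\<^bsub>F\<^esub> x"
    using Suc.prems by auto
  have sc: "s \<in> carrier F" using cups_closed[OF F(1) _ v(2) _ s(1)] Suc.prems(1) by simp
  \<comment> \<open>The image of the top summand of f is the negative of the image of the lower
    ones, so it lies in both groups of the separatedness condition for M.\<close>
  let ?y = "W ?u \<odot>\<^bsub>M\<^esub> h x"
  have hf: "h s \<oplus>\<^bsub>M\<^esub> ?y = \<zero>\<^bsub>M\<^esub>" using Suc.prems(4) s sc w h by simp
  have "?y = \<ominus>\<^bsub>M\<^esub> h s"
    using hf h(1)[OF sc] h(1)[OF s(2)] w by (metis M.minus_equality M.a_comm M.smult_closed)
  moreover have "h s \<in> cups M v m" by (rule cups_hom[OF F(1-3) _ v(2) _ s(1)]) (use Suc.prems in auto)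
  ultimately have "?y \<in> cups M v m" using cups_minus[OF F(2) _ v(2)] Suc.prems by simp
  moreover have "?y \<in> multiples M ?u" using h(1)[OF s(2)] by (auto simp: multiples_def)
  ultimately have "?y \<in> cups M ?u (m - 1)" using sep v(1) Suc.prems(1) unfolding separated_def by blast
  moreover have "m - 1 < n" using Suc.prems(1) by linarith
  ultimately obtain t where t: "t \<in> cups F ?u (m - 1)" "h t = ?y"
    using cups_hom_surj[OF F _ v(3)] by blast
  \<comment> \<open>The lift t of this image is a multiple of \<open>?u\<close> and also a sum over
    lower indices; so it may be moved from the top summand to the lower ones.\<close>
  have t': "t \<in> multiples F ?u \<inter> cups F v m"
  proof (cases m)
    case 0
    then have "t = W ?u \<odot>\<^bsub>F\<^esub> \<zero>\<^bsub>F\<^esub>" using t w by simp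
    then have "t \<in> multiples F ?u" unfolding multiples_def by (rule image_eqI) simp
    then show ?thesis using 0 t by simp
  next
    case m: (Suc k)
    then have "t \<in> multiples F ?u \<inter> cups F v k"
      by (intro cups_Cons[OF F(1) Suc.prems(1,2)]) (use t(1) in simp_all)
    then show ?thesis using cups_mono[OF F(1) _ v(2), of m t k] m Suc.prems(1) by simp
  qed
  have tc: "t \<in> carrier F" using cups_closed[OF F(1) _ v(2), of m t] t' Suc.prems(1) by simp
  \<comment> \<open>This splits f as (s + t) + z within the kernel: z is a multiple of
    \<open>?u\<close>, hence by regularity a multiple of a kernel element, and s + t is covered by
    the induction hypothesis.\<close>
  let ?z = "W ?u \<odot>\<^bsub>F\<^esub> x \<oplus>\<^bsub>F\<^esub> \<ominus>\<^bsub>F\<^esub> t"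
  have "W ?u \<odot>\<^bsub>F\<^esub> x \<in> multiples F ?u" using s by (auto simp: multiples_def)
  then have zm: "?z \<in> multiples F ?u"
    using multiples_add[OF F(1) us] multiples_minus[OF F(1) us] t' by blast
  have hz: "h ?z = \<zero>\<^bsub>M\<^esub>"
    using h tc s w t right_linear_minus[OF F(1-3) tc] by (simp add: M.r_neg)
  have z: "?z \<in> multiples ?Z ?u" by (rule multiples_kernel[OF F(1-3) v(3) zm hz])
  have "h (s \<oplus>\<^bsub>F\<^esub> t) = \<zero>\<^bsub>M\<^esub>" using h(2)[OF sc tc] t hf by simp
  moreover have "s \<oplus>\<^bsub>F\<^esub> t \<in> cups F v m" using cups_add[OF F(1) _ v(2) _ s(1)] t' Suc.prems(1) by simp
  ultimately have st: "s \<oplus>\<^bsub>F\<^esub> t \<in> cups ?Z v m" using Suc.IH v(2) Suc.prems(1) by simp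
  have "f = (s \<oplus>\<^bsub>F\<^esub> t) \<oplus>\<^bsub>F\<^esub> ?z"
  proof -
    have "(s \<oplus>\<^bsub>F\<^esub> t) \<oplus>\<^bsub>F\<^esub> ?z = (s \<oplus>\<^bsub>F\<^esub> W ?u \<odot>\<^bsub>F\<^esub> x) \<oplus>\<^bsub>F\<^esub> (t \<oplus>\<^bsub>F\<^esub> \<ominus>\<^bsub>F\<^esub> t)"
      using sc tc s w by (simp add: F.M.a_ac)
    then show ?thesis using s sc tc w by (simp add: F.M.r_neg)
  qed
  moreover obtain y where "y \<in> carrier ?Z" "?z = W ?u \<odot>\<^bsub>?Z\<^esub> y" using z by (auto simp: multiples_def)
  ultimately have "f = (s \<oplus>\<^bsub>F\<^esub> t) \<oplus>\<^bsub>?Z\<^esub> W ?u \<odot>\<^bsub>?Z\<^esub> y \<and> s \<oplus>\<^bsub>F\<^esub> t \<in> cups ?Z v m \<and> y \<in> carrier ?Z"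
    using st by simp
  then show ?case unfolding cups.simps by blast
qed simp

text \<open>Separatedness of F produces the required sum with summands from F. That they can be
  taken from the kernel is \<open>cups_kernel\<close> at the longer product
  \<open>Suc m # v\<close>, and this uses separatedness of M.\<close>

lemma separated_kernel:
  assumes F: "right_module A F" "right_module A M" "right_linear A F M h" "h ` carrier F = carrier M"
    and "separated F" "separated M"
  shows "separated (F\<lparr>carrier := a_kernel F M h\<rparr>)"
  unfolding separated_def
proof (intro allI impI subsetI)
  fix m v f
  let ?u = "Suc m # v" and ?Z = "F\<lparr>carrier := a_kernel F M h\<rparr>"
  assume m: "Suc m < n" and v: "spaced n (m + 3) v" and f: "f \<in> multiples ?Z ?u \<inter> cups ?Z v m"
  have v2: "spaced n (m + 2) v" "spaced n (Suc m) ?u" using v m spaced_mono[of n "m + 3" v "m + 2"]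
    by (simp_all add: numeral_3_eq_3)
  have Z: "right_module A ?Z" by (rule right_linear_kernel[OF F(1-3)])
  have incl: "right_linear A ?Z F (\<lambda>x. x)" by (simp add: right_linear_def a_kernel_def')
  have "f \<in> carrier ?Z" using cups_closed[OF Z _ v2(1), of m f] f m by simp
  then have hf: "h f = \<zero>\<^bsub>M\<^esub>" by (simp add: a_kernel_def')
  have "f \<in> multiples F ?u" using f by (auto simp: multiples_def a_kernel_def')
  moreover have "f \<in> cups F v m" using cups_hom[OF Z F(1) incl _ v2(1)] f m by auto
  ultimately have g: "f \<in> cups F ?u (m - 1)" using assms(5) m v unfolding separated_def by blast
  show "f \<in> cups ?Z ?u (m - 1)"
  proof (cases m)
    case 0
    then show ?thesis using g by simp
  next
    case (Suc k)
    then show ?thesis using cups_kernel[OF F assms(6), of k ?u f] g hf v2 m by simp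
  qed
qed

lemma free_cups:
  assumes "m < n" "spaced n b v" "1 \<le> b"
  shows "f \<in> carrier (free_module A X) \<Longrightarrow> \<forall>x. f x \<in> cups (right_regular A) v m \<Longrightarrow> f \<in> cups (free_module A X) v m"
  using assms(1)
proof (induction m arbitrary: f)
  case (Suc m)
  let ?w = "W (Suc m # v)" and ?A = "right_regular A"
  have w: "?w \<in> carrier A" using W_Cons_closed Suc.prems assms by simp
  \<comment> \<open>Choosing zero wherever f vanishes keeps the supports of s and c finite.\<close>
  have "\<forall>x. \<exists>s c. s \<in> cups ?A v m \<and> c \<in> carrier A \<and> f x = s \<oplus> c \<otimes> ?w \<and> (f x = \<zero> \<longrightarrow> s = \<zero> \<and> c = \<zero>)"
  proof
    fix x
    have z: "\<zero> \<in> cups ?A v m"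
      using cups_zero[OF right_regular_right_module, of m b v] Suc.prems assms by simp
    show "\<exists>s c. s \<in> cups ?A v m \<and> c \<in> carrier A \<and> f x = s \<oplus> c \<otimes> ?w \<and> (f x = \<zero> \<longrightarrow> s = \<zero> \<and> c = \<zero>)"
    proof (cases "f x = \<zero>")
      case True
      then show ?thesis using z w by (intro exI[of _ \<zero>]) simp
    next
      case False
      have "f x \<in> cups ?A v (Suc m)" using Suc.prems(2) by blast
      then obtain s c where "s \<in> cups ?A v m" "c \<in> carrier A" "f x = s \<oplus> c \<otimes> ?w" by auto
      then show ?thesis using False by blast
    qed
  qed
  then obtain s c where sc: "\<And>x. s x \<in> cups ?A v m" "\<And>x. c x \<in> carrier A" "\<And>x. f x = s x \<oplus> c x \<otimes> ?w"
    "\<And>x. f x = \<zero> \<Longrightarrow> s x = \<zero> \<and> c x = \<zero>" by metis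
  have s': "s x \<in> carrier A" for x
    using cups_closed[OF right_regular_right_module, of m b v "s x"] sc(1) Suc.prems(3) assms(2,3) by simp
  have s: "s \<in> carrier (free_module A X)"
    by (rule free_module_carrierI[of _ _ "{x. f x \<noteq> \<zero>}"]) (use Suc.prems(1) s' sc(4) in \<open>auto simp: free_module_carrier\<close>)
  have c: "c \<in> carrier (free_module A X)"
    by (rule free_module_carrierI[of _ _ "{x. f x \<noteq> \<zero>}"]) (use Suc.prems(1) sc(2,4) in \<open>auto simp: free_module_carrier\<close>)
  have "s \<in> cups (free_module A X) v m" using Suc.IH[OF s] sc(1) Suc.prems(3) by simp
  moreover have "f = s \<oplus>\<^bsub>free_module A X\<^esub> ?w \<odot>\<^bsub>free_module A X\<^esub> c" using sc(3) by auto
  ultimately show ?case using c by auto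
qed (auto simp: fun_eq_iff)

text \<open>Each coordinate is a linear map to the regular module, so the condition is verified
  coefficient by coefficient and reassembled with \<open>free_cups\<close>.\<close>

lemma separated_free:
  assumes "separated (right_regular A)"
  shows "separated (free_module A X)"
  unfolding separated_def
proof (intro allI impI subsetI)
  fix m v f
  let ?u = "Suc m # v" and ?F = "free_module A X" and ?A = "right_regular A"
  assume m: "Suc m < n" and v: "spaced n (m + 3) v" and f: "f \<in> multiples ?F ?u \<inter> cups ?F v m"
  have ev: "right_linear A ?F ?A (\<lambda>f. f x)" for x by (auto simp: right_linear_def free_module_carrier)
  have fc: "f \<in> carrier ?F" by (rule cups_closed[OF free_module_right_module _ v, of m]) (use f m in auto)
  have "f x \<in> cups ?A ?u (m - 1)" for x
  proof -
    have "f x \<in> multiples ?A ?u" using f by (auto simp: multiples_def free_module_carrier)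
    moreover have "f x \<in> cups ?A v m"
      using cups_hom[OF free_module_right_module right_regular_right_module ev _ v] f m by auto
    ultimately show ?thesis using assms m v unfolding separated_def by blast
  qed
  moreover have "spaced n (Suc m) ?u" using v m by (simp add: numeral_3_eq_3)
  ultimately show "f \<in> cups ?F ?u (m - 1)" using free_cups[of "m - 1" "Suc m" ?u f X] fc m by simp
qed

end

section \<open>Tensor products with the trivial module\<close>

lemma right_linear_kernel_subgroup:
  assumes "right_module A M" "right_module A N" "right_linear A M N h"
  shows "subgroup (a_kernel M N h) (add_monoid M)"
proof -
  interpret M: right_module A M by fact
  interpret N: right_module A N by fact
  note h = right_linearD[OF assms(3)]
  show ?thesis
  proof (rule M.add.subgroupI)
    show "a_kernel M N h \<noteq> {}"
      using right_linear_zero[OF assms] M.zero_closed by (auto simp: a_kernel_def')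
  next
    fix x assume "x \<in> a_kernel M N h"
    then show "\<ominus>\<^bsub>M\<^esub> x \<in> a_kernel M N h"
      using right_linear_minus[OF assms, of x] N.M.minus_equality[of "\<zero>\<^bsub>N\<^esub>" "\<zero>\<^bsub>N\<^esub>"] by (simp add: a_kernel_def')
  next
    fix x y assume "x \<in> a_kernel M N h" "y \<in> a_kernel M N h"
    then show "x \<oplus>\<^bsub>M\<^esub> y \<in> a_kernel M N h" using h(2)[of x y] by (simp add: a_kernel_def')
  qed (auto simp: a_kernel_def')
qed

text \<open>By \<open>eps_scalar\<close> a scalar can be moved across the tensor sign in either
  direction; \<open>pure_shift\<close> depends on it.\<close>

locale augmented_algebra = A?: ring A + R: cring R
  for A :: "('r, 'a) module" (structure) and R :: "('r, 'z) ring_scheme" +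
  fixes eps :: "'a \<Rightarrow> 'r"
  assumes eps_closed [simp]: "c \<in> carrier A \<Longrightarrow> eps c \<in> carrier R"
    and eps_add: "c \<in> carrier A \<Longrightarrow> d \<in> carrier A \<Longrightarrow> eps (c \<oplus> d) = eps c \<oplus>\<^bsub>R\<^esub> eps d"
    and eps_mult: "c \<in> carrier A \<Longrightarrow> d \<in> carrier A \<Longrightarrow> eps (c \<otimes> d) = eps c \<otimes>\<^bsub>R\<^esub> eps d"
    and eps_one [simp]: "eps \<one> = \<one>\<^bsub>R\<^esub>"
    and scalar_closed [simp]: "r \<in> carrier R \<Longrightarrow> r \<odot>\<^bsub>A\<^esub> \<one> \<in> carrier A"
    and eps_scalar [simp]: "r \<in> carrier R \<Longrightarrow> eps (r \<odot>\<^bsub>A\<^esub> \<one>) = r"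
begin

abbreviation trivial :: "('a, 'r) module" where
  "trivial \<equiv> ring_as_module R eps"

lemma trivial_simps [simp]:
  "carrier (ring_as_module R \<phi>) = carrier R" "\<zero>\<^bsub>ring_as_module R \<phi>\<^esub> = \<zero>\<^bsub>R\<^esub>"
  "x \<oplus>\<^bsub>ring_as_module R \<phi>\<^esub> y = x \<oplus>\<^bsub>R\<^esub> y" "c \<odot>\<^bsub>ring_as_module R \<phi>\<^esub> x = \<phi> c \<otimes>\<^bsub>R\<^esub> x"
  by (simp_all add: ring_as_module_def)

lemma eps_zero [simp]: "eps \<zero> = \<zero>\<^bsub>R\<^esub>"
  using eps_add[of \<zero> \<zero>] R.add.r_cancel_one[of "eps \<zero>" "eps \<zero>"] by simp

lemma trivial_right_module: "right_module A trivial"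
proof -
  have "abelian_group trivial"
    by (rule abelian_groupI) (auto simp: R.a_ac intro: bexI[of _ "\<ominus>\<^bsub>R\<^esub> _"] R.l_neg)
  then show ?thesis
    by (intro right_module.intro right_module_axioms.intro A.ring_axioms)
      (auto simp: eps_add eps_mult R.l_distr R.r_distr R.m_ac)
qed

lemma scalars_right_module: "right_module R (ring_as_module R id)"
proof -
  have "abelian_group (ring_as_module R id)"
    by (rule abelian_groupI) (auto simp: R.a_ac intro: bexI[of _ "\<ominus>\<^bsub>R\<^esub> _"] R.l_neg)
  then show ?thesis
    by (intro right_module.intro right_module_axioms.intro R.ring_axioms)
      (auto simp: R.l_distr R.r_distr R.m_ac)
qed

context
  fixes M :: "('a, 'm) module"
  assumes M: "right_module A M"
begin

interpretation M: right_module A M by (rule M)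

abbreviation symbols :: "('r, 'm \<times> 'r \<Rightarrow> 'r) module" where
  "symbols \<equiv> free_module R (carrier M \<times> carrier R)"

interpretation S: right_module R symbols by (rule R.free_module_right_module)

abbreviation kern :: "('m \<times> 'r \<Rightarrow> 'r) set" where
  "kern \<equiv> tensor_kernel R A M trivial"

abbreviation pure :: "'m \<Rightarrow> 'r \<Rightarrow> ('m \<times> 'r \<Rightarrow> 'r) set" where
  "pure \<equiv> pure_tensor R A M trivial"

abbreviation sym :: "'m \<Rightarrow> 'r \<Rightarrow> 'm \<times> 'r \<Rightarrow> 'r" where
  "sym x y \<equiv> basis_vector R (x, y)"

lemma tensor_relations_closed: "tensor_relations R A M trivial \<subseteq> carrier symbols"
proof -
  have "sym x y \<in> carrier symbols" if "x \<in> carrier M" "y \<in> carrier R" for x y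
    using that by simp
  then show ?thesis unfolding tensor_relations_def Let_def
    by (auto simp del: free_module_simps intro!: S.M.minus_closed S.M.a_closed S.smult_closed)
qed

lemma kern_submodule: "right_submodule R symbols kern"
proof -
  let ?Hs = "{H. submodule H R symbols \<and> tensor_relations R A M trivial \<subseteq> H}"
  have kern: "kern = \<Inter>?Hs" by (simp add: tensor_kernel_def submodule_span_def)
  have sub: "subgroup H (add_monoid symbols)" "\<And>a x. a \<in> carrier R \<Longrightarrow> x \<in> H \<Longrightarrow> a \<odot>\<^bsub>symbols\<^esub> x \<in> H"
    if "H \<in> ?Hs" for H
    using that by (auto simp del: free_module_simps simp: submodule_def submodule_axioms_def)
  \<comment> \<open>An intersection over an empty family would be everything, so one submodule
    containing the relations is exhibited.\<close>
  have "submodule (carrier symbols) R symbols"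
    unfolding submodule_def submodule_axioms_def using S.M.add.subgroup_self S.smult_closed by blast
  then have ne: "?Hs \<noteq> {}" using tensor_relations_closed by blast
  have "subgroup kern (add_monoid symbols)"
    unfolding kern by (rule S.M.add.subgroups_Inter[OF _ ne]) (use sub in blast)
  then have "abelian_subgroup kern symbols"
    by (intro abelian_subgroupI3 S.M.abelian_group_axioms additive_subgroup.intro)
  moreover have "a \<odot>\<^bsub>symbols\<^esub> x \<in> kern" if "a \<in> carrier R" "x \<in> kern" for a x
    unfolding kern
  proof (rule InterI)
    fix H assume "H \<in> ?Hs"
    then show "a \<odot>\<^bsub>symbols\<^esub> x \<in> H" using sub(2)[of H a x] that kern by blast
  qed
  ultimately show ?thesis
    by (intro right_submodule.intro S.right_module_axioms right_submodule_axioms.intro) blast+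
qed

interpretation K: right_submodule R symbols kern by (rule kern_submodule)

lemma relation_in_kern: "x \<in> tensor_relations R A M trivial \<Longrightarrow> x \<in> kern"
  by (auto simp: tensor_kernel_def submodule_span_def)

lemma tensor_right_module: "right_module R (tensor R A M trivial)"
  using K.quotient_right_module by (simp add: tensor_def)

lemma pure_closed: "x \<in> carrier M \<Longrightarrow> y \<in> carrier R \<Longrightarrow> pure x y \<in> carrier (tensor R A M trivial)"
  by (simp add: tensor_def pure_tensor_def K.quotient_carrier)

lemma coset_eqI:
  assumes "f \<in> carrier symbols" "g \<in> carrier symbols" "f \<ominus>\<^bsub>symbols\<^esub> g \<in> tensor_relations R A M trivial"
  shows "kern +>\<^bsub>symbols\<^esub> f = kern +>\<^bsub>symbols\<^esub> g"
  using K.H.coset_eq_iff[OF assms(1,2)] relation_in_kern[OF assms(3)]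
  by (simp del: free_module_simps add: a_minus_def)

lemma pure_add_left:
  assumes "x \<in> carrier M" "x' \<in> carrier M" "y \<in> carrier R"
  shows "pure (x \<oplus>\<^bsub>M\<^esub> x') y = pure x y \<oplus>\<^bsub>tensor R A M trivial\<^esub> pure x' y"
proof -
  have s: "sym x y \<in> carrier symbols" "sym x' y \<in> carrier symbols" "sym (x \<oplus>\<^bsub>M\<^esub> x') y \<in> carrier symbols"
    using assms by auto
  have "sym (x \<oplus>\<^bsub>M\<^esub> x') y \<ominus>\<^bsub>symbols\<^esub> (sym x y \<oplus>\<^bsub>symbols\<^esub> sym x' y) \<in> tensor_relations R A M trivial"
    unfolding tensor_relations_def Let_def trivial_simps using assms by blast
  then have "kern +>\<^bsub>symbols\<^esub> sym (x \<oplus>\<^bsub>M\<^esub> x') y = kern +>\<^bsub>symbols\<^esub> (sym x y \<oplus>\<^bsub>symbols\<^esub> sym x' y)"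
    by (intro coset_eqI s S.M.a_closed)
  then show ?thesis using K.quotient_add[OF s(1,2)] by (simp add: pure_tensor_def tensor_def)
qed

lemma pure_balanced:
  assumes "x \<in> carrier M" "c \<in> carrier A" "y \<in> carrier R"
  shows "pure (c \<odot>\<^bsub>M\<^esub> x) y = pure x (eps c \<otimes>\<^bsub>R\<^esub> y)"
proof -
  have s: "sym (c \<odot>\<^bsub>M\<^esub> x) y \<in> carrier symbols" "sym x (eps c \<otimes>\<^bsub>R\<^esub> y) \<in> carrier symbols"
    using assms by auto
  have "sym (c \<odot>\<^bsub>M\<^esub> x) y \<ominus>\<^bsub>symbols\<^esub> sym x (eps c \<otimes>\<^bsub>R\<^esub> y) \<in> tensor_relations R A M trivial"
    unfolding tensor_relations_def Let_def trivial_simps using assms by blast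
  then show ?thesis using coset_eqI[OF s] by (simp add: pure_tensor_def)
qed

lemma pure_scalar:
  assumes "r \<in> carrier R" "x \<in> carrier M" "y \<in> carrier R"
  shows "pure ((r \<odot>\<^bsub>A\<^esub> \<one>) \<odot>\<^bsub>M\<^esub> x) y = r \<odot>\<^bsub>tensor R A M trivial\<^esub> pure x y"
proof -
  have s: "sym x y \<in> carrier symbols" "sym ((r \<odot>\<^bsub>A\<^esub> \<one>) \<odot>\<^bsub>M\<^esub> x) y \<in> carrier symbols"
    using assms by auto
  have "sym ((r \<odot>\<^bsub>A\<^esub> \<one>) \<odot>\<^bsub>M\<^esub> x) y \<ominus>\<^bsub>symbols\<^esub> r \<odot>\<^bsub>symbols\<^esub> sym x y \<in> tensor_relations R A M trivial"
    unfolding tensor_relations_def Let_def trivial_simps using assms by blast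
  then have "kern +>\<^bsub>symbols\<^esub> sym ((r \<odot>\<^bsub>A\<^esub> \<one>) \<odot>\<^bsub>M\<^esub> x) y = kern +>\<^bsub>symbols\<^esub> (r \<odot>\<^bsub>symbols\<^esub> sym x y)"
    by (intro coset_eqI s S.smult_closed assms(1))
  then show ?thesis using K.quotient_smult[OF assms(1) s(1)] by (simp add: pure_tensor_def tensor_def)
qed

interpretation T: right_module R "tensor R A M trivial" by (rule tensor_right_module)

lemma pure_zero [simp]:
  assumes "y \<in> carrier R"
  shows "pure \<zero>\<^bsub>M\<^esub> y = \<zero>\<^bsub>tensor R A M trivial\<^esub>"
  using pure_add_left[of "\<zero>\<^bsub>M\<^esub>" "\<zero>\<^bsub>M\<^esub>" y] pure_closed[of "\<zero>\<^bsub>M\<^esub>" y] assms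
  by (simp add: T.M.add.r_cancel_one)

lemma pure_zero_right:
  assumes "x \<in> carrier M"
  shows "pure x \<zero>\<^bsub>R\<^esub> = \<zero>\<^bsub>tensor R A M trivial\<^esub>"
  using pure_balanced[of x \<zero> "\<zero>\<^bsub>R\<^esub>"] assms by simp

lemma pure_minus:
  assumes "x \<in> carrier M" "y \<in> carrier R"
  shows "pure (\<ominus>\<^bsub>M\<^esub> x) y = \<ominus>\<^bsub>tensor R A M trivial\<^esub> pure x y"
  using pure_add_left[of "\<ominus>\<^bsub>M\<^esub> x" x y] assms pure_closed
  by (intro T.M.minus_equality[symmetric]) (simp_all add: M.M.l_neg)

lemma pure_shift:
  assumes "x \<in> carrier M" "y \<in> carrier R"
  shows "pure x y = pure ((y \<odot>\<^bsub>A\<^esub> \<one>) \<odot>\<^bsub>M\<^esub> x) \<one>\<^bsub>R\<^esub>"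
  using pure_balanced[of x "y \<odot>\<^bsub>A\<^esub> \<one>" "\<one>\<^bsub>R\<^esub>"] assms by simp

text \<open>Scalars move into the left factor and sums of symbols x \<otimes> 1 collapse by
  additivity, so every tensor is a single x \<otimes> 1. All later computations are made with such
  representatives.\<close>

lemma tensor_carrier: "carrier (tensor R A M trivial) = (\<lambda>x. pure x \<one>\<^bsub>R\<^esub>) ` carrier M"
proof
  have "kern +>\<^bsub>symbols\<^esub> f \<in> (\<lambda>x. pure x \<one>\<^bsub>R\<^esub>) ` carrier M" if "f \<in> carrier symbols" for f
    using that
  proof (induction f rule: R.free_module_induct)
    case zero
    have "kern +>\<^bsub>symbols\<^esub> (\<lambda>x. \<zero>\<^bsub>R\<^esub>) = pure \<zero>\<^bsub>M\<^esub> \<one>\<^bsub>R\<^esub>"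
      using K.H.coset_eq_self_iff[of "\<zero>\<^bsub>symbols\<^esub>"] S.M.zero_closed K.H.zero_closed K.quotient_zero
      by (simp add: tensor_def)
    then show ?case by blast
  next
    case (add f g)
    then obtain x y where "x \<in> carrier M" "y \<in> carrier M"
      "kern +>\<^bsub>symbols\<^esub> f = pure x \<one>\<^bsub>R\<^esub>" "kern +>\<^bsub>symbols\<^esub> g = pure y \<one>\<^bsub>R\<^esub>" by auto
    moreover have "kern +>\<^bsub>symbols\<^esub> (f \<oplus>\<^bsub>symbols\<^esub> g) = (kern +>\<^bsub>symbols\<^esub> f) \<oplus>\<^bsub>tensor R A M trivial\<^esub> (kern +>\<^bsub>symbols\<^esub> g)"
      using K.quotient_add[OF add(1,2)] by (simp add: tensor_def)
    ultimately have "kern +>\<^bsub>symbols\<^esub> (f \<oplus>\<^bsub>symbols\<^esub> g) = pure (x \<oplus>\<^bsub>M\<^esub> y) \<one>\<^bsub>R\<^esub>"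
      by (simp add: pure_add_left)
    then show ?case using \<open>x \<in> carrier M\<close> \<open>y \<in> carrier M\<close> by auto
  next
    case (basis r p)
    then obtain x y where p: "p = (x, y)" "x \<in> carrier M" "y \<in> carrier R" by auto
    let ?x = "(y \<odot>\<^bsub>A\<^esub> \<one>) \<odot>\<^bsub>M\<^esub> x"
    have "kern +>\<^bsub>symbols\<^esub> (r \<odot>\<^bsub>symbols\<^esub> basis_vector R p) = r \<odot>\<^bsub>tensor R A M trivial\<^esub> pure x y"
      using K.quotient_smult[of r "sym x y"] basis p by (simp add: tensor_def pure_tensor_def)
    also have "\<dots> = pure ((r \<odot>\<^bsub>A\<^esub> \<one>) \<odot>\<^bsub>M\<^esub> ?x) \<one>\<^bsub>R\<^esub>"
      using p basis(1) pure_shift[OF p(2,3)] by (simp add: pure_scalar)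
    finally show ?case using p basis(1) by auto
  qed
  then show "carrier (tensor R A M trivial) \<subseteq> (\<lambda>x. pure x \<one>\<^bsub>R\<^esub>) ` carrier M"
    by (auto simp: tensor_def K.quotient_carrier)
  show "(\<lambda>x. pure x \<one>\<^bsub>R\<^esub>) ` carrier M \<subseteq> carrier (tensor R A M trivial)"
    using pure_closed by auto
qed

text \<open>The universal property, in the form that \<open>the_elem\<close> in
  \<open>tensor_map\<close> calls for. The kernel of the linear extension is a submodule containing
  the relations, so the extension is constant on cosets.\<close>

lemma tensor_lift:
  fixes P :: "('r, 'p) module"
  assumes P: "right_module R P"
    and closed: "\<And>x y. x \<in> carrier M \<Longrightarrow> y \<in> carrier R \<Longrightarrow> \<beta> x y \<in> carrier P"
    and add_left: "\<And>x x' y. x \<in> carrier M \<Longrightarrow> x' \<in> carrier M \<Longrightarrow> y \<in> carrier R \<Longrightarrow>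
      \<beta> (x \<oplus>\<^bsub>M\<^esub> x') y = \<beta> x y \<oplus>\<^bsub>P\<^esub> \<beta> x' y"
    and add_right: "\<And>x y y'. x \<in> carrier M \<Longrightarrow> y \<in> carrier R \<Longrightarrow> y' \<in> carrier R \<Longrightarrow>
      \<beta> x (y \<oplus>\<^bsub>R\<^esub> y') = \<beta> x y \<oplus>\<^bsub>P\<^esub> \<beta> x y'"
    and balanced: "\<And>x c y. x \<in> carrier M \<Longrightarrow> c \<in> carrier A \<Longrightarrow> y \<in> carrier R \<Longrightarrow>
      \<beta> (c \<odot>\<^bsub>M\<^esub> x) y = \<beta> x (eps c \<otimes>\<^bsub>R\<^esub> y)"
    and scalar: "\<And>r x y. r \<in> carrier R \<Longrightarrow> x \<in> carrier M \<Longrightarrow> y \<in> carrier R \<Longrightarrow>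
      \<beta> ((r \<odot>\<^bsub>A\<^esub> \<one>) \<odot>\<^bsub>M\<^esub> x) y = r \<odot>\<^bsub>P\<^esub> \<beta> x y"
    and xy: "x \<in> carrier M" "y \<in> carrier R"
  shows "linear_ext R P (\<lambda>(x, y). \<beta> x y) ` pure x y = {\<beta> x y}"
proof -
  interpret P: right_module R P by (rule P)
  let ?L = "linear_ext R P (\<lambda>(x, y). \<beta> x y)"
  have lin: "right_linear R symbols P ?L"
    by (rule P.linear_ext_right_linear) (use closed in auto)
  have L: "?L (sym x y) = \<beta> x y" if "x \<in> carrier M" "y \<in> carrier R" for x y
    using P.linear_ext_basis_vector[of "\<lambda>(x, y). \<beta> x y" "(x, y)"] that closed by simp
  have S: "sym x y \<in> carrier symbols" if "x \<in> carrier M" "y \<in> carrier R" for x y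
    using that by simp
  note D = right_linearD[OF lin]
  have LD: "?L (f \<ominus>\<^bsub>symbols\<^esub> g) = \<zero>\<^bsub>P\<^esub>" if "f \<in> carrier symbols" "g \<in> carrier symbols" "?L f = ?L g" for f g
    unfolding a_minus_def using D[of f] D[of g] that right_linear_minus[OF S.right_module_axioms P lin, of g]
    by (simp del: free_module_simps add: P.M.r_neg)
  let ?Z = "a_kernel symbols P ?L"
  have "tensor_relations R A M trivial \<subseteq> ?Z"
  proof
    fix f assume f: "f \<in> tensor_relations R A M trivial"
    have "?L f = \<zero>\<^bsub>P\<^esub>"
      using f unfolding tensor_relations_def Let_def trivial_simps
      by (elim UnE CollectE exE conjE; simp del: free_module_simps; intro LD)
        (simp_all del: free_module_simps add: S S.M.a_closed S.smult_closed D L add_left add_right balanced scalar[symmetric])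
    then show "f \<in> ?Z" using f tensor_relations_closed by (auto simp: a_kernel_def')
  qed
  moreover have "submodule ?Z R symbols"
  proof -
    have "subgroup ?Z (add_monoid symbols)"
      by (rule right_linear_kernel_subgroup[OF S.right_module_axioms P lin])
    moreover have "a \<odot>\<^bsub>symbols\<^esub> f \<in> ?Z" if "a \<in> carrier R" "f \<in> ?Z" for a f
      using that D(3)[of f a] S.smult_closed[of a f] by (simp del: free_module_simps add: a_kernel_def')
    ultimately show ?thesis unfolding submodule_def submodule_axioms_def by blast
  qed
  ultimately have "kern \<subseteq> ?Z" by (auto simp: tensor_kernel_def submodule_span_def)
  then have "?L (k \<oplus>\<^bsub>symbols\<^esub> sym x y) = \<beta> x y" if "k \<in> kern" for k
    using that D(2)[of k "sym x y"] S[OF xy] L[OF xy] closed[OF xy] by (auto simp del: free_module_simps simp: a_kernel_def')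
  then have "(\<lambda>k. ?L (k \<oplus>\<^bsub>symbols\<^esub> sym x y)) ` kern = (\<lambda>k. \<beta> x y) ` kern"
    by (intro image_cong refl)
  moreover have "pure x y = (\<lambda>k. k \<oplus>\<^bsub>symbols\<^esub> sym x y) ` kern"
    by (auto simp: pure_tensor_def a_r_coset_def' simp del: free_module_simps)
  moreover have "kern \<noteq> {}" using K.H.zero_closed by blast
  ultimately have "?L ` pure x y = (\<lambda>k. \<beta> x y) ` kern" "kern \<noteq> {}"
    by (simp_all add: image_image del: free_module_simps)
  then show ?thesis by auto
qed

end

lemma tensor_map_pure:
  assumes M: "right_module A M" and M': "right_module A M'" and h: "right_linear A M M' h"
    and xy: "x \<in> carrier M" "y \<in> carrier R"
  shows "tensor_map R A trivial M' h (pure_tensor R A M trivial x y) = pure_tensor R A M' trivial (h x) y"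
proof -
  let ?p = "pure_tensor R A M' trivial" and ?T = "tensor R A M' trivial"
  interpret T: right_module R ?T by (rule tensor_right_module[OF M'])
  interpret M': right_module A M' by (rule M')
  note h' = right_linearD[OF h]
  \<comment> \<open>Additivity on the right follows from additivity on the left, by moving both
    scalars across the tensor sign and back.\<close>
  have add_right: "?p x (y \<oplus>\<^bsub>R\<^esub> y') = ?p x y \<oplus>\<^bsub>?T\<^esub> ?p x y'"
    if x: "x \<in> carrier M'" and y: "y \<in> carrier R" "y' \<in> carrier R" for x y y'
  proof -
    have "?p x (y \<oplus>\<^bsub>R\<^esub> y') = ?p (((y \<odot>\<^bsub>A\<^esub> \<one>) \<oplus> (y' \<odot>\<^bsub>A\<^esub> \<one>)) \<odot>\<^bsub>M'\<^esub> x) \<one>\<^bsub>R\<^esub>"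
      using pure_balanced[OF M' x, of "(y \<odot>\<^bsub>A\<^esub> \<one>) \<oplus> (y' \<odot>\<^bsub>A\<^esub> \<one>)" "\<one>\<^bsub>R\<^esub>"] y by (simp add: eps_add)
    then show ?thesis
      using x y by (simp add: M'.smult_scalar_add pure_add_left[OF M'] pure_shift[OF M' x, symmetric])
  qed
  have "linear_ext R ?T (\<lambda>(x, y). ?p (h x) y) ` pure_tensor R A M trivial x y = {?p (h x) y}"
    by (rule tensor_lift[OF M T.right_module_axioms])
      (use h' xy M' in \<open>simp_all add: pure_closed pure_add_left add_right pure_balanced pure_scalar[symmetric]\<close>)
  then show ?thesis by (simp add: tensor_map_def)
qed

text \<open>Augmenting every coefficient is a balanced map into a free R-module; it recovers the
  coefficients of f modulo the augmentation ideal from f \<otimes> 1.\<close>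

lemma pure_free_eqD:
  assumes "f \<in> carrier (free_module A X)" "g \<in> carrier (free_module A X)"
    and "pure_tensor R A (free_module A X) trivial f \<one>\<^bsub>R\<^esub> = pure_tensor R A (free_module A X) trivial g \<one>\<^bsub>R\<^esub>"
  shows "eps (f x) = eps (g x)"
proof -
  let ?F = "free_module A X"
  have closed: "(\<lambda>x. eps (f x) \<otimes>\<^bsub>R\<^esub> r) \<in> carrier (free_module R X)" if "f \<in> carrier ?F" "r \<in> carrier R" for f r
    by (rule free_module_carrierI[of _ _ "{x. f x \<noteq> \<zero>}"])
      (use that in \<open>auto simp: free_module_carrier\<close>)
  have "linear_ext R (free_module R X) (\<lambda>(f, r). \<lambda>x. eps (f x) \<otimes>\<^bsub>R\<^esub> r) ` pure_tensor R A ?F trivial f \<one>\<^bsub>R\<^esub>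
      = {\<lambda>x. eps (f x) \<otimes>\<^bsub>R\<^esub> \<one>\<^bsub>R\<^esub>}" if "f \<in> carrier ?F" for f
    by (rule tensor_lift[OF A.free_module_right_module R.free_module_right_module])
      (use that closed in \<open>auto simp: free_module_carrier eps_add eps_mult R.l_distr R.r_distr R.m_ac\<close>)
  from this[OF assms(1)] this[OF assms(2)] have "(\<lambda>x. eps (f x) \<otimes>\<^bsub>R\<^esub> \<one>\<^bsub>R\<^esub>) = (\<lambda>x. eps (g x) \<otimes>\<^bsub>R\<^esub> \<one>\<^bsub>R\<^esub>)"
    using assms(3) by simp
  then have "eps (f x) \<otimes>\<^bsub>R\<^esub> \<one>\<^bsub>R\<^esub> = eps (g x) \<otimes>\<^bsub>R\<^esub> \<one>\<^bsub>R\<^esub>" by (rule fun_cong)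
  then show ?thesis using assms(1,2) by (simp add: free_module_carrier)
qed

lemma pure_free_zeroD:
  assumes "f \<in> carrier (free_module A X)"
  shows "pure_tensor R A (free_module A X) trivial f \<one>\<^bsub>R\<^esub> = \<zero>\<^bsub>tensor R A (free_module A X) trivial\<^esub>
    \<Longrightarrow> eps (f x) = \<zero>\<^bsub>R\<^esub>"
  using pure_free_eqD[OF assms, of "\<zero>\<^bsub>free_module A X\<^esub>"] assms
    pure_zero[OF A.free_module_right_module, of "\<one>\<^bsub>R\<^esub>" X]
    abelian_monoid.zero_closed[OF abelian_group.axioms(1)[OF right_module.axioms(2)[OF A.free_module_right_module]], of X]
  by simp

end

section \<open>The canonical resolution and Tor\<close>

text \<open>A function is determined by its graph over the support, and \<open>Abs_fset\<close>
  keeps finite graphs apart.\<close>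

lemma syz_inj_on:
  assumes "Z \<subseteq> carrier (free_module A X)"
  shows "inj_on (syz A) Z"
proof (rule inj_onI)
  fix f g assume fg: "f \<in> Z" "g \<in> Z" "syz A f = syz A g"
  have fin: "finite {x. h x \<noteq> \<zero>\<^bsub>A\<^esub>}" if "h \<in> Z" for h
    using assms that by (auto simp: free_module_carrier)
  have "(\<lambda>x. (x, f x)) ` {x. f x \<noteq> \<zero>\<^bsub>A\<^esub>} = (\<lambda>x. (x, g x)) ` {x. g x \<noteq> \<zero>\<^bsub>A\<^esub>}"
    using fg(3) fin[OF fg(1)] fin[OF fg(2)] by (auto simp: syz_def Abs_fset_inject)
  then have "(x, y) \<in> (\<lambda>x. (x, f x)) ` {x. f x \<noteq> \<zero>\<^bsub>A\<^esub>} \<longleftrightarrow> (x, y) \<in> (\<lambda>x. (x, g x)) ` {x. g x \<noteq> \<zero>\<^bsub>A\<^esub>}"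
    for x y by simp
  then have "f x \<noteq> \<zero>\<^bsub>A\<^esub> \<and> y = f x \<longleftrightarrow> g x \<noteq> \<zero>\<^bsub>A\<^esub> \<and> y = g x" for x y by (auto simp: image_iff)
  then show "f = g" by (metis ext)
qed

text \<open>The basis enters \<open>free_module\<close> only through the carrier, so every syzygy
  module can be viewed inside the free module on all names.\<close>

abbreviation free_sub :: "('a, 'z) ring_scheme \<Rightarrow> ('x \<Rightarrow> 'a) set \<Rightarrow> ('a, 'x \<Rightarrow> 'a) module" where
  "free_sub A Z \<equiv> (free_module A UNIV)\<lparr>carrier := Z\<rparr>"

lemma free_sub_eq: "(free_module A X)\<lparr>carrier := Z\<rparr> = free_sub A Z"
  by (simp add: free_module_def)

text \<open>The differential is regarded as a map onto the cycles below instead of into the free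
  module, because \<open>cups_kernel\<close> and \<open>separated_kernel\<close> require a
  surjection onto a separated module.\<close>

lemma (in ring) syz_map:
  fixes Z :: "(('a, 'm) gen \<Rightarrow> 'a) set"
  assumes Z: "right_module R (free_sub R Z)" "Z \<subseteq> carrier (free_module R UNIV)"
  defines "d \<equiv> linear_ext R (free_module R UNIV) (inv_into Z (syz R))"
    and "X \<equiv> syz R ` Z"
  shows "right_linear R (free_module R X) (free_sub R Z) d"
    and "\<And>z. z \<in> Z \<Longrightarrow> d (basis_vector R (syz R z)) = z"
    and "d ` carrier (free_module R X) = carrier (free_sub R Z)"
proof -
  let ?U = "free_module R UNIV :: ('a, ('a, 'm) gen \<Rightarrow> 'a) module"
  interpret U: right_module R ?U by (rule free_module_right_module)
  interpret Z: right_module R "free_sub R Z" by (rule Z(1))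
  have inv: "inv_into Z (syz R) (syz R z) = z" if "z \<in> Z" for z
    by (rule inv_into_f_f[OF syz_inj_on[OF Z(2)] that])
  have lin: "right_linear R (free_module R X) ?U d"
    unfolding d_def X_def by (rule U.linear_ext_right_linear) (use inv Z(2) in auto)
  note D = right_linearD[OF lin]
  show basis: "d (basis_vector R (syz R z)) = z" if "z \<in> Z" for z
    unfolding d_def using U.linear_ext_basis_vector[of "inv_into Z (syz R)" "syz R z"] that Z(2) inv[OF that] by auto
  have mem: "d f \<in> Z" if "f \<in> carrier (free_module R X)" for f
    using that
  proof (induction f rule: free_module_induct)
    case zero
    have "d (\<lambda>x. \<zero>) = (\<lambda>x. \<zero>)"
      using right_linear_zero[OF free_module_right_module U.right_module_axioms lin] by simp
    then show ?case using Z.M.zero_closed by simp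
  next
    case (add f g)
    then show ?case using D(2)[of f g] Z.M.a_closed[of "d f" "d g"] by simp
  next
    case (basis a x)
    then obtain z where z: "z \<in> Z" "x = syz R z" by (auto simp: X_def)
    have "basis_vector R x \<in> carrier (free_module R X)" using basis(2) by simp
    from D(3)[OF this basis(1)] have "d (a \<odot>\<^bsub>free_module R X\<^esub> basis_vector R x) = a \<odot>\<^bsub>free_sub R Z\<^esub> z"
      using \<open>\<And>z. z \<in> Z \<Longrightarrow> d (basis_vector R (syz R z)) = z\<close>[OF z(1)] z(2) by simp
    then show ?case using Z.smult_closed[of a z] basis(1) z(1) by simp
  qed
  show "right_linear R (free_module R X) (free_sub R Z) d"
    using mem D by (simp add: right_linear_def del: free_module_simps)
  show "d ` carrier (free_module R X) = carrier (free_sub R Z)"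
  proof
    show "carrier (free_sub R Z) \<subseteq> d ` carrier (free_module R X)"
    proof
      fix z assume "z \<in> carrier (free_sub R Z)"
      then have z: "z \<in> Z" by simp
      have "basis_vector R (syz R z) \<in> carrier (free_module R X)" using z by (simp add: X_def)
      then show "z \<in> d ` carrier (free_module R X)" using basis[OF z] by (metis imageI)
    qed
  qed (use mem in auto)
qed

text \<open>These three facts are the only further input about the Temperley--Lieb algebra. The last
  two identify the augmentation ideal with A U_1 + ... + A U_(n-1).\<close>

locale tl_algebra = word_algebra A n W + augmented_algebra A R eps
  for A :: "('r, 'a) module" (structure) and n W and R :: "('r, 'z) ring_scheme" and eps +
  assumes separated_regular: "separated (right_regular A)"
    and eps_W: "1 \<le> i \<Longrightarrow> i < n \<Longrightarrow> eps (W [i]) = \<zero>\<^bsub>R\<^esub>"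
    and eps_kernel: "c \<in> carrier A \<Longrightarrow> eps c = \<zero>\<^bsub>R\<^esub> \<Longrightarrow> c \<in> cups (right_regular A) [] (n - 1)"
begin

lemma n_pos: "n - 1 < n" using odd_n by (cases n) auto

lemma separated_trivial: "separated trivial"
  unfolding separated_def
proof (intro allI impI subsetI)
  fix m v x
  assume m: "Suc m < n" and v: "spaced n (m + 3) v" and x: "x \<in> multiples trivial (Suc m # v) \<inter> cups trivial v m"
  have v': "set v \<subseteq> {1..<n}" "spaced n 1 (Suc m # v)"
    using spaced_set[OF v] m v by (auto simp: numeral_3_eq_3)
  have "eps (W ([Suc m] @ v)) = \<zero>\<^bsub>R\<^esub>"
    using m v' eps_W[of "Suc m"] W_closed[of "[Suc m]"] W_closed[OF v'(1)] by (subst W_append) (simp_all add: eps_mult)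
  then have "x = \<zero>\<^bsub>trivial\<^esub>" using x by (auto simp: multiples_def)
  then show "x \<in> cups trivial (Suc m # v) (m - 1)"
    using cups_zero[OF trivial_right_module, of "m - 1" 1 "Suc m # v"] v' m by simp
qed

abbreviation cycles :: "nat \<Rightarrow> (('a, 'r) gen \<Rightarrow> 'a) set" where
  "cycles \<equiv> res_cycles A trivial"

abbreviation F :: "nat \<Rightarrow> ('a, ('a, 'r) gen \<Rightarrow> 'a) module" where
  "F \<equiv> res_module A trivial"

abbreviation proj :: "(('a, 'r) gen \<Rightarrow> 'a) \<Rightarrow> 'r" where
  "proj \<equiv> linear_ext A trivial (inv_into (carrier trivial) Elem)"

lemma F_free: obtains X where "F k = free_module A X"
  by (auto simp: res_module_def)

lemma F_right_module: "right_module A (F k)"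
  unfolding res_module_def by (rule free_module_right_module)

lemma proj_linear: "right_linear A (F 0) trivial proj" "proj ` carrier (F 0) = carrier trivial"
proof -
  let ?E = "Elem :: 'r \<Rightarrow> ('a, 'r) gen"
  interpret N: right_module A trivial by (rule trivial_right_module)
  have inv: "inv_into (carrier trivial) ?E (?E x) = x" if "x \<in> carrier trivial" for x
    by (rule inv_into_f_f) (use that in \<open>auto simp: inj_on_def\<close>)
  show lin: "right_linear A (F 0) trivial proj"
    unfolding res_module_def nat.case by (rule N.linear_ext_right_linear) (use inv in auto)
  have "x \<in> proj ` carrier (F 0)" if x: "x \<in> carrier trivial" for x
  proof -
    have "proj (basis_vector A (?E x)) = x"
      using N.linear_ext_basis_vector[of "inv_into (carrier trivial) ?E" "?E x"] inv[OF x] x by simp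
    moreover have "basis_vector A (?E x) \<in> carrier (F 0)" using x by (simp add: res_module_def)
    ultimately show ?thesis by (metis imageI)
  qed
  then show "proj ` carrier (F 0) = carrier trivial"
    using right_linearD(1)[OF lin] by blast
qed

text \<open>Everything goes through one induction since Z_k must be known to be a separated module
  before it can serve as the target of the next differential. The last conjunct is the essential
  inclusion of Z_k \<inter> F_k I = Z_k I, obtained from \<open>cups_kernel\<close> with empty v and
  m = n - 1.\<close>

lemma cycles_chain:
  "right_module A (free_sub A (cycles k)) \<and> separated (free_sub A (cycles k)) \<and> cycles k \<subseteq> carrier (F k)
    \<and> cycles k \<subseteq> carrier (free_module A UNIV)
    \<and> (\<forall>f\<in>cycles k. f \<in> cups (F k) [] (n - 1) \<longrightarrow> f \<in> cups (free_sub A (cycles k)) [] (n - 1))"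
proof (induction k)
  case 0
  have c: "cycles 0 = a_kernel (F 0) trivial proj" by (simp add: res_module_def)
  have e: "free_sub A (cycles 0) = (F 0)\<lparr>carrier := a_kernel (F 0) trivial proj\<rparr>"
    unfolding c res_module_def by (rule free_sub_eq[symmetric])
  have "separated (F 0)" unfolding res_module_def by (rule separated_free[OF separated_regular])
  note facts = F_right_module trivial_right_module proj_linear
  have sub: "cycles 0 \<subseteq> carrier (F 0)" unfolding c by (auto simp: a_kernel_def')
  have "f \<in> cups (free_sub A (cycles 0)) [] (n - 1)" if "f \<in> cycles 0" "f \<in> cups (F 0) [] (n - 1)" for f
    unfolding e by (rule cups_kernel[OF facts separated_trivial n_pos _ that(2)]) (use that(1) in \<open>simp_all only: c a_kernel_def' spaced.simps mem_Collect_eq\<close>)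
  moreover have "separated (free_sub A (cycles 0))"
    unfolding e by (rule separated_kernel[OF facts \<open>separated (F 0)\<close> separated_trivial])
  moreover have "right_module A (free_sub A (cycles 0))"
    unfolding e by (rule right_linear_kernel[OF facts(1-3)])
  moreover have "cycles 0 \<subseteq> carrier (free_module A UNIV)"
    by (rule order_trans[OF sub]) (unfold res_module_def, rule free_module_mono, rule subset_UNIV)
  ultimately show ?case using sub by blast
next
  case (Suc k)
  let ?d = "res_diff A trivial k" and ?Z = "free_sub A (cycles k)"
  have IH: "right_module A ?Z" "separated ?Z" "cycles k \<subseteq> carrier (free_module A UNIV)" using Suc by auto
  have F: "F (Suc k) = free_module A (syz A ` cycles k)" by (simp add: res_module_def)
  have lin: "right_linear A (F (Suc k)) ?Z ?d" "?d ` carrier (F (Suc k)) = carrier ?Z"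
    using syz_map[OF IH(1,3)] unfolding F res_diff_def by blast+
  have c: "cycles (Suc k) = a_kernel (F (Suc k)) ?Z ?d"
    by (simp add: F res_diff_def a_kernel_def')
  have e: "free_sub A (cycles (Suc k)) = (F (Suc k))\<lparr>carrier := a_kernel (F (Suc k)) ?Z ?d\<rparr>"
    unfolding c res_module_def by (rule free_sub_eq[symmetric])
  have sep: "separated (F (Suc k))" unfolding res_module_def by (rule separated_free[OF separated_regular])
  note facts = F_right_module IH(1) lin
  have sub: "cycles (Suc k) \<subseteq> carrier (F (Suc k))" unfolding c by (auto simp: a_kernel_def')
  have "f \<in> cups (free_sub A (cycles (Suc k))) [] (n - 1)"
    if "f \<in> cycles (Suc k)" "f \<in> cups (F (Suc k)) [] (n - 1)" for f
    unfolding e by (rule cups_kernel[OF facts IH(2) n_pos _ that(2)]) (use that(1) in \<open>simp_all only: c a_kernel_def' spaced.simps mem_Collect_eq\<close>)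
  moreover have "separated (free_sub A (cycles (Suc k)))"
    unfolding e by (rule separated_kernel[OF facts sep IH(2)])
  moreover have "right_module A (free_sub A (cycles (Suc k)))"
    unfolding e by (rule right_linear_kernel[OF facts(1-3)])
  moreover have "cycles (Suc k) \<subseteq> carrier (free_module A UNIV)"
    by (rule order_trans[OF sub]) (unfold res_module_def, rule free_module_mono, rule subset_UNIV)
  ultimately show ?case using sub by blast
qed

section \<open>The complex computing Tor\<close>

abbreviation pt :: "nat \<Rightarrow> (('a, 'r) gen \<Rightarrow> 'a) \<Rightarrow> ((('a, 'r) gen \<Rightarrow> 'a) \<times> 'r \<Rightarrow> 'r) set" where
  "pt k f \<equiv> pure_tensor R A (F k) trivial f \<one>\<^bsub>R\<^esub>"

abbreviation C :: "nat \<Rightarrow> ('r, ((('a, 'r) gen \<Rightarrow> 'a) \<times> 'r \<Rightarrow> 'r) set) module" where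
  "C \<equiv> tor_chains R A trivial trivial"

abbreviation bd :: "nat \<Rightarrow> (('a, 'r) gen \<Rightarrow> 'a) \<Rightarrow> ('a, 'r) gen \<Rightarrow> 'a" where
  "bd \<equiv> res_diff A trivial"

lemma C_right_module: "right_module R (C k)"
  unfolding tor_chains_def by (rule tensor_right_module[OF F_right_module])

lemma C_carrier: "carrier (C k) = pt k ` carrier (F k)"
  unfolding tor_chains_def by (rule tensor_carrier[OF F_right_module])

lemma pt_add: "f \<in> carrier (F k) \<Longrightarrow> g \<in> carrier (F k) \<Longrightarrow> pt k (f \<oplus>\<^bsub>F k\<^esub> g) = pt k f \<oplus>\<^bsub>C k\<^esub> pt k g"
  unfolding tor_chains_def by (rule pure_add_left[OF F_right_module]) simp_all

lemma pt_minus: "f \<in> carrier (F k) \<Longrightarrow> pt k (\<ominus>\<^bsub>F k\<^esub> f) = \<ominus>\<^bsub>C k\<^esub> pt k f"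
  unfolding tor_chains_def by (rule pure_minus[OF F_right_module]) simp_all

lemma pt_zero: "pt k \<zero>\<^bsub>F k\<^esub> = \<zero>\<^bsub>C k\<^esub>"
  unfolding tor_chains_def by (rule pure_zero[OF F_right_module]) simp

lemma pt_scalar: "r \<in> carrier R \<Longrightarrow> f \<in> carrier (F k) \<Longrightarrow> pt k ((r \<odot>\<^bsub>A\<^esub> \<one>) \<odot>\<^bsub>F k\<^esub> f) = r \<odot>\<^bsub>C k\<^esub> pt k f"
  unfolding tor_chains_def by (rule pure_scalar[OF F_right_module]) simp_all

text \<open>The symbol x U_i \<otimes> 1 equals x \<otimes> eps(U_i) = 0. Together with
  \<open>pt_zero_cups\<close>, f \<otimes> 1 vanishes exactly when f lies in F_k I.\<close>

lemma pt_cups: "m < n \<Longrightarrow> f \<in> cups (F k) [] m \<Longrightarrow> pt k f = \<zero>\<^bsub>C k\<^esub>"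
proof (induction m arbitrary: f)
  case 0
  then show ?case by (simp add: pt_zero)
next
  case (Suc m)
  interpret F: right_module A "F k" by (rule F_right_module)
  interpret C: right_module R "C k" by (rule C_right_module)
  obtain s x where s: "s \<in> cups (F k) [] m" "x \<in> carrier (F k)" "f = s \<oplus>\<^bsub>F k\<^esub> W [Suc m] \<odot>\<^bsub>F k\<^esub> x"
    using Suc.prems by auto
  have w: "W [Suc m] \<in> carrier A" using Suc.prems W_closed by simp
  have "s \<in> carrier (F k)" using cups_closed[OF F_right_module, of m 1 "[]" s] s Suc.prems by simp
  moreover have "pt k (W [Suc m] \<odot>\<^bsub>F k\<^esub> x) = \<zero>\<^bsub>C k\<^esub>"
    using pure_balanced[OF F_right_module s(2) w R.one_closed] pure_zero_right[OF F_right_module s(2)]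
      eps_W[of "Suc m"] Suc.prems by (simp add: tor_chains_def)
  moreover have "pt k s = \<zero>\<^bsub>C k\<^esub>" using Suc s by simp
  ultimately show ?case using s w by (simp add: pt_add)
qed

lemma pt_zero_cups:
  assumes "f \<in> carrier (F k)" "pt k f = \<zero>\<^bsub>C k\<^esub>"
  shows "f \<in> cups (F k) [] (n - 1)"
proof -
  obtain X where X: "F k = free_module A X" by (rule F_free)
  have "eps (f x) = \<zero>\<^bsub>R\<^esub>" for x
    using pure_free_zeroD[of f X x] assms unfolding tor_chains_def X by blast
  then have "f x \<in> cups (right_regular A) [] (n - 1)" for x
    using assms(1) unfolding X by (intro eps_kernel) (auto simp: free_module_carrier)
  then show ?thesis using free_cups[of "n - 1" 1 "[]" f X] n_pos assms(1) unfolding X by simp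
qed

lemma bd_linear:
  "right_linear A (F (Suc k)) (free_sub A (cycles k)) (bd k)"
  "bd k ` carrier (F (Suc k)) = cycles k"
  "right_linear A (F (Suc k)) (F k) (bd k)"
proof -
  have F: "F (Suc k) = free_module A (syz A ` cycles k)" by (simp add: res_module_def)
  have Z: "right_module A (free_sub A (cycles k))" "cycles k \<subseteq> carrier (free_module A UNIV)"
    "cycles k \<subseteq> carrier (F k)"
    using cycles_chain[of k] by blast+
  show 1: "right_linear A (F (Suc k)) (free_sub A (cycles k)) (bd k)"
    unfolding F res_diff_def by (rule syz_map(1)[OF Z(1,2)])
  show "bd k ` carrier (F (Suc k)) = cycles k"
    using syz_map(3)[OF Z(1,2)] unfolding F res_diff_def by simp
  obtain X where X: "F k = free_module A X" by (rule F_free)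
  have "right_linear A (free_sub A (cycles k)) (F k) (\<lambda>x. x)"
    using Z(3) unfolding X by (auto simp: right_linear_def)
  from right_linear_comp[OF 1 this] show "right_linear A (F (Suc k)) (F k) (bd k)" .
qed

lemma cycles_Suc: "f \<in> cycles (Suc k) \<longleftrightarrow> f \<in> carrier (F (Suc k)) \<and> bd k f = \<zero>\<^bsub>F k\<^esub>"
  by (simp add: res_module_def res_diff_def a_kernel_def')

lemma tor_diff_pt: "f \<in> carrier (F (Suc k)) \<Longrightarrow> tor_diff R A trivial trivial k (pt (Suc k) f) = pt k (bd k f)"
  unfolding tor_diff_def by (rule tensor_map_pure[OF F_right_module F_right_module bd_linear(3)]) simp_all

abbreviation boundaries :: "nat \<Rightarrow> ((('a, 'r) gen \<Rightarrow> 'a) \<times> 'r \<Rightarrow> 'r) set set" where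
  "boundaries k \<equiv> tor_diff R A trivial trivial k ` carrier (C (Suc k))"

text \<open>Every chain is some f \<otimes> 1, and \<open>bd k\<close> maps onto the cycles of the
  resolution.\<close>

lemma boundaries_eq: "boundaries k = pt k ` cycles k"
proof -
  have "boundaries k = (\<lambda>f. pt k (bd k f)) ` carrier (F (Suc k))"
    unfolding C_carrier image_image by (rule image_cong) (simp_all add: tor_diff_pt)
  then show ?thesis by (simp add: bd_linear(2)[symmetric] image_image)
qed

lemma boundaries_submodule: "right_submodule R (C k) (boundaries k)"
proof -
  interpret C: right_module R "C k" by (rule C_right_module)
  interpret F: right_module A "F k" by (rule F_right_module)
  interpret Z: right_module A "free_sub A (cycles k)" using cycles_chain by blast
  have sub: "cycles k \<subseteq> carrier (F k)" using cycles_chain by blast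
  obtain X where X: "F k = free_module A X" by (rule F_free)
  have ops: "\<zero>\<^bsub>F k\<^esub> \<in> cycles k" "\<And>f g. f \<in> cycles k \<Longrightarrow> g \<in> cycles k \<Longrightarrow> f \<oplus>\<^bsub>F k\<^esub> g \<in> cycles k"
    "\<And>a f. a \<in> carrier A \<Longrightarrow> f \<in> cycles k \<Longrightarrow> a \<odot>\<^bsub>F k\<^esub> f \<in> cycles k"
    using Z.M.zero_closed Z.M.a_closed Z.smult_closed unfolding X by simp_all
  have minus: "\<ominus>\<^bsub>F k\<^esub> f \<in> cycles k" if "f \<in> cycles k" for f
    using ops(3)[of "\<ominus> \<one>" f] F.uminus_smult[of f] that sub by auto
  have "subgroup (boundaries k) (add_monoid (C k))"
    unfolding boundaries_eq
  proof (rule C.M.add.subgroupI)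
    show "pt k ` cycles k \<subseteq> carrier (C k)" using sub by (auto simp: C_carrier)
    show "pt k ` cycles k \<noteq> {}" using ops(1) by blast
  next
    fix x assume "x \<in> pt k ` cycles k"
    then obtain f where f: "f \<in> cycles k" "x = pt k f" by blast
    then have "\<ominus>\<^bsub>C k\<^esub> x = pt k (\<ominus>\<^bsub>F k\<^esub> f)" using pt_minus[of f k] subsetD[OF sub] by simp
    then show "\<ominus>\<^bsub>C k\<^esub> x \<in> pt k ` cycles k" using minus[OF f(1)] by blast
  next
    fix x y assume "x \<in> pt k ` cycles k" "y \<in> pt k ` cycles k"
    then obtain f g where f: "f \<in> cycles k" "x = pt k f" and g: "g \<in> cycles k" "y = pt k g" by blast
    then have "x \<oplus>\<^bsub>C k\<^esub> y = pt k (f \<oplus>\<^bsub>F k\<^esub> g)" using pt_add[of f k g] subsetD[OF sub] by simp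
    then show "x \<oplus>\<^bsub>C k\<^esub> y \<in> pt k ` cycles k" using ops(2)[OF f(1) g(1)] by blast
  qed
  moreover have "r \<odot>\<^bsub>C k\<^esub> x \<in> boundaries k" if "r \<in> carrier R" "x \<in> boundaries k" for r x
  proof -
    obtain f where f: "f \<in> cycles k" "x = pt k f" using \<open>x \<in> boundaries k\<close> unfolding boundaries_eq by blast
    then have "r \<odot>\<^bsub>C k\<^esub> x = pt k ((r \<odot>\<^bsub>A\<^esub> \<one>) \<odot>\<^bsub>F k\<^esub> f)"
      using pt_scalar[of r f k] subsetD[OF sub] that(1) by simp
    then show ?thesis
      using ops(3)[OF scalar_closed[OF that(1)] f(1)] unfolding boundaries_eq by blast
  qed
  ultimately show ?thesis
    by (intro right_submodule.intro C.right_module_axioms right_submodule_axioms.intro abelian_subgroupI3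
        additive_subgroup.intro C.M.abelian_group_axioms)
qed

text \<open>If \<open>f \<otimes> 1\<close> is a cycle, then \<open>bd k f\<close> lies in \<open>Z\<^sub>k \<inter> F\<^sub>k I = Z\<^sub>k I\<close>, so \<open>f\<close> can be
  corrected by an element of \<open>F\<^sub>k\<^sub>+\<^sub>1 I\<close> to a cycle of the resolution.\<close>

lemma tor_cycles_subset: "tor_cycles R A trivial trivial (Suc k) \<subseteq> boundaries (Suc k)"
proof
  fix c assume "c \<in> tor_cycles R A trivial trivial (Suc k)"
  then have c: "c \<in> carrier (C (Suc k))" "tor_diff R A trivial trivial k c = \<zero>\<^bsub>C k\<^esub>"
    by (simp_all add: tor_cycles_def a_kernel_def')
  interpret F: right_module A "F (Suc k)" by (rule F_right_module)
  interpret Fk: right_module A "F k" by (rule F_right_module)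
  interpret C: right_module R "C (Suc k)" by (rule C_right_module)
  obtain f where f: "f \<in> carrier (F (Suc k))" "c = pt (Suc k) f" using c unfolding C_carrier by blast
  note d = right_linearD[OF bd_linear(3)[of k]]
  have Z: "right_module A (free_sub A (cycles k))" using cycles_chain by blast
  have "pt k (bd k f) = \<zero>\<^bsub>C k\<^esub>" using c f by (simp add: tor_diff_pt)
  then have "bd k f \<in> cups (F k) [] (n - 1)" using d(1)[OF f(1)] by (intro pt_zero_cups)
  moreover have "bd k f \<in> cycles k" using f(1) bd_linear(2) by blast
  ultimately have "bd k f \<in> cups (free_sub A (cycles k)) [] (n - 1)" using cycles_chain by blast
  moreover have "bd k ` carrier (F (Suc k)) = carrier (free_sub A (cycles k))" using bd_linear(2) by simp
  ultimately obtain g where g: "g \<in> cups (F (Suc k)) [] (n - 1)" "bd k g = bd k f"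
    using cups_hom_surj[OF F_right_module Z bd_linear(1) _ n_pos, of 1 "[]"] by auto
  have gc: "g \<in> carrier (F (Suc k))" using cups_closed[OF F_right_module n_pos, of 1 "[]"] g(1) by simp
  let ?z = "f \<oplus>\<^bsub>F (Suc k)\<^esub> \<ominus>\<^bsub>F (Suc k)\<^esub> g"
  have "bd k ?z = \<zero>\<^bsub>F k\<^esub>"
    using d(2)[OF f(1), of "\<ominus>\<^bsub>F (Suc k)\<^esub> g"] gc g(2) d(1)[OF f(1)]
      right_linear_minus[OF F_right_module F_right_module bd_linear(3) gc] by (simp add: Fk.M.r_neg)
  then have z: "?z \<in> cycles (Suc k)" unfolding cycles_Suc using f(1) gc by simp
  have "pt (Suc k) ?z = c"
    using pt_add[OF f(1), of "\<ominus>\<^bsub>F (Suc k)\<^esub> g"] pt_minus[OF gc] pt_cups[OF n_pos g(1)] gc f c(1)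
      C.M.minus_equality[of "\<zero>\<^bsub>C (Suc k)\<^esub>" "\<zero>\<^bsub>C (Suc k)\<^esub>"] by simp
  then show "c \<in> boundaries (Suc k)" using z unfolding boundaries_eq by blast
qed

lemma boundaries_cycles: "boundaries (Suc k) \<subseteq> tor_cycles R A trivial trivial (Suc k)"
proof
  fix c assume "c \<in> boundaries (Suc k)"
  then obtain f where f: "f \<in> cycles (Suc k)" "c = pt (Suc k) f" unfolding boundaries_eq by blast
  then show "c \<in> tor_cycles R A trivial trivial (Suc k)"
    unfolding cycles_Suc by (simp add: tor_cycles_def a_kernel_def' C_carrier tor_diff_pt pt_zero)
qed

lemma tor_positive:
  "carrier (Tor R A trivial trivial (Suc k)) = {\<zero>\<^bsub>Tor R A trivial trivial (Suc k)\<^esub>}"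
proof -
  interpret B: right_submodule R "C (Suc k)" "boundaries (Suc k)" by (rule boundaries_submodule)
  have "tor_cycles R A trivial trivial (Suc k) = boundaries (Suc k)"
    using tor_cycles_subset boundaries_cycles by blast
  \<comment> \<open>The cosets are formed in the chain module with its carrier cut down to the
    cycles; translating S by one of its own elements gives S again.\<close>
  moreover have "(\<Union>b\<in>S. {S +>\<^bsub>(C (Suc k))\<lparr>carrier := S\<rparr>\<^esub> b}) = {S}" if "S = boundaries (Suc k)" for S
  proof -
    have "S +>\<^bsub>(C (Suc k))\<lparr>carrier := S\<rparr>\<^esub> b = S" if "b \<in> S" for b
      using B.H.a_rcos_const[of b] that unfolding \<open>S = _\<close> a_r_coset_def' by simp
    moreover have "S \<noteq> {}" using B.H.zero_closed unfolding \<open>S = _\<close> by blast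
    ultimately show ?thesis by auto
  qed
  moreover have "carrier ((C (Suc k))\<lparr>carrier := S\<rparr>) = S" for S by simp
  ultimately show ?thesis
    by (simp only: Tor_def quotient_def FactRing_def A_RCOSETS_def' module.simps ring.simps partial_object.simps)
qed

text \<open>Modulo boundaries, f \<otimes> 1 depends only on f modulo Z_0, and Z_0 is the kernel of
  the projection from F_0 onto R; so the projection descends to the isomorphism.\<close>

lemma tor_zero: "module_iso R (Tor R A trivial trivial 0) (ring_as_module R id) \<noteq> {}"
proof -
  interpret B: right_submodule R "C 0" "boundaries 0" by (rule boundaries_submodule)
  interpret F: right_module A "F 0" by (rule F_right_module)
  interpret C: right_module R "C 0" by (rule C_right_module)
  let ?B = "boundaries 0" and ?T = "quotient (C 0) (boundaries 0)" and ?P = "ring_as_module R id"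
  have T: "Tor R A trivial trivial 0 = ?T" by (simp add: Tor_def tor_cycles_def)
  have c0: "cycles 0 = {f \<in> carrier (F 0). proj f = \<zero>\<^bsub>R\<^esub>}" by (simp add: res_module_def a_kernel_def')
  note p = right_linearD[OF proj_linear(1)]
  define cl where "cl f = ?B +>\<^bsub>C 0\<^esub> pt 0 f" for f
  have T_carrier: "carrier ?T = cl ` carrier (F 0)"
    unfolding B.quotient_carrier cl_def C_carrier[of 0] by (simp only: image_image)
  have pt_mem: "pt 0 f \<in> carrier (C 0)" if "f \<in> carrier (F 0)" for f using that by (auto simp: C_carrier)
  have cl_add: "cl f \<oplus>\<^bsub>?T\<^esub> cl g = cl (f \<oplus>\<^bsub>F 0\<^esub> g)" if "f \<in> carrier (F 0)" "g \<in> carrier (F 0)" for f g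
    using that by (simp add: cl_def B.quotient_add pt_add pt_mem)
  have cl_smult: "r \<odot>\<^bsub>?T\<^esub> cl f = cl ((r \<odot>\<^bsub>A\<^esub> \<one>) \<odot>\<^bsub>F 0\<^esub> f)" if "r \<in> carrier R" "f \<in> carrier (F 0)" for r f
    using that by (simp add: cl_def B.quotient_smult pt_scalar pt_mem)
  let ?L = "linear_ext R ?P (\<lambda>(f, r). proj f \<otimes>\<^bsub>R\<^esub> r)"
  have L: "?L ` pt 0 f = {proj f}" if f: "f \<in> carrier (F 0)" for f
  proof -
    have "?L ` pt 0 f = {proj f \<otimes>\<^bsub>R\<^esub> \<one>\<^bsub>R\<^esub>}"
      by (rule tensor_lift[OF F_right_module scalars_right_module])
        (use f p in \<open>simp_all add: R.l_distr R.r_distr R.m_ac\<close>)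
    then show ?thesis using p(1)[OF f] by simp
  qed
  have cl_eq: "cl f = (\<Union>z\<in>cycles 0. {pt 0 (z \<oplus>\<^bsub>F 0\<^esub> f)})" if f: "f \<in> carrier (F 0)" for f
  proof -
    have "pt 0 z \<oplus>\<^bsub>C 0\<^esub> pt 0 f = pt 0 (z \<oplus>\<^bsub>F 0\<^esub> f)" if "z \<in> cycles 0" for z
      using pt_add[of z 0 f] that f c0 by auto
    then show ?thesis unfolding cl_def a_r_coset_def' boundaries_eq by auto
  qed
  \<comment> \<open>A class D is a set of chains, and a chain is itself a coset. The map
    \<open>?L\<close> has one value on each chain in D, and the same one for all of them.\<close>
  define h where "h D = the_elem (\<Union>c\<in>D. ?L ` c)" for D
  have zero0: "\<zero>\<^bsub>F 0\<^esub> \<in> cycles 0"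
    using right_linear_zero[OF F_right_module trivial_right_module proj_linear(1)] c0 by simp
  have h: "h (cl f) = proj f" if f: "f \<in> carrier (F 0)" for f
  proof -
    have "?L ` pt 0 (z \<oplus>\<^bsub>F 0\<^esub> f) = {proj f}" if "z \<in> cycles 0" for z
      using L[of "z \<oplus>\<^bsub>F 0\<^esub> f"] p(2)[of z f] p(1)[OF f] that f c0 by simp
    then have "(\<Union>c\<in>cl f. ?L ` c) = {proj f}" using zero0 unfolding cl_eq[OF f] by auto
    then show ?thesis by (simp add: h_def)
  qed
  have "h \<in> module_iso R ?T ?P"
    unfolding module_iso_def
  proof (intro CollectI conjI ballI)
    fix r x assume r: "r \<in> carrier R" and "x \<in> carrier ?T"
    then obtain f where f: "f \<in> carrier (F 0)" "x = cl f" unfolding T_carrier by blast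
    then show "h (r \<odot>\<^bsub>?T\<^esub> x) = r \<odot>\<^bsub>?P\<^esub> h x"
      using r p(3)[OF f(1), of "r \<odot>\<^bsub>A\<^esub> \<one>"] by (simp add: cl_smult h)
  next
    have "inj_on h (carrier ?T)"
    proof (rule inj_onI)
      fix x y assume "x \<in> carrier ?T" "y \<in> carrier ?T" and eq: "h x = h y"
      then obtain f g where f: "f \<in> carrier (F 0)" "x = cl f" and g: "g \<in> carrier (F 0)" "y = cl g"
        unfolding T_carrier by blast
      have "proj (f \<oplus>\<^bsub>F 0\<^esub> \<ominus>\<^bsub>F 0\<^esub> g) = proj f \<oplus>\<^bsub>R\<^esub> \<ominus>\<^bsub>trivial\<^esub> proj g"
        using p(2)[OF f(1), of "\<ominus>\<^bsub>F 0\<^esub> g"] g(1)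
          right_linear_minus[OF F_right_module trivial_right_module proj_linear(1) g(1)] by simp
      moreover have "proj g \<oplus>\<^bsub>trivial\<^esub> \<ominus>\<^bsub>trivial\<^esub> proj g = \<zero>\<^bsub>trivial\<^esub>"
        by (rule abelian_group.r_neg[OF right_module.axioms(2)[OF trivial_right_module]]) (use p(1)[OF g(1)] in simp)
      ultimately have "f \<oplus>\<^bsub>F 0\<^esub> \<ominus>\<^bsub>F 0\<^esub> g \<in> cycles 0"
        unfolding c0 using eq f g by (simp add: h)
      then have "pt 0 (f \<oplus>\<^bsub>F 0\<^esub> \<ominus>\<^bsub>F 0\<^esub> g) \<in> ?B" unfolding boundaries_eq by blast
      then have "pt 0 f \<oplus>\<^bsub>C 0\<^esub> \<ominus>\<^bsub>C 0\<^esub> pt 0 g \<in> ?B" using f(1) g(1) by (simp add: pt_add pt_minus)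
      then show "x = y" using B.H.coset_eq_iff[OF pt_mem[OF f(1)] pt_mem[OF g(1)]] f(2) g(2) by (simp add: cl_def)
    qed
    moreover have "h ` carrier ?T = carrier ?P"
    proof -
      have "h ` carrier ?T = proj ` carrier (F 0)"
        unfolding T_carrier image_image by (rule image_cong) (simp_all add: h)
      then show ?thesis using proj_linear(2) by simp
    qed
    moreover have "h (x \<oplus>\<^bsub>?T\<^esub> y) = h x \<oplus>\<^bsub>?P\<^esub> h y" if "x \<in> carrier ?T" "y \<in> carrier ?T" for x y
    proof -
      obtain f g where f: "f \<in> carrier (F 0)" "x = cl f" and g: "g \<in> carrier (F 0)" "y = cl g"
        using \<open>x \<in> carrier ?T\<close> \<open>y \<in> carrier ?T\<close> unfolding T_carrier by blast
      then show ?thesis using p(2)[OF f(1) g(1)] by (simp add: cl_add h)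
    qed
    ultimately show "h \<in> iso (add_monoid ?T) (add_monoid ?P)"
      by (auto simp: iso_def hom_def bij_betw_def)
  qed
  then show ?thesis unfolding T by blast
qed

end

section \<open>The presentation\<close>

context cring
begin

definition conv :: "('x list \<Rightarrow> 'a) \<Rightarrow> ('x list \<Rightarrow> 'a) \<Rightarrow> 'x list \<Rightarrow> 'a" where
  "conv f g w = (\<Oplus>i\<in>{..length w}. f (take i w) \<otimes> g (drop i w))"

lemma conv_Nil: "(\<And>u. f u \<in> carrier R) \<Longrightarrow> (\<And>u. g u \<in> carrier R) \<Longrightarrow> conv f g [] = f [] \<otimes> g []"
  by (simp add: conv_def)

text \<open>Recursion on the first letter turns the laws of the convolution product into inductions
  on the word, without index manipulations.\<close>

lemma conv_Cons:
  assumes "\<And>u. f u \<in> carrier R" "\<And>u. g u \<in> carrier R"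
  shows "conv f g (x # w) = f [] \<otimes> g (x # w) \<oplus> conv (\<lambda>u. f (x # u)) g w"
proof -
  have "conv f g (x # w) = (\<Oplus>i\<in>{..Suc (length w)}. f (take i (x # w)) \<otimes> g (drop i (x # w)))"
    by (simp add: conv_def)
  also have "\<dots> = (\<Oplus>i\<in>{..length w}. f (take (Suc i) (x # w)) \<otimes> g (drop (Suc i) (x # w)))
      \<oplus> f (take 0 (x # w)) \<otimes> g (drop 0 (x # w))"
    by (rule add.finprod_Suc2) (use assms in auto)
  also have "\<dots> = conv (\<lambda>u. f (x # u)) g w \<oplus> f [] \<otimes> g (x # w)"
    by (simp add: conv_def)
  moreover have "conv (\<lambda>u. f (x # u)) g w \<in> carrier R"
    unfolding conv_def using assms by auto
  ultimately show ?thesis using assms by (simp add: a_comm)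
qed

lemma conv_closed [simp]: "(\<And>u. f u \<in> carrier R) \<Longrightarrow> (\<And>u. g u \<in> carrier R) \<Longrightarrow> conv f g w \<in> carrier R"
  unfolding conv_def by auto

lemma conv_add_left:
  "(\<And>u. f u \<in> carrier R) \<Longrightarrow> (\<And>u. f' u \<in> carrier R) \<Longrightarrow> (\<And>u. g u \<in> carrier R) \<Longrightarrow>
    conv (\<lambda>u. f u \<oplus> f' u) g w = conv f g w \<oplus> conv f' g w"
  by (induction w arbitrary: f f') (simp_all add: conv_Nil conv_Cons l_distr a_ac)

lemma conv_add_right:
  "(\<And>u. f u \<in> carrier R) \<Longrightarrow> (\<And>u. g u \<in> carrier R) \<Longrightarrow> (\<And>u. g' u \<in> carrier R) \<Longrightarrow>
    conv f (\<lambda>u. g u \<oplus> g' u) w = conv f g w \<oplus> conv f g' w"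
  by (induction w arbitrary: f) (simp_all add: conv_Nil conv_Cons r_distr a_ac)

lemma conv_smult_left:
  "(\<And>u. f u \<in> carrier R) \<Longrightarrow> (\<And>u. g u \<in> carrier R) \<Longrightarrow> r \<in> carrier R \<Longrightarrow>
    conv (\<lambda>u. f u \<otimes> r) g w = conv f g w \<otimes> r"
  by (induction w arbitrary: f) (simp_all add: conv_Nil conv_Cons l_distr r_distr m_ac)

lemma conv_smult_left':
  "(\<And>u. f u \<in> carrier R) \<Longrightarrow> (\<And>u. g u \<in> carrier R) \<Longrightarrow> r \<in> carrier R \<Longrightarrow>
    conv (\<lambda>u. r \<otimes> f u) g w = r \<otimes> conv f g w"
  by (induction w arbitrary: f) (simp_all add: conv_Nil conv_Cons r_distr m_ac)

lemma conv_smult_right: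
  "(\<And>u. f u \<in> carrier R) \<Longrightarrow> (\<And>u. g u \<in> carrier R) \<Longrightarrow> r \<in> carrier R \<Longrightarrow>
    conv f (\<lambda>u. g u \<otimes> r) w = conv f g w \<otimes> r"
  by (induction w arbitrary: f) (simp_all add: conv_Nil conv_Cons l_distr r_distr m_ac)

lemma conv_assoc:
  "(\<And>u. f u \<in> carrier R) \<Longrightarrow> (\<And>u. g u \<in> carrier R) \<Longrightarrow> (\<And>u. h u \<in> carrier R) \<Longrightarrow>
    conv (conv f g) h w = conv f (conv g h) w"
proof (induction w arbitrary: f)
  case Nil
  then show ?case by (simp add: conv_Nil m_assoc)
next
  case (Cons x w)
  have "(\<lambda>u. conv f g (x # u)) = (\<lambda>u. f [] \<otimes> g (x # u) \<oplus> conv (\<lambda>u. f (x # u)) g u)"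
    using Cons.prems by (simp add: conv_Cons)
  then have "conv (conv f g) h (x # w) = (f [] \<otimes> g []) \<otimes> h (x # w)
      \<oplus> (f [] \<otimes> conv (\<lambda>u. g (x # u)) h w \<oplus> conv (conv (\<lambda>u. f (x # u)) g) h w)"
    using Cons.prems by (simp add: conv_Cons[of "conv f g"] conv_Nil conv_add_left conv_smult_left')
  also have "\<dots> = f [] \<otimes> (g [] \<otimes> h (x # w) \<oplus> conv (\<lambda>u. g (x # u)) h w)
      \<oplus> conv (\<lambda>u. f (x # u)) (conv g h) w"
    using Cons.prems by (simp add: Cons.IH r_distr m_assoc a_assoc)
  also have "\<dots> = conv f (conv g h) (x # w)"
    using Cons.prems by (simp add: conv_Cons)
  finally show ?case .
qed

lemma conv_zero_left: "(\<And>u. g u \<in> carrier R) \<Longrightarrow> conv (\<lambda>u. \<zero>) g w = \<zero>"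
  by (induction w) (simp_all add: conv_Nil conv_Cons)

lemma basis_vector_closed [simp]: "basis_vector R x y \<in> carrier R"
  by (simp add: basis_vector_def)

lemma conv_one_left: "(\<And>u. g u \<in> carrier R) \<Longrightarrow> conv (basis_vector R []) g = g"
proof
  fix w assume g: "\<And>u. g u \<in> carrier R"
  show "conv (basis_vector R []) g w = g w"
    using g by (cases w) (simp_all add: conv_Nil conv_Cons, simp_all add: basis_vector_def conv_zero_left)
qed

lemma conv_one_right: "(\<And>u. f u \<in> carrier R) \<Longrightarrow> conv f (basis_vector R []) w = f w"
  by (induction w arbitrary: f) (simp_all add: conv_Nil conv_Cons, simp_all add: basis_vector_def)

lemma conv_basis_vector: "conv (basis_vector R u) (basis_vector R v) = basis_vector R (u @ v)"
proof (induction u)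
  case Nil
  then show ?case by (simp add: conv_one_left)
next
  case (Cons x u)
  show ?case
  proof
    fix w
    show "conv (basis_vector R (x # u)) (basis_vector R v) w = basis_vector R ((x # u) @ v) w"
    proof (cases w)
      case Nil
      then show ?thesis by (simp add: conv_Nil) (simp add: basis_vector_def)
    next
      case w: (Cons y w')
      have "(\<lambda>t. basis_vector R (x # u) (y # t)) = (if y = x then basis_vector R u else (\<lambda>t. \<zero>))"
        by (auto simp: basis_vector_def fun_eq_iff)
      moreover have "basis_vector R (x # u) [] = \<zero>" by (simp add: basis_vector_def)
      ultimately have "conv (basis_vector R (x # u)) (basis_vector R v) w
          = (if y = x then basis_vector R (u @ v) w' else \<zero>)"
        using w Cons.IH by (simp add: conv_Cons conv_zero_left)
      then show ?thesis using w by (auto simp: basis_vector_def)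
    qed
  qed
qed

lemma conv_support:
  assumes "\<And>u. f u \<in> carrier R" "\<And>u. g u \<in> carrier R" "conv f g w \<noteq> \<zero>"
  shows "\<exists>u v. w = u @ v \<and> f u \<noteq> \<zero> \<and> g v \<noteq> \<zero>"
proof (rule ccontr)
  assume "\<not> ?thesis"
  then have "f (take i w) \<otimes> g (drop i w) = \<zero>" for i
    using assms(1,2) append_take_drop_id[of i w] by (metis l_null r_null)
  then show False using assms(3) by (simp add: conv_def)
qed

lemma free_algebra_simps:
  "carrier (free_algebra R X) = carrier (free_module R (lists X))"
  "\<zero>\<^bsub>free_algebra R X\<^esub> = (\<lambda>w. \<zero>)" "\<one>\<^bsub>free_algebra R X\<^esub> = basis_vector R []"
  "f \<oplus>\<^bsub>free_algebra R X\<^esub> g = (\<lambda>w. f w \<oplus> g w)" "f \<otimes>\<^bsub>free_algebra R X\<^esub> g = conv f g"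
  "r \<odot>\<^bsub>free_algebra R X\<^esub> f = (\<lambda>w. f w \<otimes> r)"
  by (simp_all add: free_algebra_def free_module_def conv_def fun_eq_iff)

lemma free_algebra_right_module: "right_module R (free_algebra R X)"
proof -
  interpret F: right_module R "free_module R (lists X)" by (rule free_module_right_module)
  have "add_monoid (free_algebra R X) = add_monoid (free_module R (lists X))"
    by (simp add: free_algebra_def)
  then have "abelian_group (free_algebra R X)"
    using F.M.abelian_group_axioms
    by (simp add: abelian_group_def abelian_monoid_def abelian_group_axioms_def)
  then show ?thesis
    by (intro right_module.intro right_module_axioms.intro ring_axioms)
      (use F.smult_closed in \<open>auto simp: free_algebra_simps free_module_carrier l_distr r_distr m_assoc\<close>)
qed

lemma conv_free: 
  assumes "f \<in> carrier (free_module R (lists X))" "g \<in> carrier (free_module R (lists X))"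
  shows "conv f g \<in> carrier (free_module R (lists X))"
proof (rule free_module_carrierI)
  let ?S = "(\<lambda>(u, v). u @ v) ` ({u. f u \<noteq> \<zero>} \<times> {v. g v \<noteq> \<zero>})"
  have fg: "\<And>u. f u \<in> carrier R" "\<And>u. g u \<in> carrier R" using assms by (auto simp: free_module_carrier)
  then show "conv f g w \<in> carrier R" for w by simp
  show "finite ?S" "?S \<subseteq> lists X" using assms by (auto simp: free_module_carrier subset_eq)
  show "conv f g w = \<zero>" if "w \<notin> ?S" for w
    using conv_support[of f g w] fg that by (force simp: image_iff)
qed

lemma free_algebra_ring: "ring (free_algebra R X)"
proof -
  interpret F: right_module R "free_algebra R X" by (rule free_algebra_right_module)
  have c: "f w \<in> carrier R" if "f \<in> carrier (free_algebra R X)" for f w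
    using that by (simp add: free_algebra_simps free_module_carrier)
  show ?thesis
  proof (rule ringI)
    show "monoid (free_algebra R X)"
      by (rule monoidI) (use conv_free c in \<open>auto simp: free_algebra_simps fun_eq_iff conv_assoc conv_one_left conv_one_right\<close>)
  qed (use c F.M.abelian_group_axioms in \<open>auto simp: free_algebra_simps fun_eq_iff conv_add_left conv_add_right\<close>)
qed

lemma free_algebra_smult_mult:
  assumes "f \<in> carrier (free_algebra R X)" "g \<in> carrier (free_algebra R X)" "r \<in> carrier R"
  shows "(r \<odot>\<^bsub>free_algebra R X\<^esub> f) \<otimes>\<^bsub>free_algebra R X\<^esub> g = r \<odot>\<^bsub>free_algebra R X\<^esub> (f \<otimes>\<^bsub>free_algebra R X\<^esub> g)"
    "f \<otimes>\<^bsub>free_algebra R X\<^esub> (r \<odot>\<^bsub>free_algebra R X\<^esub> g) = r \<odot>\<^bsub>free_algebra R X\<^esub> (f \<otimes>\<^bsub>free_algebra R X\<^esub> g)"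
  using assms by (simp_all add: free_algebra_simps free_module_carrier fun_eq_iff conv_smult_left conv_smult_right)

end

section \<open>The Temperley--Lieb algebra as a quotient of the free algebra\<close>

locale tl_presentation = R?: cring R for R :: "('r, 'z) ring_scheme" (structure) +
  fixes a :: 'r and n :: nat
  assumes a [simp]: "a \<in> carrier R"
begin

definition T :: "('r, nat list \<Rightarrow> 'r) module" where "T = free_algebra R {1..<n}"
abbreviation relators :: "(nat list \<Rightarrow> 'r) set" where "relators \<equiv> tl_relations R n a"
definition J :: "(nat list \<Rightarrow> 'r) set" where "J = genideal T relators"
abbreviation A :: "('r, (nat list \<Rightarrow> 'r) set) module" where "A \<equiv> temperley_lieb R n a"
abbreviation word :: "nat list \<Rightarrow> nat list \<Rightarrow> 'r" where "word w \<equiv> basis_vector R w"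

definition W :: "nat list \<Rightarrow> (nat list \<Rightarrow> 'r) set" where "W w = J +>\<^bsub>T\<^esub> word w"

lemmas T_simps = free_algebra_simps[where X = "{1..<n}", folded T_def]
lemmas T_smult_mult = free_algebra_smult_mult[where X = "{1..<n}", folded T_def]
lemmas relators_def = tl_relations_def[of R n a, unfolded Let_def, folded T_def]

lemma A_def: "A = quotient T J"
  by (simp only: temperley_lieb_def T_def J_def)

sublocale T: ring T unfolding T_def by (rule free_algebra_ring)
sublocale TM: right_module R T unfolding T_def by (rule free_algebra_right_module)

lemma word_closed [simp]: "set w \<subseteq> {1..<n} \<Longrightarrow> word w \<in> carrier T"
  unfolding T_simps by (rule basis_vector_carrier) auto

lemma letter_closed [simp]: "i \<in> {1..<n} \<Longrightarrow> word [i] \<in> carrier T"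
  by (rule word_closed) simp

lemma word_mult: "word u \<otimes>\<^bsub>T\<^esub> word v = word (u @ v)"
  by (simp add: T_simps conv_basis_vector)

lemma relators_closed: "relators \<subseteq> carrier T"
proof -
  show ?thesis unfolding relators_def
    by (intro Un_least subsetI; elim CollectE exE conjE; simp del: One_nat_def)
qed

sublocale J: ideal J T unfolding J_def by (rule T.genideal_ideal[OF relators_closed])

text \<open>A two-sided ideal is stable under scalars because r f = f (r 1).\<close>

sublocale JM: right_submodule R T J
proof -
  have "r \<odot>\<^bsub>T\<^esub> f \<in> J" if "r \<in> carrier R" "f \<in> J" for r f
  proof -
    have f: "f \<in> carrier T" using that J.a_subset by blast
    have "r \<odot>\<^bsub>T\<^esub> f = f \<otimes>\<^bsub>T\<^esub> (r \<odot>\<^bsub>T\<^esub> \<one>\<^bsub>T\<^esub>)"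
      using T_smult_mult(2)[OF f T.one_closed that(1)] f by simp
    then show ?thesis using J.I_r_closed[OF that(2), of "r \<odot>\<^bsub>T\<^esub> \<one>\<^bsub>T\<^esub>"] that(1) by simp
  qed
  then show "right_submodule R T J"
    by (intro right_submodule.intro TM.right_module_axioms right_submodule_axioms.intro
        abelian_subgroupI3 J.is_additive_subgroup T.abelian_group_axioms)
qed

lemma A_carrier: "carrier A = (\<lambda>f. J +>\<^bsub>T\<^esub> f) ` carrier T"
  unfolding A_def by (rule JM.quotient_carrier)

lemma A_add: "f \<in> carrier T \<Longrightarrow> g \<in> carrier T \<Longrightarrow> (J +>\<^bsub>T\<^esub> f) \<oplus>\<^bsub>A\<^esub> (J +>\<^bsub>T\<^esub> g) = J +>\<^bsub>T\<^esub> (f \<oplus>\<^bsub>T\<^esub> g)"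
  unfolding A_def by (rule JM.quotient_add)

lemma A_smult: "r \<in> carrier R \<Longrightarrow> f \<in> carrier T \<Longrightarrow> r \<odot>\<^bsub>A\<^esub> (J +>\<^bsub>T\<^esub> f) = J +>\<^bsub>T\<^esub> (r \<odot>\<^bsub>T\<^esub> f)"
  unfolding A_def by (rule JM.quotient_smult)

lemma A_mult: "f \<in> carrier T \<Longrightarrow> g \<in> carrier T \<Longrightarrow> (J +>\<^bsub>T\<^esub> f) \<otimes>\<^bsub>A\<^esub> (J +>\<^bsub>T\<^esub> g) = J +>\<^bsub>T\<^esub> (f \<otimes>\<^bsub>T\<^esub> g)"
  by (simp add: A_def quotient_def FactRing_def J.rcoset_mult_add)

lemma A_one: "\<one>\<^bsub>A\<^esub> = J +>\<^bsub>T\<^esub> \<one>\<^bsub>T\<^esub>"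
  by (simp add: A_def quotient_def FactRing_def)

sublocale AM: right_module R A
  unfolding A_def by (rule JM.quotient_right_module)

sublocale A: ring A
proof (rule ringI)
  show "abelian_group A" by (rule AM.M.abelian_group_axioms)
  show "monoid A"
    by (rule monoidI) (auto simp: A_carrier A_mult A_one T.m_assoc)
qed (auto simp: A_carrier A_mult A_add T.l_distr T.r_distr)

lemma A_smult_mult:
  assumes "c \<in> carrier A" "d \<in> carrier A" "r \<in> carrier R"
  shows "(r \<odot>\<^bsub>A\<^esub> c) \<otimes>\<^bsub>A\<^esub> d = r \<odot>\<^bsub>A\<^esub> (c \<otimes>\<^bsub>A\<^esub> d)" "c \<otimes>\<^bsub>A\<^esub> (r \<odot>\<^bsub>A\<^esub> d) = r \<odot>\<^bsub>A\<^esub> (c \<otimes>\<^bsub>A\<^esub> d)"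
  using assms by (auto simp: A_carrier A_mult A_smult T_smult_mult)

lemma W_closed [simp]: "set w \<subseteq> {1..<n} \<Longrightarrow> W w \<in> carrier A"
  by (auto simp: W_def A_carrier)

lemma W_append: "set u \<subseteq> {1..<n} \<Longrightarrow> set v \<subseteq> {1..<n} \<Longrightarrow> W (u @ v) = W u \<otimes>\<^bsub>A\<^esub> W v"
  by (simp add: W_def A_mult word_mult)

lemma coset_eqI: "f \<in> carrier T \<Longrightarrow> g \<in> carrier T \<Longrightarrow> f \<ominus>\<^bsub>T\<^esub> g \<in> relators \<Longrightarrow> J +>\<^bsub>T\<^esub> f = J +>\<^bsub>T\<^esub> g"
  using J.coset_eq_iff[of f g] T.genideal_self[OF relators_closed, folded J_def] by (auto simp: a_minus_def)

lemma W_sq: "i \<in> {1..<n} \<Longrightarrow> W [i, i] = a \<odot>\<^bsub>A\<^esub> W [i]"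
proof -
  assume i: "i \<in> {1..<n}"
  then have "word [i] \<otimes>\<^bsub>T\<^esub> word [i] \<ominus>\<^bsub>T\<^esub> a \<odot>\<^bsub>T\<^esub> word [i] \<in> relators"
    unfolding relators_def by blast
  then have "J +>\<^bsub>T\<^esub> (word [i] \<otimes>\<^bsub>T\<^esub> word [i]) = J +>\<^bsub>T\<^esub> (a \<odot>\<^bsub>T\<^esub> word [i])"
    using i by (intro coset_eqI) (simp_all del: One_nat_def)
  then show ?thesis using i by (simp add: W_def A_smult word_mult)
qed

lemma W_braid: "i \<in> {1..<n} \<Longrightarrow> j \<in> {1..<n} \<Longrightarrow> j = i + 1 \<or> i = j + 1 \<Longrightarrow> W [i, j, i] = W [i]"
proof -
  assume i: "i \<in> {1..<n}" "j \<in> {1..<n}" "j = i + 1 \<or> i = j + 1"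
  then have "word [i] \<otimes>\<^bsub>T\<^esub> word [j] \<otimes>\<^bsub>T\<^esub> word [i] \<ominus>\<^bsub>T\<^esub> word [i] \<in> relators"
    unfolding relators_def by blast
  then have "J +>\<^bsub>T\<^esub> (word [i] \<otimes>\<^bsub>T\<^esub> word [j] \<otimes>\<^bsub>T\<^esub> word [i]) = J +>\<^bsub>T\<^esub> word [i]"
    using i by (intro coset_eqI) (simp_all del: One_nat_def)
  then show ?thesis by (simp add: W_def word_mult)
qed

lemma W_comm: "i \<in> {1..<n} \<Longrightarrow> j \<in> {1..<n} \<Longrightarrow> i + 2 \<le> j \<Longrightarrow> W [i, j] = W [j, i]"
proof -
  assume i: "i \<in> {1..<n}" "j \<in> {1..<n}" "i + 2 \<le> j"
  then have "\<bar>int i - int j\<bar> \<ge> 2" by linarith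
  then have "word [i] \<otimes>\<^bsub>T\<^esub> word [j] \<ominus>\<^bsub>T\<^esub> word [j] \<otimes>\<^bsub>T\<^esub> word [i] \<in> relators"
    unfolding relators_def using i by blast
  then have "J +>\<^bsub>T\<^esub> (word [i] \<otimes>\<^bsub>T\<^esub> word [j]) = J +>\<^bsub>T\<^esub> (word [j] \<otimes>\<^bsub>T\<^esub> word [i])"
    using i by (intro coset_eqI) (simp_all del: One_nat_def)
  then show ?thesis by (simp add: W_def word_mult)
qed

text \<open>The rewriting of monomials is valid in the algebra. Combined with
  \<open>run_faithful\<close>, equal diagrams with equal loop numbers give equal elements.\<close>

lemma W_tleq_power:
  "tleq n s t \<Longrightarrow> set (snd s) \<subseteq> {1..<n} \<Longrightarrow> (a [^] fst s) \<odot>\<^bsub>A\<^esub> W (snd s) = (a [^] fst t) \<odot>\<^bsub>A\<^esub> W (snd t)"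
proof (induction rule: tleq.induct)
  case (tleq_sym s t)
  then show ?case using tleq_set by metis
next
  case (tleq_trans s t r)
  then show ?case using tleq_set by metis
next
  case (tleq_sq i k u v)
  have "W (u @ [i, i] @ v) = a \<odot>\<^bsub>A\<^esub> W (u @ [i] @ v)"
  proof -
    have "W (u @ [i, i] @ v) = W u \<otimes>\<^bsub>A\<^esub> (W [i, i] \<otimes>\<^bsub>A\<^esub> W v)" "W (u @ [i] @ v) = W u \<otimes>\<^bsub>A\<^esub> (W [i] \<otimes>\<^bsub>A\<^esub> W v)"
      using tleq_sq W_append[of u "[i, i] @ v"] W_append[of "[i, i]" v] W_append[of u "[i] @ v"] W_append[of "[i]" v]
      by simp_all
    then show ?thesis using tleq_sq by (simp add: W_sq A_smult_mult)
  qed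
  then show ?case
    using tleq_sq AM.smult_mult[of a "a [^] k" "W (u @ [i] @ v)"] by (auto simp: m_comm)
next
  case (tleq_braid i j k u v)
  then have "W (u @ [i, j, i] @ v) = W (u @ [i] @ v)"
    using W_append[of u "[i, j, i] @ v"] W_append[of "[i, j, i]" v] W_append[of u "[i] @ v"] W_append[of "[i]" v] W_braid[of i j]
    by simp
  then show ?case by simp
next
  case (tleq_comm i j k u v)
  then have "W (u @ [i, j] @ v) = W (u @ [j, i] @ v)"
    using W_append[of u "[i, j] @ v"] W_append[of "[i, j]" v] W_append[of u "[j, i] @ v"] W_append[of "[j, i]" v] W_comm[of i j]
    by simp
  then show ?case by simp
qed simp

lemma W_tleq: "set w \<subseteq> {1..<n} \<Longrightarrow> tleq n (0, w) (0, w') \<Longrightarrow> W w = W w'"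
  using W_tleq_power[of "(0, w)" "(0, w')"] tleq_set[of n "(0, w)" "(0, w')"] by simp

section \<open>The diagram representation\<close>

text \<open>The predicate bounds the support: which diagrams can occur in an element is recorded by
  membership in such a submodule, and two bounds are combined by \<open>V_Int\<close>.\<close>

definition V :: "((int \<Rightarrow> int) \<Rightarrow> bool) \<Rightarrow> ('r, (int \<Rightarrow> int) \<Rightarrow> 'r) module" where
  "V B = free_module R {p. matching p \<and> B p}"

abbreviation V0 :: "('r, (int \<Rightarrow> int) \<Rightarrow> 'r) module" where "V0 \<equiv> V (\<lambda>p. True)"

abbreviation dg :: "(int \<Rightarrow> int) \<Rightarrow> (int \<Rightarrow> int) \<Rightarrow> 'r" where "dg p \<equiv> basis_vector R p"

definition weight :: "nat \<times> (int \<Rightarrow> int) \<Rightarrow> (int \<Rightarrow> int) \<Rightarrow> 'r" where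
  "weight s = (a [^] fst s) \<odot>\<^bsub>V0\<^esub> dg (snd s)"

definition rho :: "nat list \<Rightarrow> ((int \<Rightarrow> int) \<Rightarrow> 'r) \<Rightarrow> (int \<Rightarrow> int) \<Rightarrow> 'r" where
  "rho w = linear_ext R V0 (\<lambda>p. weight (run w (0, p)))"

definition act :: "(nat list \<Rightarrow> 'r) \<Rightarrow> ((int \<Rightarrow> int) \<Rightarrow> 'r) \<Rightarrow> (int \<Rightarrow> int) \<Rightarrow> 'r" where
  "act f x = linear_ext R V0 (\<lambda>w. rho w x) f"

lemma V_right_module: "right_module R (V B)"
  unfolding V_def by (rule free_module_right_module)

lemma dg_closed: "matching p \<Longrightarrow> B p \<Longrightarrow> dg p \<in> carrier (V B)"
  by (simp add: V_def)

lemma V_ops: "x \<oplus>\<^bsub>V B\<^esub> y = x \<oplus>\<^bsub>V0\<^esub> y" "r \<odot>\<^bsub>V B\<^esub> x = r \<odot>\<^bsub>V0\<^esub> x" "\<zero>\<^bsub>V B\<^esub> = \<zero>\<^bsub>V0\<^esub>"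
  by (simp_all add: V_def)

lemma V_subset: "(\<And>p. matching p \<Longrightarrow> B p \<Longrightarrow> B' p) \<Longrightarrow> x \<in> carrier (V B) \<Longrightarrow> x \<in> carrier (V B')"
  using free_module_mono[of "{p. matching p \<and> B p}" "{p. matching p \<and> B' p}" R] unfolding V_def by blast

lemma V_Int: "x \<in> carrier (V B) \<Longrightarrow> x \<in> carrier (V B') \<Longrightarrow> x \<in> carrier (V (\<lambda>p. B p \<and> B' p))"
  by (simp add: V_def free_module_carrier subset_eq)

sublocale V0: right_module R V0 by (rule V_right_module)

lemma weight_closed: "matching (snd s) \<Longrightarrow> B (snd s) \<Longrightarrow> weight s \<in> carrier (V B)"
  unfolding weight_def V_ops(2)[of B, symmetric]
  by (rule right_module.smult_closed[OF V_right_module]) (simp_all add: dg_closed)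

lemma weight_shift: "(a [^] k) \<odot>\<^bsub>V0\<^esub> weight s = weight (k + fst s, snd s)"
  by (auto simp: weight_def V_def basis_vector_def fun_eq_iff nat_pow_mult m_comm)

lemma V0_linear_ext: "(\<And>p. matching p \<Longrightarrow> g p \<in> carrier V0) \<Longrightarrow> right_linear R V0 V0 (linear_ext R V0 g)"
  unfolding V_def[of "\<lambda>p. True"] by (rule V0.linear_ext_right_linear[unfolded V_def]) simp

lemma V0_linear_eqI:
  assumes "right_linear R V0 M h" "right_linear R V0 M k" "right_module R M"
    and "\<And>p. matching p \<Longrightarrow> h (dg p) = k (dg p)" and "x \<in> carrier V0"
  shows "h x = k x"
  by (rule right_module.right_linear_eqI[OF assms(3) assms(1,2)[unfolded V_def] _ assms(5)[unfolded V_def]])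
    (simp add: assms(4))

lemma rho_linear:
  assumes "\<And>p. matching p \<Longrightarrow> B (snd (run w (0, p)))"
  shows "right_linear R V0 (V B) (rho w)"
proof -
  have 1: "right_linear R V0 V0 (rho w)"
    unfolding rho_def by (rule V0_linear_ext) (simp add: weight_closed)
  note D = right_linearD[OF 1]
  have "rho w x \<in> carrier (V B)" if "x \<in> carrier V0" for x
    using that unfolding V_def[of "\<lambda>p. True"]
  proof (induction x rule: free_module_induct)
    case zero
    have "rho w \<zero>\<^bsub>V0\<^esub> = \<zero>\<^bsub>V0\<^esub>" by (rule right_linear_zero[OF V0.right_module_axioms V0.right_module_axioms 1])
    then show ?case
      using abelian_monoid.zero_closed[OF abelian_group.axioms(1)[OF right_module.axioms(2)[OF V_right_module[of B]]]]
      by (simp add: V_def)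
  next
    case (add f g)
    then have "rho w f \<oplus>\<^bsub>V B\<^esub> rho w g \<in> carrier (V B)"
      by (intro abelian_monoid.a_closed[OF abelian_group.axioms(1)[OF right_module.axioms(2)[OF V_right_module]]])
    then show ?case using D(2)[of f g] add by (simp add: V_def)
  next
    case (basis r p)
    then have p: "matching p" "dg p \<in> carrier V0" by (auto simp: dg_closed)
    have "rho w (dg p) = weight (run w (0, p))"
      unfolding rho_def by (rule V0.linear_ext_basis_vector) (simp add: weight_closed p)
    then have "rho w (dg p) \<in> carrier (V B)" using weight_closed[of "run w (0, p)" B] assms p by simp
    then have "r \<odot>\<^bsub>V B\<^esub> rho w (dg p) \<in> carrier (V B)"
      using basis by (intro right_module.smult_closed[OF V_right_module])
    then show ?case using D(3)[OF p(2) basis(1)] by (simp add: V_def)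
  qed
  then show ?thesis using D unfolding right_linear_def V_ops[where B = B] by simp
qed

lemma rho_linear0: "right_linear R V0 V0 (rho w)"
  by (rule rho_linear) simp

lemma rho_weight: "matching (snd s) \<Longrightarrow> rho w (weight s) = weight (run w s)"
proof -
  assume s: "matching (snd s)"
  have "rho w (weight s) = (a [^] fst s) \<odot>\<^bsub>V0\<^esub> rho w (dg (snd s))"
    unfolding weight_def by (rule right_linearD(3)[OF rho_linear0]) (simp_all add: s dg_closed)
  also have "rho w (dg (snd s)) = weight (run w (0, snd s))"
    unfolding rho_def by (rule V0.linear_ext_basis_vector) (simp add: weight_closed s)
  also have "(a [^] fst s) \<odot>\<^bsub>V0\<^esub> weight (run w (0, snd s)) = weight (run w (fst s, snd s))"
    using run_shift[of w "fst s" 0 "snd s"] unfolding weight_shift by simp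
  finally show ?thesis by simp
qed

lemma weight_zero: "weight (0, p) = dg p"
  by (simp add: weight_def V_def basis_vector_def fun_eq_iff)

lemma V0_smult_linear: "r \<in> carrier R \<Longrightarrow> right_linear R V0 V0 (\<lambda>x. r \<odot>\<^bsub>V0\<^esub> x)"
  by (auto simp: right_linear_def V0.smult_add V0.smult_mult[symmetric] m_comm)

lemma right_linear_add:
  assumes "right_linear R M V0 h" "right_linear R M V0 k"
  shows "right_linear R M V0 (\<lambda>x. h x \<oplus>\<^bsub>V0\<^esub> k x)"
  unfolding right_linear_def
proof (intro conjI ballI)
  fix x y assume x: "x \<in> carrier M" and y: "y \<in> carrier M"
  note hx = right_linearD[OF assms(1) x] right_linearD(1)[OF assms(1) y]
  note kx = right_linearD[OF assms(2) x] right_linearD(1)[OF assms(2) y]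
  show "h (x \<oplus>\<^bsub>M\<^esub> y) \<oplus>\<^bsub>V0\<^esub> k (x \<oplus>\<^bsub>M\<^esub> y) = (h x \<oplus>\<^bsub>V0\<^esub> k x) \<oplus>\<^bsub>V0\<^esub> (h y \<oplus>\<^bsub>V0\<^esub> k y)"
    using hx kx y by (simp add: V0.M.a_ac)
next
  fix r x assume r: "r \<in> carrier R" and x: "x \<in> carrier M"
  show "h (r \<odot>\<^bsub>M\<^esub> x) \<oplus>\<^bsub>V0\<^esub> k (r \<odot>\<^bsub>M\<^esub> x) = r \<odot>\<^bsub>V0\<^esub> (h x \<oplus>\<^bsub>V0\<^esub> k x)"
    using right_linearD[OF assms(1) x] right_linearD[OF assms(2) x] r by (simp add: V0.smult_add)
qed (use right_linearD(1)[OF assms(1)] right_linearD(1)[OF assms(2)] in simp)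

lemma rho_tleq:
  assumes "tleq n s t" "x \<in> carrier V0"
  shows "(a [^] fst s) \<odot>\<^bsub>V0\<^esub> rho (snd s) x = (a [^] fst t) \<odot>\<^bsub>V0\<^esub> rho (snd t) x"
proof (rule V0_linear_eqI[OF _ _ V0.right_module_axioms _ assms(2)])
  have lin: "right_linear R V0 V0 (\<lambda>x. r \<odot>\<^bsub>V0\<^esub> rho w x)" if "r \<in> carrier R" for r w
    using right_linear_comp[OF rho_linear0 V0_smult_linear[OF that]] .
  show "right_linear R V0 V0 (\<lambda>x. (a [^] fst s) \<odot>\<^bsub>V0\<^esub> rho (snd s) x)"
    "right_linear R V0 V0 (\<lambda>x. (a [^] fst t) \<odot>\<^bsub>V0\<^esub> rho (snd t) x)"
    by (rule lin; simp)+
  fix p :: "int \<Rightarrow> int" assume p: "matching p"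
  have "(a [^] k) \<odot>\<^bsub>V0\<^esub> rho w (dg p) = weight (run w (k, p))" for k w
    using rho_weight[of "(0, p)" w] p run_shift[of w k 0 p] by (simp add: weight_zero weight_shift)
  then show "(a [^] fst s) \<odot>\<^bsub>V0\<^esub> rho (snd s) (dg p) = (a [^] fst t) \<odot>\<^bsub>V0\<^esub> rho (snd t) (dg p)"
    using tleq_run[OF assms(1) p] by (simp)
qed

lemma rho_append: "x \<in> carrier V0 \<Longrightarrow> rho (u @ v) x = rho v (rho u x)"
proof (rule V0_linear_eqI[where h = "rho (u @ v)"])
  show "right_module R V0" by (rule V0.right_module_axioms)
  show "right_linear R V0 V0 (\<lambda>x. rho v (rho u x))"
    by (rule right_linear_comp[OF rho_linear0 rho_linear0])
  fix p :: "int \<Rightarrow> int" assume "matching p"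
  then show "rho (u @ v) (dg p) = rho v (rho u (dg p))"
    using rho_weight[of "(0, p)"] rho_weight[of "run u (0, p)" v] by (simp add: weight_zero)
qed (simp_all add: rho_linear0)

lemma T_carrier: "carrier T = carrier (free_module R (lists {1..<n}))"
  by (rule T_simps)

lemma act_linear: "x \<in> carrier V0 \<Longrightarrow> right_linear R T V0 (\<lambda>f. act f x)"
proof -
  assume "x \<in> carrier V0"
  then have "right_linear R (free_module R (lists {1..<n})) V0 (\<lambda>f. act f x)"
    unfolding act_def by (intro V0.linear_ext_right_linear right_linearD(1)[OF rho_linear0])
  then show ?thesis by (simp add: right_linear_def T_simps)
qed

lemma act_word: "x \<in> carrier V0 \<Longrightarrow> act (word w) x = rho w x"
  unfolding act_def by (rule V0.linear_ext_basis_vector) (rule right_linearD(1)[OF rho_linear0])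

lemma T_linear_eqI:
  assumes "right_linear R T M h" "right_linear R T M k" "right_module R M"
    and "\<And>w. set w \<subseteq> {1..<n} \<Longrightarrow> h (word w) = k (word w)" and "f \<in> carrier T"
  shows "h f = k f"
proof -
  have "right_linear R (free_module R (lists {1..<n})) M h'" if "right_linear R T M h'" for h'
    using that by (simp add: right_linear_def T_simps)
  from this[OF assms(1)] this[OF assms(2)] show ?thesis
    by (rule right_module.right_linear_eqI[OF assms(3)])
      (use assms(4,5) in \<open>auto simp: T_simps in_lists_conv_set subset_eq\<close>)
qed

lemma act_right_linear: "f \<in> carrier T \<Longrightarrow> right_linear R V0 V0 (act f)"
proof -
  assume f: "f \<in> carrier T"
  have lin: "act f x \<in> carrier V0" if "x \<in> carrier V0" for x
    using right_linearD(1)[OF act_linear[OF that] f] .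
  have "act f (x \<oplus>\<^bsub>V0\<^esub> y) = act f x \<oplus>\<^bsub>V0\<^esub> act f y" if "x \<in> carrier V0" "y \<in> carrier V0" for x y
  proof (rule T_linear_eqI[OF act_linear _ V0.right_module_axioms _ f])
    show "right_linear R T V0 (\<lambda>f. act f x \<oplus>\<^bsub>V0\<^esub> act f y)"
      by (rule right_linear_add[OF act_linear[OF that(1)] act_linear[OF that(2)]])
  qed (use that right_linearD(2)[OF rho_linear0] in \<open>simp_all add: act_word\<close>)
  moreover have "act f (r \<odot>\<^bsub>V0\<^esub> x) = r \<odot>\<^bsub>V0\<^esub> act f x" if "r \<in> carrier R" "x \<in> carrier V0" for r x
  proof (rule T_linear_eqI[OF act_linear _ V0.right_module_axioms _ f])
    show "right_linear R T V0 (\<lambda>f. r \<odot>\<^bsub>V0\<^esub> act f x)"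
      by (rule right_linear_comp[OF act_linear[OF that(2)] V0_smult_linear[OF that(1)]])
  qed (use that right_linearD(3)[OF rho_linear0] in \<open>simp_all add: act_word\<close>)
  ultimately show ?thesis using lin by (simp add: right_linear_def)
qed

lemma T_mult_right_linear: "g \<in> carrier T \<Longrightarrow> right_linear R T T (\<lambda>f. f \<otimes>\<^bsub>T\<^esub> g)"
  by (simp add: right_linear_def T.l_distr T_smult_mult)

lemma T_mult_left_linear: "f \<in> carrier T \<Longrightarrow> right_linear R T T (\<lambda>g. f \<otimes>\<^bsub>T\<^esub> g)"
  by (simp add: right_linear_def T.r_distr T_smult_mult)

lemma act_mult:
  assumes f: "f \<in> carrier T" and g: "g \<in> carrier T" and x: "x \<in> carrier V0"
  shows "act (f \<otimes>\<^bsub>T\<^esub> g) x = act g (act f x)"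
proof (rule T_linear_eqI[OF right_linear_comp[OF T_mult_left_linear[OF f] act_linear[OF x]] _ V0.right_module_axioms _ g])
  have fx: "act f x \<in> carrier V0" if "f \<in> carrier T" for f
    by (rule right_linearD(1)[OF act_linear[OF x] that])
  show "right_linear R T V0 (\<lambda>g. act g (act f x))" by (rule act_linear[OF fx[OF f]])
  fix v assume v: "set v \<subseteq> {1..<n}"
  have "act (f \<otimes>\<^bsub>T\<^esub> word v) x = rho v (act f x)"
  proof (rule T_linear_eqI[OF right_linear_comp[OF T_mult_right_linear act_linear[OF x]]
        right_linear_comp[OF act_linear[OF x] rho_linear0] V0.right_module_axioms _ f])
    fix u assume "set u \<subseteq> {1..<n}"
    then show "act (word u \<otimes>\<^bsub>T\<^esub> word v) x = rho v (act (word u) x)"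
      using x by (simp add: word_mult act_word rho_append)
  qed (rule word_closed[OF v])
  then show "act (f \<otimes>\<^bsub>T\<^esub> word v) x = act (word v) (act f x)"
    by (simp add: act_word fx[OF f])
qed

text \<open>The elements acting as zero form a two-sided ideal. It contains the relators, since each
  is a difference of two monomials with equal runs on every matching.\<close>

lemma J_acts_trivially:
  assumes "f \<in> J" "x \<in> carrier V0"
  shows "act f x = \<zero>\<^bsub>V0\<^esub>"
proof -
  define K where "K = {f \<in> carrier T. \<forall>x\<in>carrier V0. act f x = \<zero>\<^bsub>V0\<^esub>}"
  have closed: "act f x \<in> carrier V0" if "f \<in> carrier T" "x \<in> carrier V0" for f x
    by (rule right_linearD(1)[OF act_linear[OF that(2)] that(1)])
  have zero: "act f \<zero>\<^bsub>V0\<^esub> = \<zero>\<^bsub>V0\<^esub>" if "f \<in> carrier T" for f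
    by (rule right_linear_zero[OF V0.right_module_axioms V0.right_module_axioms act_right_linear[OF that]])
  have minus: "act (f \<ominus>\<^bsub>T\<^esub> g) x = act f x \<oplus>\<^bsub>V0\<^esub> \<ominus>\<^bsub>V0\<^esub> act g x"
    if "f \<in> carrier T" "g \<in> carrier T" "x \<in> carrier V0" for f g x
    unfolding a_minus_def
    using right_linearD(2)[OF act_linear[OF that(3)] that(1), of "\<ominus>\<^bsub>T\<^esub> g"] that
      right_linear_minus[OF TM.right_module_axioms V0.right_module_axioms act_linear[OF that(3)] that(2)] by simp
  have "ideal K T"
  proof (rule idealI[OF T.ring_axioms])
    show "subgroup K (add_monoid T)"
    proof (rule T.add.subgroupI)
      show "K \<noteq> {}"
        using right_linear_zero[OF TM.right_module_axioms V0.right_module_axioms act_linear] T.zero_closed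
        unfolding K_def by blast
    next
      fix f assume "f \<in> K"
      then show "\<ominus>\<^bsub>T\<^esub> f \<in> K"
        using right_linear_minus[OF TM.right_module_axioms V0.right_module_axioms act_linear, of _ f]
          V0.M.minus_equality[of "\<zero>\<^bsub>V0\<^esub>" "\<zero>\<^bsub>V0\<^esub>"] unfolding K_def by simp
    next
      fix f g assume "f \<in> K" "g \<in> K"
      then show "f \<oplus>\<^bsub>T\<^esub> g \<in> K"
        using right_linearD(2)[OF act_linear, of _ f g] unfolding K_def by (simp)
    qed (auto simp: K_def)
  next
    fix f g assume "f \<in> K" "g \<in> carrier T"
    then show "g \<otimes>\<^bsub>T\<^esub> f \<in> K" "f \<otimes>\<^bsub>T\<^esub> g \<in> K"
      using closed zero unfolding K_def by (simp_all add: act_mult)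
  qed
  moreover have "relators \<subseteq> K"
  proof
    have K: "f \<ominus>\<^bsub>T\<^esub> g \<in> K" if "f \<in> carrier T" "g \<in> carrier T" "\<And>x. x \<in> carrier V0 \<Longrightarrow> act f x = act g x" for f g
      using that closed by (simp add: K_def minus V0.M.r_neg)
    have rel: "word w \<ominus>\<^bsub>T\<^esub> word w' \<in> K" if "tleq n (0, w) (0, w')" "set w \<subseteq> {1..<n}" "set w' \<subseteq> {1..<n}" for w w'
    proof (rule K[OF word_closed word_closed])
      fix x assume x: "x \<in> carrier V0"
      have "rho w x \<in> carrier V0" "rho w' x \<in> carrier V0" using right_linearD(1)[OF rho_linear0 x] by auto
      then show "act (word w) x = act (word w') x"
        using rho_tleq[OF that(1) x] x by (simp add: act_word)
    qed (use that in auto)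
    fix f assume f: "f \<in> relators"
    consider i j where "f = word [i, j] \<ominus>\<^bsub>T\<^esub> word [j, i]" "i \<in> {1..<n}" "j \<in> {1..<n}" "\<bar>int i - int j\<bar> \<ge> 2"
      | i j where "f = word [i, j, i] \<ominus>\<^bsub>T\<^esub> word [i]" "i \<in> {1..<n}" "j \<in> {1..<n}" "j = i + 1 \<or> i = j + 1"
      | i where "f = word [i, i] \<ominus>\<^bsub>T\<^esub> a \<odot>\<^bsub>T\<^esub> word [i]" "i \<in> {1..<n}"
      using f unfolding relators_def word_mult append_Cons append_Nil by blast
    then show "f \<in> K"
    proof cases
      case (1 i j)
      have "i + 2 \<le> j \<or> j + 2 \<le> i" using 1(4) by linarith
      then have "tleq n (0, [i, j]) (0, [j, i])"
        using tleq_comm[of i n j 0 "[]" "[]"] tleq_sym[OF tleq_comm[of j n i 0 "[]" "[]"]] 1 by auto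
      then show ?thesis using 1 rel[of "[i, j]" "[j, i]"] by simp
    next
      case (2 i j)
      have "tleq n (0, [i, j, i]) (0, [i])" using tleq_braid[OF 2(2-4), of 0 "[]" "[]"] by simp
      then show ?thesis using 2 rel[of "[i, j, i]" "[i]"] by simp
    next
      case (3 i)
      have t: "tleq n (0, [i, i]) (1, [i])" using tleq_sq[OF 3(2), of 0 "[]" "[]"] by simp
      show ?thesis unfolding 3(1)
      proof (rule K)
        fix x assume x: "x \<in> carrier V0"
        have "rho [i, i] x \<in> carrier V0" using right_linearD(1)[OF rho_linear0 x] by auto
        then have "rho [i, i] x = a \<odot>\<^bsub>V0\<^esub> rho [i] x"
          using rho_tleq[OF t x] by (simp)
        then show "act (word [i, i]) x = act (a \<odot>\<^bsub>T\<^esub> word [i]) x"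
          using right_linearD(3)[OF act_linear[OF x], of "word [i]" a] 3(2) x
          by (simp add: act_word)
      qed (use 3(2) in simp_all)
    qed
  qed
  ultimately have "J \<subseteq> K" unfolding J_def by (rule T.genideal_minimal)
  then show ?thesis using assms unfolding K_def by blast
qed

end

text \<open>Each letter creates an arc at its position, and later letters are too far away to
  disturb it.\<close>

lemma run_spaced_arcs:
  "matching (snd s) \<Longrightarrow> spaced n b u \<Longrightarrow> i \<in> set u \<Longrightarrow> arc i (snd (run u s))"
proof (induction u arbitrary: s b)
  case (Cons j u)
  have keep: "arc j (snd (run v t))" if "matching (snd t)" "arc j (snd t)" "\<forall>i\<in>set v. j + 2 \<le> i" for v t
    using that
  proof (induction v arbitrary: t)
    case (Cons k v)
    then show ?case by (simp add: cup_step_def arc_cup_far)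
  qed simp
  have "\<forall>i\<in>set u. j + 2 \<le> i" using spaced_set[of n "j + 2" u] Cons.prems by auto
  moreover have "matching (snd (cup_step j s))" "arc j (snd (cup_step j s))"
    using Cons.prems by (simp_all add: cup_step_def)
  ultimately show ?case using Cons.IH[of "cup_step j s" "j + 2"] Cons.prems keep[of "cup_step j s" u]
    by (cases "i = j") simp_all
qed simp

context tl_presentation
begin

section \<open>Separatedness of the regular module\<close>

text \<open>
  \<open>phi\<close> expands an element of the algebra in diagrams; \<open>psi\<close> maps a diagram back to a loop-free word
  representing it.
\<close>

definition phi :: "(nat list \<Rightarrow> 'r) set \<Rightarrow> (int \<Rightarrow> int) \<Rightarrow> 'r" where
  "phi c = the_elem ((\<lambda>f. act f (dg (base n))) ` c)"

lemma base_closed: "dg (base n) \<in> carrier V0"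
  by (rule dg_closed) simp_all

lemma J_zero: "J +>\<^bsub>T\<^esub> \<zero>\<^bsub>T\<^esub> = \<zero>\<^bsub>A\<^esub>"
  using J.coset_eq_self_iff[of "\<zero>\<^bsub>T\<^esub>"] JM.quotient_zero by (simp add: A_def)

lemma coset_image:
  assumes "f \<in> carrier T" "\<And>k. k \<in> J \<Longrightarrow> h (k \<oplus>\<^bsub>T\<^esub> f) = y"
  shows "the_elem (h ` (J +>\<^bsub>T\<^esub> f)) = y"
proof -
  have "h ` (J +>\<^bsub>T\<^esub> f) = (\<lambda>k. h (k \<oplus>\<^bsub>T\<^esub> f)) ` J" by (auto simp: a_r_coset_def')
  also have "\<dots> = (\<lambda>k. y) ` J" by (rule image_cong) (simp_all add: assms)
  also have "\<dots> = {y}" using J.zero_closed by blast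
  finally show ?thesis by simp
qed

lemma phi_coset: "f \<in> carrier T \<Longrightarrow> phi (J +>\<^bsub>T\<^esub> f) = act f (dg (base n))"
  unfolding phi_def
proof (rule coset_image)
  fix k assume f: "f \<in> carrier T" and k: "k \<in> J"
  have "k \<in> carrier T" using k J.a_subset by blast
  then show "act (k \<oplus>\<^bsub>T\<^esub> f) (dg (base n)) = act f (dg (base n))"
    using right_linearD(2)[OF act_linear[OF base_closed], of k f] f J_acts_trivially[OF k base_closed]
      right_linearD(1)[OF act_linear[OF base_closed] f] by simp
qed

lemma phi_linear: "right_linear R A V0 phi"
  using act_linear[OF base_closed]
  by (auto simp: right_linear_def A_carrier A_add A_smult phi_coset)

lemma phi_W: "c \<in> carrier A \<Longrightarrow> set u \<subseteq> {1..<n} \<Longrightarrow> phi (c \<otimes>\<^bsub>A\<^esub> W u) = rho u (phi c)"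
proof -
  assume "c \<in> carrier A" and u: "set u \<subseteq> {1..<n}"
  then obtain f where f: "f \<in> carrier T" "c = J +>\<^bsub>T\<^esub> f" by (auto simp: A_carrier)
  have "act f (dg (base n)) \<in> carrier V0" by (rule right_linearD(1)[OF act_linear[OF base_closed] f(1)])
  then show ?thesis using f word_closed[OF u]
    by (simp add: W_def A_mult phi_coset act_mult base_closed act_word)
qed

definition reduced :: "(int \<Rightarrow> int) \<Rightarrow> nat list \<Rightarrow> bool" where
  "reduced p w \<longleftrightarrow> set w \<subseteq> {1..<n} \<and> run w (0, base n) = (0, p)"

text \<open>Matchings not reached from the identity by a loop-free word get the value 0, so planar
  diagrams need no characterisation.\<close>

definition sec :: "(int \<Rightarrow> int) \<Rightarrow> (nat list \<Rightarrow> 'r) set" where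
  "sec p = (if \<exists>w. reduced p w then W (SOME w. reduced p w) else \<zero>\<^bsub>A\<^esub>)"

definition psi :: "((int \<Rightarrow> int) \<Rightarrow> 'r) \<Rightarrow> (nat list \<Rightarrow> 'r) set" where
  "psi = linear_ext R A sec"

text \<open>Independence of the chosen word is \<open>run_faithful\<close>.\<close>

lemma sec_reduced: "reduced p w \<Longrightarrow> sec p = W w"
proof -
  assume w: "reduced p w"
  define w' where "w' = (SOME w. reduced p w)"
  have w': "reduced p w'" unfolding w'_def using w by (rule someI)
  have "tleq n (0, w') (0, w)" by (rule run_faithful) (use w w' in \<open>auto simp: reduced_def\<close>)
  then have "W w' = W w" using w' by (intro W_tleq) (auto simp: reduced_def)
  then show ?thesis using w by (auto simp: sec_def w'_def)
qed

lemma sec_closed: "sec p \<in> carrier A"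
  by (cases "\<exists>w. reduced p w") (auto simp: sec_reduced, auto simp: reduced_def sec_def)

lemma psi_linear: "right_linear R V0 A psi"
  unfolding psi_def V_def by (rule AM.linear_ext_right_linear) (rule sec_closed)

lemma psi_dg: "psi (dg p) = sec p"
  unfolding psi_def by (rule AM.linear_ext_basis_vector) (rule sec_closed)

text \<open>This is the diagram basis in the form in which it is used: elements of the algebra can
  be recovered from their expansion. For a word, the loop-free form shows that the expansion is a
  power of a times one diagram, and \<open>W_tleq_power\<close> leads back to the word.\<close>

lemma psi_phi: "c \<in> carrier A \<Longrightarrow> psi (phi c) = c"
proof -
  assume "c \<in> carrier A"
  then obtain f where f: "f \<in> carrier T" "c = J +>\<^bsub>T\<^esub> f" by (auto simp: A_carrier)
  have "psi (act f (dg (base n))) = J +>\<^bsub>T\<^esub> f"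
  proof (rule T_linear_eqI[OF right_linear_comp[OF act_linear[OF base_closed] psi_linear] _ AM.right_module_axioms _ f(1)])
    show "right_linear R T A (\<lambda>f. J +>\<^bsub>T\<^esub> f)" unfolding A_def by (rule JM.coset_right_linear)
    fix w assume w: "set w \<subseteq> {1..<n}"
    obtain k w' where w': "set w' \<subseteq> {1..<n}" "tleq n (0, w) (k, w')" "fst (run w' (0, base n)) = 0"
      using loop_free_form[OF w] by blast
    obtain q where q: "run w' (0, base n) = (0, q)" using w'(3) by (metis prod.collapse)
    have "matching q" using matching_run[of "(0, base n)" w'] q by simp
    have "run w (0, base n) = (k, q)"
      using tleq_run[OF w'(2), of "base n"] run_shift[of w' k 0 "base n"] q by simp
    then have "act (word w) (dg (base n)) = weight (k, q)"
      using rho_weight[of "(0, base n)" w] by (simp add: act_word base_closed weight_zero)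
    then have "psi (act (word w) (dg (base n))) = (a [^] k) \<odot>\<^bsub>A\<^esub> sec q"
      using right_linearD(3)[OF psi_linear dg_closed[OF \<open>matching q\<close>], of "a [^] k"] by (simp add: weight_def psi_dg)
    also have "sec q = W w'" by (rule sec_reduced) (use w'(1) q in \<open>simp add: reduced_def\<close>)
    also have "(a [^] k) \<odot>\<^bsub>A\<^esub> W w' = W w" using W_tleq_power[OF w'(2)] w by simp
    finally show "psi (act (word w) (dg (base n))) = J +>\<^bsub>T\<^esub> word w" by (simp add: W_def)
  qed
  then show ?thesis using f by (simp add: phi_coset)
qed

text \<open>All words in the relators are nonempty, so the ideal of elements without constant
  coefficient contains them and hence contains J.\<close>

lemma augmentation_coset: "f \<in> carrier T \<Longrightarrow> augmentation (J +>\<^bsub>T\<^esub> f) = f []"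
  unfolding augmentation_def
proof (rule coset_image)
  fix k assume f: "f \<in> carrier T" and k: "k \<in> J"
  define E where "E = {f \<in> carrier T. f [] = \<zero>}"
  have c: "f w \<in> carrier R" if "f \<in> carrier T" for f w
    using that by (simp add: T_simps free_module_carrier)
  have zero: "\<zero>\<^bsub>T\<^esub> \<in> E" by (simp add: E_def) (simp add: T_simps)
  have minus: "\<ominus>\<^bsub>T\<^esub> g \<in> E" if g: "g \<in> E" for g
  proof -
    have "\<ominus>\<^bsub>T\<^esub> g = (\<ominus> \<one>) \<odot>\<^bsub>T\<^esub> g" using g by (intro TM.uminus_smult) (simp add: E_def)
    then have "(\<ominus>\<^bsub>T\<^esub> g) [] = g [] \<otimes> (\<ominus> \<one>)" by (simp add: T_simps)
    then show ?thesis using g by (simp add: E_def)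
  qed
  have add: "f \<oplus>\<^bsub>T\<^esub> g \<in> E" if "f \<in> E" "g \<in> E" for f g
  proof -
    have "(f \<oplus>\<^bsub>T\<^esub> g) [] = \<zero>" using that by (simp add: E_def T_simps)
    then show ?thesis using that by (simp add: E_def)
  qed
  have "ideal E T"
  proof (rule idealI[OF T.ring_axioms])
    show "subgroup E (add_monoid T)"
      by (rule T.add.subgroupI) (use zero minus add in \<open>auto simp: E_def\<close>)
  next
    fix f g assume f: "f \<in> E" and g: "g \<in> carrier T"
    have "(g \<otimes>\<^bsub>T\<^esub> f) [] = \<zero>" "(f \<otimes>\<^bsub>T\<^esub> g) [] = \<zero>"
      using f g c[of f] c[OF g] by (simp_all add: E_def T_simps conv_Nil)
    then show "g \<otimes>\<^bsub>T\<^esub> f \<in> E" "f \<otimes>\<^bsub>T\<^esub> g \<in> E" using f g by (simp_all add: E_def)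
  qed
  have word: "word w \<in> E" if "set w \<subseteq> {1..<n}" "w \<noteq> []" for w
    using word_closed[OF that(1)] that(2) by (simp add: E_def basis_vector_def)
  have diff: "f \<ominus>\<^bsub>T\<^esub> g \<in> E" if "f \<in> E" "g \<in> E" for f g
    using that unfolding a_minus_def by (intro add minus)
  have sm: "a \<odot>\<^bsub>T\<^esub> g \<in> E" if "g \<in> E" for g
    using that TM.smult_closed[OF a, of g] by (simp add: E_def) (simp add: T_simps)
  have "relators \<subseteq> E"
    unfolding relators_def word_mult append_Cons append_Nil
    by (intro Un_least subsetI; elim CollectE exE conjE; hypsubst; intro diff sm word) auto
  with \<open>ideal E T\<close> have "J \<subseteq> E" unfolding J_def by (rule T.genideal_minimal)
  then have "k [] = \<zero>" using k by (auto simp: E_def)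
  then show "(k \<oplus>\<^bsub>T\<^esub> f) [] = f []" using c[OF f] by (simp add: T_simps)
qed

sublocale augmented_algebra A R augmentation
proof
  fix c d assume "c \<in> carrier A" "d \<in> carrier A"
  then obtain f g where fg: "f \<in> carrier T" "c = J +>\<^bsub>T\<^esub> f" "g \<in> carrier T" "d = J +>\<^bsub>T\<^esub> g"
    by (auto simp: A_carrier)
  have "\<And>w. f w \<in> carrier R" "\<And>w. g w \<in> carrier R" using fg by (simp_all add: T_simps free_module_carrier)
  moreover have "(f \<oplus>\<^bsub>T\<^esub> g) [] = f [] \<oplus> g []" "(f \<otimes>\<^bsub>T\<^esub> g) [] = f [] \<otimes> g []"
    using calculation by (simp_all add: T_simps conv_Nil)
  ultimately show "augmentation (c \<oplus>\<^bsub>A\<^esub> d) = augmentation c \<oplus> augmentation d"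
    "augmentation (c \<otimes>\<^bsub>A\<^esub> d) = augmentation c \<otimes> augmentation d"
    using fg by (simp_all add: A_add A_mult augmentation_coset)
next
  fix c assume "c \<in> carrier A"
  then obtain f where f: "f \<in> carrier T" "c = J +>\<^bsub>T\<^esub> f" by (auto simp: A_carrier)
  then have "f [] \<in> carrier R" by (simp add: T_simps free_module_carrier)
  then show "augmentation c \<in> carrier R" using f by (simp add: augmentation_coset)
next
  show "augmentation \<one>\<^bsub>A\<^esub> = \<one>"
    by (simp add: A_one augmentation_coset) (simp add: T_simps basis_vector_def)
next
  fix r assume r: "r \<in> carrier R"
  then show "r \<odot>\<^bsub>A\<^esub> \<one>\<^bsub>A\<^esub> \<in> carrier A" by simp
  have "(r \<odot>\<^bsub>T\<^esub> \<one>\<^bsub>T\<^esub>) [] = r" using r by (simp add: T_simps basis_vector_def)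
  then show "augmentation (r \<odot>\<^bsub>A\<^esub> \<one>\<^bsub>A\<^esub>) = r"
    using r TM.smult_closed[OF r T.one_closed] by (simp add: A_one A_smult augmentation_coset)
qed

end

section \<open>Separatedness of the regular module for odd n\<close>

locale tl_odd = tl_presentation R a n for R :: "('r, 'z) ring_scheme" (structure) and a n +
  assumes odd: "odd n"
begin

sublocale word_algebra A n W
  by (intro word_algebra.intro word_algebra_axioms.intro A.ring_axioms odd)
    (simp_all add: W_append W_tleq del: One_nat_def)

abbreviation RA :: "((nat list \<Rightarrow> 'r) set, (nat list \<Rightarrow> 'r) set) module" where
  "RA \<equiv> right_regular A"

lemma RA: "right_module A RA"
  by (rule A.right_regular_right_module)

lemma multiple_mem_cups:
  assumes "m < n" "spaced n b v" "1 \<le> b" "1 \<le> i" "i \<le> m" "set w \<subseteq> {1..<n}" "r \<in> carrier R"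
  shows "r \<odot>\<^bsub>A\<^esub> W (w @ i # v) \<in> cups RA v m"
proof -
  have iv: "set (i # v) \<subseteq> {1..<n}" using assms spaced_set[OF assms(2)] by auto
  have "r \<odot>\<^bsub>A\<^esub> W (w @ i # v) = (r \<odot>\<^bsub>A\<^esub> W w) \<otimes>\<^bsub>A\<^esub> W (i # v)"
    using W_append[OF assms(6) iv] A_smult_mult(1)[OF W_closed[OF assms(6)] W_closed[OF iv] assms(7)] by simp
  then show ?thesis
    using cups_mem[OF RA assms(1-5), of "r \<odot>\<^bsub>A\<^esub> W w"] AM.smult_closed[OF assms(7) W_closed[OF assms(6)]] by simp
qed

text \<open>Right multiplication by u creates the arcs of u in every diagram of the
  expansion.\<close>

lemma phi_multiples:
  assumes "spaced n b u" "1 \<le> b" "x \<in> multiples RA u"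
  shows "phi x \<in> carrier (V (\<lambda>p. \<forall>i\<in>set u. arc i p))"
proof -
  have u: "set u \<subseteq> {1..<n}" using spaced_set[OF assms(1)] assms(2) by auto
  obtain c where c: "c \<in> carrier A" "x = c \<otimes>\<^bsub>A\<^esub> W u" using assms(3) by (auto simp: multiples_def)
  have "phi c \<in> carrier V0" by (rule right_linearD(1)[OF phi_linear c(1)])
  moreover have "right_linear R V0 (V (\<lambda>p. \<forall>i\<in>set u. arc i p)) (rho u)"
    by (rule rho_linear) (use run_spaced_arcs[OF _ assms(1)] in auto)
  ultimately show ?thesis using phi_W[OF c(1) u] c(2) right_linearD(1) by fastforce
qed

text \<open>Each summand with last factor U_i v contributes diagrams with arcs at i and at v. In the
  sum the index i varies with the diagram, hence the existential quantifier.\<close>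

lemma phi_cups:
  assumes "spaced n (m + 2) v" "m < n" "x \<in> cups RA v m"
  shows "phi x \<in> carrier (V (\<lambda>p. (\<forall>i\<in>set v. arc i p) \<and> (\<exists>i\<in>{1..m}. arc i p)))"
  using assms
proof (induction m arbitrary: x)
  case 0
  let ?B = "\<lambda>p. (\<forall>i\<in>set v. arc i p) \<and> (\<exists>i\<in>{1..0}. arc i p)"
  interpret VB: right_module R "V ?B" by (rule V_right_module)
  have "phi x = \<zero>\<^bsub>V0\<^esub>"
    using 0 right_linear_zero[OF AM.right_module_axioms V0.right_module_axioms phi_linear] by simp
  then show ?case using VB.M.zero_closed unfolding V_ops(3)[where B = ?B] by (simp only:)
next
  case (Suc m)
  let ?B = "\<lambda>m p. (\<forall>i\<in>set v. arc i p) \<and> (\<exists>i\<in>{1..m}. arc i p)"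
  interpret VB: right_module R "V (?B (Suc m))" by (rule V_right_module)
  obtain s c where s: "s \<in> cups RA v m" "c \<in> carrier A" "x = s \<oplus>\<^bsub>A\<^esub> c \<otimes>\<^bsub>A\<^esub> W (Suc m # v)"
    using Suc.prems(3) by auto
  have v: "spaced n (m + 2) v" "spaced n (Suc m) (Suc m # v)"
    using Suc.prems spaced_mono[of n "Suc m + 2" v "m + 2"] by auto
  have sc: "s \<in> carrier A" using cups_closed[OF RA _ v(1) _ s(1)] Suc.prems by simp
  have "phi s \<in> carrier (V (?B m))" using Suc.IH[OF v(1) _ s(1)] Suc.prems by simp
  then have 1: "phi s \<in> carrier (V (?B (Suc m)))" by (rule V_subset[rotated]) auto
  have "c \<otimes>\<^bsub>A\<^esub> W (Suc m # v) \<in> multiples RA (Suc m # v)" using s(2) by (auto simp: multiples_def)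
  then have "phi (c \<otimes>\<^bsub>A\<^esub> W (Suc m # v)) \<in> carrier (V (\<lambda>p. \<forall>i\<in>set (Suc m # v). arc i p))"
    by (rule phi_multiples[OF v(2), rotated]) simp
  then have 2: "phi (c \<otimes>\<^bsub>A\<^esub> W (Suc m # v)) \<in> carrier (V (?B (Suc m)))" by (rule V_subset[rotated]) auto
  have "W (Suc m # v) \<in> carrier A" using spaced_set[OF v(2)] by (intro W_closed) auto
  then have "phi x = phi s \<oplus>\<^bsub>V0\<^esub> phi (c \<otimes>\<^bsub>A\<^esub> W (Suc m # v))"
    using right_linearD(2)[OF phi_linear sc, of "c \<otimes>\<^bsub>A\<^esub> W (Suc m # v)"] s by simp
  then show ?case using VB.M.a_closed[OF 1 2] unfolding V_ops[where B = "?B (Suc m)"] by simp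
qed

text \<open>In the expansion of x every diagram satisfies both support conditions at once: arcs at m
  + 1 and v, and an arc at some i \<le> m. Arcs are two apart, so i \<le> m - 1, and
  \<open>arcs_right_divisible\<close> divides each diagram by U_i U_(m+1) v. Transport along
  \<open>psi\<close> gives the claim for x.\<close>

lemma separated_regular: "separated RA"
  unfolding separated_def
proof (intro allI impI subsetI)
  fix m v x
  let ?u = "Suc m # v"
  assume m: "Suc m < n" and v: "spaced n (m + 3) v" and x: "x \<in> multiples RA ?u \<inter> cups RA v m"
  have v': "spaced n (m + 2) v" "spaced n 1 ?u" "spaced n (Suc m) ?u"
    using m v spaced_mono[of n "m + 3" v "m + 2"] by (simp_all add: numeral_3_eq_3)
  let ?B = "\<lambda>p. (\<forall>i\<in>set ?u. arc i p) \<and> (\<forall>i\<in>set v. arc i p) \<and> (\<exists>i\<in>{1..m}. arc i p)"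
  have xc: "x \<in> carrier A" using cups_closed[OF RA _ v'(1), of m x] x m by simp
  have S: "r \<odot>\<^bsub>A\<^esub> sec p \<in> cups RA ?u (m - 1)" if p: "matching p" "?B p" and r: "r \<in> carrier R" for r p
  proof (cases "\<exists>w. reduced p w")
    case False
    then have "r \<odot>\<^bsub>A\<^esub> sec p = \<zero>\<^bsub>A\<^esub>" using r by (simp add: sec_def)
    then show ?thesis using cups_zero[OF RA _ v'(2), of "m - 1"] m by simp
  next
    case True
    then obtain w where w: "reduced p w" by blast
    obtain i where i: "1 \<le> i" "i \<le> m" "arc i p" using p(2) by auto
    have "i + 2 \<le> Suc m" using arc_apart[OF p(1) i(3), of "Suc m"] p(2) i(2) by simp
    then have sp: "spaced n 1 (i # ?u)" using i(1) m v by (simp add: numeral_3_eq_3)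
    have "\<forall>j\<in>set (i # ?u). arc j (snd (run w (0, base n)))" using w i(3) p(2) by (auto simp: reduced_def)
    then obtain y where y: "set y \<subseteq> {1..<n}" "tleq n (0, w) (0, y @ i # ?u)"
      using arcs_right_divisible[OF odd sp] w unfolding reduced_def by blast
    have "sec p = W (y @ i # ?u)"
      using sec_reduced[OF w] W_tleq[OF _ y(2)] w by (simp add: reduced_def)
    then show ?thesis
      using multiple_mem_cups[OF _ v'(2) _ i(1) _ y(1) r, of "m - 1"] m \<open>i + 2 \<le> Suc m\<close> by simp
  qed
  have psi_mem: "psi y \<in> cups RA ?u (m - 1)" if "y \<in> carrier (V ?B)" for y
    using that unfolding V_def[of ?B]
  proof (induction y rule: free_module_induct)
    case zero
    have "psi \<zero>\<^bsub>V0\<^esub> = \<zero>\<^bsub>A\<^esub>" by (rule right_linear_zero[OF V0.right_module_axioms AM.right_module_axioms psi_linear])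
    then show ?case using cups_zero[OF RA _ v'(2), of "m - 1"] m by (simp add: V_def)
  next
    case (add f g)
    have "f \<in> carrier V0" "g \<in> carrier V0" 
      using add(1,2) V_subset[of ?B "\<lambda>p. True"] unfolding V_def[of ?B] by auto
    from right_linearD(2)[OF psi_linear this] cups_add[OF RA _ v'(2) _ add(3,4)] m
    show ?case by (simp add: V_def)
  next
    case (basis r p)
    then have "psi (r \<odot>\<^bsub>V0\<^esub> dg p) = r \<odot>\<^bsub>A\<^esub> sec p"
      using right_linearD(3)[OF psi_linear dg_closed, of p r] by (simp add: psi_dg)
    then show ?case using S[of p r] basis by (simp add: V_def)
  qed
  have "phi x \<in> carrier (V ?B)"
    using x m by (intro V_Int[OF phi_multiples[OF v'(2)] phi_cups[OF v'(1)]]) simp_all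
  then have "psi (phi x) \<in> cups RA ?u (m - 1)" by (rule psi_mem)
  then show "x \<in> cups RA ?u (m - 1)" by (simp only: psi_phi[OF xc])
qed

sublocale tl_algebra A n W R augmentation
proof
  show "separated RA" by (rule separated_regular)
next
  fix i assume "1 \<le> i" "i < n"
  then show "augmentation (W [i]) = \<zero>"
    using letter_closed[of i] by (simp add: W_def augmentation_coset) (simp add: basis_vector_def)
next
  fix c assume "c \<in> carrier A" "augmentation c = \<zero>"
  then obtain f where f: "f \<in> carrier T" "c = J +>\<^bsub>T\<^esub> f" "f [] = \<zero>" by (auto simp: A_carrier augmentation_coset)
  have n: "n - 1 < n" using odd by (cases n) auto
  \<comment> \<open>Without constant coefficient, f is a combination of nonempty words, and the
    class of such a word lies in A U_i for its last letter i.\<close>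
  have "f \<in> carrier (free_module R (lists {1..<n} - {[]}))"
    using f(1,3) by (auto simp: T_simps free_module_carrier)
  then have "J +>\<^bsub>T\<^esub> f \<in> cups RA [] (n - 1)"
  proof (induction f rule: free_module_induct)
    case zero
    then show ?case using J_zero cups_zero[OF RA n, of 1 "[]"] by (simp add: T_simps)
  next
    case (add f g)
    have "f \<in> carrier T" "g \<in> carrier T"
      using add(1,2) free_module_mono[of "lists {1..<n} - {[]}" "lists {1..<n}" R] by (auto simp: T_simps)
    then show ?case using A_add[of f g] cups_add[OF RA n _ _ add(3,4), of 1] by (simp add: T_simps)
  next
    case (basis r w)
    then have w: "set w \<subseteq> {1..<n}" "w \<noteq> []" by (auto simp: in_lists_conv_set)
    then obtain y i where y: "w = y @ [i]" by (metis rev_exhaust)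
    have "r \<odot>\<^bsub>A\<^esub> W (y @ [i]) \<in> cups RA [] (n - 1)"
      by (rule multiple_mem_cups[OF n, of 1]) (use w y basis(1) in auto)
    moreover have "r \<odot>\<^bsub>A\<^esub> W (y @ [i]) = J +>\<^bsub>T\<^esub> (r \<odot>\<^bsub>T\<^esub> word w)"
      using A_smult[OF basis(1) word_closed[OF w(1)]] by (simp add: W_def y)
    ultimately show ?case by (simp add: T_simps)
  qed
  then show "c \<in> cups RA [] (n - 1)" using f(2) by simp
qed

end

theorem theoremA:
  fixes R (structure) and n :: nat
  assumes "cring R" and "a \<in> carrier R" and "odd n"
  shows "module_iso R (tl_homology R n a (trivial_module R) 0) (ring_as_module R id) \<noteq> {}
    \<and> (\<forall>k>0. carrier (tl_homology R n a (trivial_module R) k)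
              = {\<zero>\<^bsub>tl_homology R n a (trivial_module R) k\<^esub>})"
proof -
  interpret tl_odd R a n
    using assms by (intro tl_odd.intro tl_presentation.intro tl_presentation_axioms.intro tl_odd_axioms.intro)
  have "carrier (tl_homology R n a (trivial_module R) k) = {\<zero>\<^bsub>tl_homology R n a (trivial_module R) k\<^esub>}"
    if "k > 0" for k
  proof -
    obtain j where "k = Suc j" using \<open>k > 0\<close> by (cases k) auto
    then show ?thesis unfolding tl_homology_def trivial_module_def using tor_positive by blast
  qed
  moreover have "module_iso R (tl_homology R n a (trivial_module R) 0) (ring_as_module R id) \<noteq> {}"
    unfolding tl_homology_def trivial_module_def by (rule tor_zero)
  ultimately show ?thesis by blast
qed

end
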